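(* Let $d_n=[z^n]D(z)$ be the total weight of excursions of length $n$ ending with a catastrophe. Then: (i) if $\rho_0<\rho$, then $d_n=\frac{\rho_0^{-n}}{\rho_0Q'(\rho_0)}+o(K^n)$ for some $K<1/\rho_0$; (ii) if $\rho_0=\rho$, then $d_n=\frac{\rho^{-n}}{\eta\sqrt{\pi n}}\big(1+O(1/n)\big)$; (iii) if $\rho_0$ does not exist, then $d_n=\frac{D(\rho)^2\eta\,\rho^{-n}}{2\sqrt{\pi n^3}}\big(1+O(1/n)\big)$. The last two cases occur only when $\delta<0$.
   Context: Fix integers $c,d\ge1$ and non-negative real weights $p_{-c},\dots,p_d$ with $p_{-c}\neq0\neq p_d$; jump set $\mathcal J=\{i: p_i\neq0\}$, jump polynomial $P(u)=\sum_{i=-c}^dp_iu^i$. Standing assumption: $P$ is aperiodic (there are no integer $b$, integer $p\ge2$ and Laurent polynomial $H$ with $P(u)=u^bH(u^p)$). A catastrophe is a step from an altitude $h>0$ with $-h\notin\mathcal J$ directly to altitude $0$, of weight $q>0$. Paths start at altitude $0$; each step is a jump $i\in\mathcal J$ (weight $p_i$) or a catastrophe; the weight of a path is the product of its step weights, and "number" means total weight. Meanders never go below $0$; excursions are meanders ending at $0$. Let $M(z,u)=\sum m_{n,k}z^nu^k$, with $m_{n,k}$ the total weight of catastrophe-free meanders of length $n$ ending at altitude $k$; $M_k(z)=[u^k]M(z,u)$, $M(z)=M(z,1)$, $E(z)=M_0(z)$. Let $Q(z)=zq\big(M(z)-E(z)-\sum_{j>0,-j\in\mathcal J}M_j(z)\big)$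 and $D(z)=1/(1-Q(z))$ (the generating function of excursions that are empty or end with a catastrophe). Let $\tau>0$ be the minimal positive real solution of $P'(\tau)=0$, $\rho=1/P(\tau)$, $\delta=P'(1)$. Let $\rho_0$ be the smallest positive real zero of $1-Q(z)$ satisfying $\rho_0\le\rho$, if it exists ("$\rho_0$ does not exist" otherwise). In the cases $\rho_0=\rho$ or $\rho_0$ nonexistent, $\eta$ is defined by the Puiseux expansion $Q(z)=Q(\rho)-\eta\sqrt{1-z/\rho}+O(1-z/\rho)$ as $z\to\rho$. *)

theory Defs
  imports "HOL-Analysis.Analysis" "HOL-Computational_Algebra.Formal_Power_Series"
    "HOL-Library.Landau_Symbols"
begin

text \<open>Jump weights are a function p :: int => real (p i = weight of jump i);
  the jump set is J = {i. p i \<noteq> 0}; q > 0 is the catastrophe weight.\<close>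

definition jumps :: "(int \<Rightarrow> real) \<Rightarrow> int set" where
  "jumps p = {i. p i \<noteq> 0}"

definition jumpP :: "(int \<Rightarrow> real) \<Rightarrow> real \<Rightarrow> real" where
  "jumpP p u = (\<Sum>i\<in>jumps p. p i * u powi i)"

definition jumpP' :: "(int \<Rightarrow> real) \<Rightarrow> real \<Rightarrow> real" where
  "jumpP' p u = (\<Sum>i\<in>jumps p. p i * of_int i * u powi (i - 1))"

definition aperiodic :: "(int \<Rightarrow> real) \<Rightarrow> bool" where
  "aperiodic p \<longleftrightarrow> \<not> (\<exists>(b::int) (per::nat) (h::int \<Rightarrow> real).
      per \<ge> 2 \<and> finite {j. h j \<noteq> 0} \<and>
      (\<forall>u::real. u \<noteq> 0 \<longrightarrow>
         jumpP p u = u powi b * (\<Sum>j\<in>{j. h j \<noteq> 0}. h j * (u ^ per) powi j)))"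

definition tau :: "(int \<Rightarrow> real) \<Rightarrow> real" where
  "tau p = (THE t. t > 0 \<and> jumpP' p t = 0 \<and> (\<forall>u. u > 0 \<and> jumpP' p u = 0 \<longrightarrow> t \<le> u))"

definition rho :: "(int \<Rightarrow> real) \<Rightarrow> real" where
  "rho p = 1 / jumpP p (tau p)"

definition drift :: "(int \<Rightarrow> real) \<Rightarrow> real" where
  "drift p = jumpP' p 1"

definition meanders :: "(int \<Rightarrow> real) \<Rightarrow> nat \<Rightarrow> int list set" where
  "meanders p n = {xs. length xs = n \<and> set xs \<subseteq> jumps p \<and>
       (\<forall>i\<le>n. 0 \<le> sum_list (take i xs))}"

definition path_weight :: "(int \<Rightarrow> real) \<Rightarrow> int list \<Rightarrow> real" where
  "path_weight p xs = prod_list (map p xs)"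

definition meander_count :: "(int \<Rightarrow> real) \<Rightarrow> nat \<Rightarrow> int \<Rightarrow> real" where
  "meander_count p n k = (\<Sum>xs\<in>{xs\<in>meanders p n. sum_list xs = k}. path_weight p xs)"

definition Mk :: "(int \<Rightarrow> real) \<Rightarrow> int \<Rightarrow> real fps" where
  "Mk p k = Abs_fps (\<lambda>n. meander_count p n k)"

definition Mall :: "(int \<Rightarrow> real) \<Rightarrow> real fps" where
  "Mall p = Abs_fps (\<lambda>n. \<Sum>xs\<in>meanders p n. path_weight p xs)"

definition Efps :: "(int \<Rightarrow> real) \<Rightarrow> real fps" where
  "Efps p = Mk p 0"

definition Qfps :: "(int \<Rightarrow> real) \<Rightarrow> real \<Rightarrow> real fps" where
  "Qfps p q = fps_X * fps_const q *
     (Mall p - Efps p - (\<Sum>j\<in>{j::int. j > 0 \<and> -j \<in> jumps p}. Mk p j))"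

definition Dfps :: "(int \<Rightarrow> real) \<Rightarrow> real \<Rightarrow> real fps" where
  "Dfps p q = inverse (1 - Qfps p q)"

definition Qfun :: "(int \<Rightarrow> real) \<Rightarrow> real \<Rightarrow> real \<Rightarrow> real" where
  "Qfun p q z = (\<Sum>n. fps_nth (Qfps p q) n * z ^ n)"

definition Qder :: "(int \<Rightarrow> real) \<Rightarrow> real \<Rightarrow> real \<Rightarrow> real" where
  "Qder p q z = (\<Sum>n. fps_nth (fps_deriv (Qfps p q)) n * z ^ n)"

definition rho0_set :: "(int \<Rightarrow> real) \<Rightarrow> real \<Rightarrow> real set" where
  "rho0_set p q = {z. 0 < z \<and> z \<le> rho p \<and> (\<lambda>n. fps_nth (Qfps p q) n * z ^ n) sums 1}"

definition rho0_exists :: "(int \<Rightarrow> real) \<Rightarrow> real \<Rightarrow> bool" where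
  "rho0_exists p q \<longleftrightarrow> rho0_set p q \<noteq> {}"

definition rho0 :: "(int \<Rightarrow> real) \<Rightarrow> real \<Rightarrow> real" where
  "rho0 p q = Inf (rho0_set p q)"

definition puiseux_eta :: "(int \<Rightarrow> real) \<Rightarrow> real \<Rightarrow> real \<Rightarrow> bool" where
  "puiseux_eta p q eta \<longleftrightarrow>
     summable (\<lambda>n. fps_nth (Qfps p q) n * rho p ^ n) \<and>
     (\<lambda>z. Qfun p q z - (Qfun p q (rho p) - eta * sqrt (1 - z / rho p)))
        \<in> O[at_left (rho p)](\<lambda>z. 1 - z / rho p)"

end

theory Submission
  imports Defs "HOL-Complex_Analysis.Complex_Analysis" "HOL-Probability.Probability" "HOL-Real_Asymp.Real_Asymp"
begin

text \<open>By Spitzer's identity the logarithmic derivatives of the meander generating functions are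
  the series of the coefficients of \<open>P(u)^n\<close>. If the drift is negative then \<open>\<tau> > 1\<close>, and a local limit
  theorem with relative error \<open>O(1/n)\<close> at the saddle point shows that, after rescaling by \<open>\<rho>\<close>, these
  coefficients are \<open>a n^(-1/2) + O(n^(-3/2))\<close>. The series of the form \<open>b s + g\<close> with \<open>s = (1 - z)^(1/2)\<close> and
  \<open>g_n = O(n^(-5/2))\<close> form an algebra that is closed under exponentials, and under inverses by a
  Wiener lemma for power weights; hence \<open>Q\<close> lies in it, and the coefficients of \<open>1 / (1 - Q)\<close> are read
  off without analytic continuation. Only a simple pole inside the disc of convergence needs complex
  analysis.

  If the drift is non-negative, the expectation of (height + 1) along surviving paths is
  non-decreasing, so a meander of length \<open>n\<close> survives with probability at least \<open>1 / (d n + 1)\<close>.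
  Hence \<open>Q\<close> diverges at \<open>1 / P(1) \<le> \<rho>\<close> and takes the value 1 before.\<close>


text \<open>The required relative error O(1/n) dictates the exponents. An error O(n^(-3/2)) in a
  logarithmic derivative becomes O(n^(-5/2)) after division by n, and 5/2 is enough for a remainder
  g to have a finite first moment, sum of n |g_n|. This makes g Lipschitz at 1 and lets s g be
  replaced by g(1) s within the same error. A limit theorem without a rate could not feed this
  calculus, so the cubic term of the characteristic function is tracked until it integrates to 0 by
  symmetry.

  The sign of the drift matters because M(z) sums over all altitudes: at the saddle point altitude k
  carries the weight tau^(-k), and the sum over k converges only if tau > 1. Aperiodicity enters
  through the local limit theorem; that 1 - Q has no second zero on its circle comes instead from
  the positivity of all late coefficients of Q. The calculus gives Q = b s + g with b of unknown
  sign. Excursions, followed by a climb and a catastrophe, bound the coefficients of Q from below by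
  a multiple of n^(-3/2), which forces b < 0 and so eta > 0.\<close>

section \<open>Power series with coefficients of polynomial decay\<close>

definition decay :: "real \<Rightarrow> 'a::real_normed_field fps \<Rightarrow> bool" where
  "decay \<alpha> f \<longleftrightarrow> (\<exists>C. \<forall>n. norm (fps_nth f n) \<le> C * (real n + 1) powr - \<alpha>)"

lemma decayI: "(\<And>n. norm (fps_nth f n) \<le> C * (real n + 1) powr - \<alpha>) \<Longrightarrow> decay \<alpha> f"
  unfolding decay_def by blast

lemma decayE:
  assumes "decay \<alpha> f"
  obtains C where "C > 0" "\<And>n. norm (fps_nth f n) \<le> C * (real n + 1) powr - \<alpha>"
proof -
  obtain C where C: "\<And>n. norm (fps_nth f n) \<le> C * (real n + 1) powr - \<alpha>"
    using assms unfolding decay_def by blast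
  have "norm (fps_nth f n) \<le> (\<bar>C\<bar> + 1) * (real n + 1) powr - \<alpha>" for n
    by (rule order.trans[OF C mult_right_mono]) auto
  then show ?thesis using that[of "\<bar>C\<bar> + 1"] by auto
qed

lemma decay_add:
  assumes "decay \<alpha> f" "decay \<alpha> g"
  shows "decay \<alpha> (f + g)"
proof -
  obtain C D where "\<And>n. norm (fps_nth f n) \<le> C * (real n + 1) powr - \<alpha>"
    "\<And>n. norm (fps_nth g n) \<le> D * (real n + 1) powr - \<alpha>"
    using assms unfolding decay_def by blast
  then have "norm (fps_nth (f + g) n) \<le> (C + D) * (real n + 1) powr - \<alpha>" for n
    unfolding fps_add_nth distrib_right by (intro norm_triangle_le add_mono)
  then show ?thesis by (rule decayI)
qed

lemma decay_uminus: "decay \<alpha> f \<Longrightarrow> decay \<alpha> (- f)"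
  unfolding decay_def by simp

lemma decay_diff: "decay \<alpha> f \<Longrightarrow> decay \<alpha> g \<Longrightarrow> decay \<alpha> (f - g)"
  using decay_add[of \<alpha> f "- g"] decay_uminus by fastforce

lemma decay_cmult: 
  assumes "decay \<alpha> f" shows "decay \<alpha> (fps_const c * f)"
proof -
  obtain C where "\<And>n. norm (fps_nth f n) \<le> C * (real n + 1) powr - \<alpha>"
    using assms unfolding decay_def by blast
  then have "norm (fps_nth (fps_const c * f) n) \<le> (norm c * C) * (real n + 1) powr - \<alpha>" for n
    by (simp add: norm_mult mult_left_mono mult.assoc)
  then show ?thesis by (rule decayI)
qed

lemma decay_eventually_0:
  assumes "\<And>n. n \<ge> N \<Longrightarrow> fps_nth f n = 0"
  shows "decay \<alpha> f"
proof (rule decayI)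
  fix n
  define C where "C = (\<Sum>k<N. norm (fps_nth f k) * (real k + 1) powr \<alpha>)"
  have C0: "C \<ge> 0" unfolding C_def by (intro sum_nonneg) auto
  show "norm (fps_nth f n) \<le> C * (real n + 1) powr - \<alpha>"
  proof (cases "n < N")
    case True
    then have "norm (fps_nth f n) * (real n + 1) powr \<alpha> \<le> C"
      unfolding C_def by (intro member_le_sum) auto
    then show ?thesis by (simp add: powr_minus field_simps)
  next
    case False
    then show ?thesis using assms C0 by auto
  qed
qed

lemma decay_0: "decay \<alpha> 0" by (rule decay_eventually_0[of 0]) simp
lemma decay_1: "decay \<alpha> 1" by (rule decay_eventually_0[of 1]) simp
lemma decay_const: "decay \<alpha> (fps_const c)" by (rule decay_eventually_0[of 1]) simp
lemma decay_X: "decay \<alpha> fps_X" by (rule decay_eventually_0[of 2]) (simp add: fps_X_def)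

lemma decay_sum: "(\<And>i. i \<in> I \<Longrightarrow> decay \<alpha> (f i)) \<Longrightarrow> decay \<alpha> (\<Sum>i\<in>I. f i)"
  by (induction I rule: infinite_finite_induct) (auto intro: decay_0 decay_add)

lemma decay_mono:
  assumes "decay \<alpha> f" "\<beta> \<le> \<alpha>"
  shows "decay \<beta> f"
proof -
  obtain C where C: "C > 0" "\<And>n. norm (fps_nth f n) \<le> C * (real n + 1) powr - \<alpha>"
    using decayE[OF assms(1)] by blast
  have "norm (fps_nth f n) \<le> C * (real n + 1) powr - \<beta>" for n
    by (rule order.trans[OF C(2) mult_left_mono]) (use C assms in \<open>auto intro: powr_mono\<close>)
  then show ?thesis by (rule decayI)
qed

lemma summable_powr_shift:
  assumes "\<alpha> > 1"
  shows "summable (\<lambda>n. (real n + 1) powr - \<alpha>)"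
proof -
  have "summable (\<lambda>n. real (n + 1) powr - \<alpha>)"
    using assms by (subst summable_iff_shift) (simp add: summable_real_powr_iff)
  then show ?thesis by (simp add: add.commute)
qed

lemma decay_summable:
  assumes "decay \<alpha> f" "\<alpha> > 1"
  shows "summable (\<lambda>n. norm (fps_nth f n))"
proof -
  obtain C where "C > 0" "\<And>n. norm (fps_nth f n) \<le> C * (real n + 1) powr - \<alpha>"
    using decayE[OF assms(1)] by blast
  then show ?thesis
    by (intro summable_comparison_test'[OF summable_mult[OF summable_powr_shift[OF assms(2)], of C]]) auto
qed

lemma decay_summable_of_nat:
  assumes "decay \<alpha> f" "\<alpha> > 2"
  shows "summable (\<lambda>n. real n * norm (fps_nth f n))"
proof -
  obtain C where C: "C > 0" "\<And>n. norm (fps_nth f n) \<le> C * (real n + 1) powr - \<alpha>"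
    using decayE[OF assms(1)] by blast
  have "real n * norm (fps_nth f n) \<le> C * (real n + 1) powr - (\<alpha> - 1)" for n
  proof -
    have "real n * norm (fps_nth f n) \<le> (real n + 1) * (C * (real n + 1) powr - \<alpha>)"
      by (intro mult_mono C) auto
    also have "\<dots> = C * (real n + 1) powr (1 + - \<alpha>)"
      by (subst powr_add) simp
    finally show ?thesis by (simp add: algebra_simps)
  qed
  then show ?thesis using assms(2)
    by (intro summable_comparison_test'[OF summable_mult[OF summable_powr_shift[of "\<alpha> - 1"], of C]]) auto
qed

subsection \<open>Convolution and powers\<close>

lemma fps_mult_l1_bound:
  fixes f g :: "'a::real_normed_field fps"
  assumes f: "\<And>n. (\<Sum>i\<le>n. norm (fps_nth f i)) \<le> S" and g: "\<And>n. (\<Sum>i\<le>n. norm (fps_nth g i)) \<le> T"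
  shows "(\<Sum>i\<le>n. norm (fps_nth (f * g) i)) \<le> S * T"
proof -
  have S0: "S \<ge> 0" using order.trans[OF sum_nonneg f[of 0]] by simp
  have T0: "T \<ge> 0" using order.trans[OF sum_nonneg g[of 0]] by simp
  have "(\<Sum>m\<le>n. norm (fps_nth (f * g) m)) \<le> (\<Sum>m\<le>n. \<Sum>i\<le>m. norm (fps_nth f i) * norm (fps_nth g (m - i)))"
    by (intro sum_mono) (auto simp: fps_mult_nth atLeast0AtMost norm_mult intro!: sum_norm_le)
  also have "\<dots> = (\<Sum>(i,j)\<in>{(i,j). i + j \<le> n}. norm (fps_nth f i) * norm (fps_nth g j))"
    by (rule sum.triangle_reindex_eq[symmetric])
  also have "\<dots> \<le> (\<Sum>(i,j)\<in>{..n} \<times> {..n}. norm (fps_nth f i) * norm (fps_nth g j))"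
    by (intro sum_mono2) auto
  also have "\<dots> = (\<Sum>i\<le>n. norm (fps_nth f i)) * (\<Sum>j\<le>n. norm (fps_nth g j))"
    by (simp add: sum_product sum.cartesian_product)
  also have "\<dots> \<le> S * T" by (intro mult_mono f g S0 sum_nonneg) auto
  finally show ?thesis .
qed

text \<open>If i + j = n then i + 1 is at least the fraction lam of n + 1, or j + 1 at least the fraction mu;
  with lam = k / (k + 1) the resulting bound for powers telescopes to a polynomial factor in k.\<close>

lemma fps_mult_decay_bound:
  fixes f g :: "'a::real_normed_field fps"
  assumes lm: "lam > 0" "mu > 0" "lam + mu = 1" and "\<alpha> \<ge> 0"
    and f: "\<And>n. norm (fps_nth f n) \<le> A * (real n + 1) powr - \<alpha>"
    and g: "\<And>n. norm (fps_nth g n) \<le> B * (real n + 1) powr - \<alpha>"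
    and S: "\<And>n. (\<Sum>i\<le>n. norm (fps_nth f i)) \<le> S" and T: "\<And>n. (\<Sum>i\<le>n. norm (fps_nth g i)) \<le> T"
  shows "norm (fps_nth (f * g) n) \<le> (lam powr - \<alpha> * A * T + mu powr - \<alpha> * S * B) * (real n + 1) powr - \<alpha>"
proof -
  have A0: "A \<ge> 0" using order.trans[OF norm_ge_zero f[of 0]] by simp
  have B0: "B \<ge> 0" using order.trans[OF norm_ge_zero g[of 0]] by simp
  define w where "w = (real n + 1) powr - \<alpha>"
  have w0: "w \<ge> 0" by (simp add: w_def)
  have key: "norm (fps_nth f i) * norm (fps_nth g (n - i)) \<le>
      lam powr - \<alpha> * A * w * norm (fps_nth g (n - i)) + mu powr - \<alpha> * B * w * norm (fps_nth f i)" 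
    if i: "i \<le> n" for i
  proof (cases "real i + 1 \<ge> lam * (real n + 1)")
    case True
    then have "(real i + 1) powr - \<alpha> \<le> (lam * (real n + 1)) powr - \<alpha>"
      using lm \<open>\<alpha> \<ge> 0\<close> by (intro powr_mono2') auto
    also have "\<dots> = lam powr - \<alpha> * w" using lm by (simp add: powr_mult w_def)
    finally have "norm (fps_nth f i) \<le> A * (lam powr - \<alpha> * w)"
      by (intro order.trans[OF f] mult_left_mono A0)
    then have "norm (fps_nth f i) * norm (fps_nth g (n - i)) \<le> (A * (lam powr - \<alpha> * w)) * norm (fps_nth g (n - i))"
      by (intro mult_right_mono) auto
    moreover have "mu powr - \<alpha> * B * w * norm (fps_nth f i) \<ge> 0" using B0 w0 by simp
    ultimately show ?thesis by (simp add: mult_ac)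
  next
    case False
    then have "real (n - i) + 1 \<ge> (1 - lam) * (real n + 1)" using i by (simp add: algebra_simps of_nat_diff)
    moreover have "mu = 1 - lam" using lm by simp
    ultimately have "real (n - i) + 1 \<ge> mu * (real n + 1)" by simp
    then have "(real (n - i) + 1) powr - \<alpha> \<le> (mu * (real n + 1)) powr - \<alpha>"
      using lm \<open>\<alpha> \<ge> 0\<close> by (intro powr_mono2') auto
    also have "\<dots> = mu powr - \<alpha> * w" using lm by (simp add: powr_mult w_def)
    finally have "norm (fps_nth g (n - i)) \<le> B * (mu powr - \<alpha> * w)"
      by (intro order.trans[OF g] mult_left_mono B0)
    then have "norm (fps_nth f i) * norm (fps_nth g (n - i)) \<le> norm (fps_nth f i) * (B * (mu powr - \<alpha> * w))"
      by (intro mult_left_mono) auto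
    moreover have "lam powr - \<alpha> * A * w * norm (fps_nth g (n - i)) \<ge> 0" using A0 w0 by simp
    ultimately show ?thesis by (simp add: mult_ac)
  qed
  have "norm (fps_nth (f * g) n) \<le> (\<Sum>i\<le>n. norm (fps_nth f i) * norm (fps_nth g (n - i)))"
    by (auto simp: fps_mult_nth atLeast0AtMost norm_mult intro!: sum_norm_le)
  also have "\<dots> \<le> (\<Sum>i\<le>n. lam powr - \<alpha> * A * w * norm (fps_nth g (n - i)) + mu powr - \<alpha> * B * w * norm (fps_nth f i))"
    by (intro sum_mono key) auto
  also have "\<dots> = lam powr - \<alpha> * A * w * (\<Sum>i\<le>n. norm (fps_nth g (n - i))) + mu powr - \<alpha> * B * w * (\<Sum>i\<le>n. norm (fps_nth f i))"
    by (simp add: sum.distrib sum_distrib_left)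
  also have "(\<Sum>i\<le>n. norm (fps_nth g (n - i))) = (\<Sum>i\<le>n. norm (fps_nth g i))"
    by (rule sum.nat_diff_reindex[of _ "Suc n", unfolded lessThan_Suc_atMost, simplified])
  also have "lam powr - \<alpha> * A * w * (\<Sum>i\<le>n. norm (fps_nth g i)) + mu powr - \<alpha> * B * w * (\<Sum>i\<le>n. norm (fps_nth f i))
      \<le> lam powr - \<alpha> * A * w * T + mu powr - \<alpha> * B * w * S"
    using A0 B0 w0 by (intro add_mono mult_left_mono S T) auto
  also have "\<dots> = (lam powr - \<alpha> * A * T + mu powr - \<alpha> * S * B) * w" by (simp add: algebra_simps)
  finally show ?thesis by (simp add: w_def)
qed

lemma decay_partial_sums:
  assumes "decay \<alpha> f" "\<alpha> > 1"
  shows "(\<Sum>i\<le>n. norm (fps_nth f i)) \<le> (\<Sum>i. norm (fps_nth f i))"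
  by (rule sum_le_suminf[OF decay_summable[OF assms]]) auto

lemma decay_mult:
  assumes "decay \<alpha> f" "decay \<alpha> g" "\<alpha> > 1"
  shows "decay \<alpha> (f * g)"
proof -
  obtain A where A: "A > 0" "\<And>n. norm (fps_nth f n) \<le> A * (real n + 1) powr - \<alpha>"
    using decayE[OF assms(1)] by blast
  obtain B where B: "B > 0" "\<And>n. norm (fps_nth g n) \<le> B * (real n + 1) powr - \<alpha>"
    using decayE[OF assms(2)] by blast
  show ?thesis
    by (rule decayI, rule fps_mult_decay_bound[of "1/2" "1/2"])
      (use assms A B decay_partial_sums in auto)
qed

text \<open>The split point moves with k on purpose: cutting every convolution in the middle would
  cost a factor 2^\<alpha> per multiplication, which would destroy the ratio 1/2 of the Neumann
  series in \<open>decay_inverse_complex\<close>. The l1 bound is part of the induction because each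
  convolution step needs it.\<close>

lemma fps_power_decay_bound:
  fixes f :: "'a::real_normed_field fps"
  assumes "\<alpha> \<ge> 0"
    and f: "\<And>n. norm (fps_nth f n) \<le> A * (real n + 1) powr - \<alpha>"
    and S: "\<And>n. (\<Sum>i\<le>n. norm (fps_nth f i)) \<le> S"
  shows "norm (fps_nth (f ^ Suc k) n) \<le> (real k + 1) powr (\<alpha> + 1) * S ^ k * A * (real n + 1) powr - \<alpha> \<and>
         (\<Sum>i\<le>n. norm (fps_nth (f ^ Suc k) i)) \<le> S ^ Suc k"
proof (induction k arbitrary: n)
  case 0
  then show ?case using f S by simp
next
  case (Suc k)
  define lam mu where "lam = (real k + 1) / (real k + 2)" and "mu = 1 / (real k + 2)"
  have lm: "lam > 0" "mu > 0" "lam + mu = 1" by (auto simp: lam_def mu_def field_simps)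
  have "norm (fps_nth (f ^ Suc k * f) n) \<le> (lam powr - \<alpha> * ((real k + 1) powr (\<alpha> + 1) * S ^ k * A) * S + mu powr - \<alpha> * S ^ Suc k * A) * (real n + 1) powr - \<alpha>"
    using fps_mult_decay_bound[OF lm assms(1), of "f ^ Suc k" "(real k + 1) powr (\<alpha> + 1) * S ^ k * A" f A "S ^ Suc k" S] Suc f S
    by (simp add: mult_ac)
  also have "lam powr - \<alpha> * ((real k + 1) powr (\<alpha> + 1) * S ^ k * A) * S + mu powr - \<alpha> * S ^ Suc k * A
       = (real k + 2) powr (\<alpha> + 1) * S ^ Suc k * A"
  proof -
    \<comment> \<open>Both summands then carry (k + 2)^\<alpha>, with the factors k + 1 and 1; this
      is what fixes the exponent \<alpha> + 1 in the claim.\<close>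
    have 1: "lam powr - \<alpha> * (real k + 1) powr (\<alpha> + 1) = (real k + 2) powr \<alpha> * (real k + 1)"
      by (simp add: lam_def powr_divide powr_minus powr_add field_simps)
    have 2: "mu powr - \<alpha> = (real k + 2) powr \<alpha>"
      by (simp add: mu_def powr_divide powr_minus field_simps)
    have "lam powr - \<alpha> * ((real k + 1) powr (\<alpha> + 1) * S ^ k * A) * S + mu powr - \<alpha> * S ^ Suc k * A
      = (lam powr - \<alpha> * (real k + 1) powr (\<alpha> + 1)) * (S ^ Suc k * A) + mu powr - \<alpha> * (S ^ Suc k * A)"
      by (simp add: algebra_simps)
    also have "\<dots> = (real k + 2) powr \<alpha> * (real k + 2) * (S ^ Suc k * A)"
      unfolding 1 2 by (simp add: algebra_simps)
    also have "(real k + 2) powr \<alpha> * (real k + 2) = (real k + 2) powr (\<alpha> + 1)"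
      by (simp add: powr_add)
    finally show ?thesis by (simp add: mult_ac)
  qed
  finally have "norm (fps_nth (f ^ Suc (Suc k)) n) \<le> (real (Suc k) + 1) powr (\<alpha> + 1) * S ^ Suc k * A * (real n + 1) powr - \<alpha>"
    by (simp add: mult_ac add_ac)
  moreover have "(\<Sum>i\<le>n. norm (fps_nth (f ^ Suc k * f) i)) \<le> S ^ Suc k * S"
    by (rule fps_mult_l1_bound) (use Suc S in auto)
  ultimately show ?case by (simp add: mult_ac)
qed

text \<open>Only finitely many k contribute to each coefficient, so a summable majorant of the
  weighted powers, uniform in n, is all that a composition needs.\<close>

lemma decay_compose:
  fixes a f :: "'a::real_normed_field fps"
  assumes c: "\<And>k n. norm (fps_nth (f ^ k) n) \<le> c k * (real n + 1) powr - \<alpha>"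
    and sm: "summable (\<lambda>k. norm (fps_nth a k) * c k)"
  shows "decay \<alpha> (a oo f)"
proof (rule decayI)
  fix n
  have c0: "c k \<ge> 0" for k using order.trans[OF norm_ge_zero c[of k 0]] by simp
  have "norm (fps_nth (a oo f) n) \<le> (\<Sum>k\<in>{0..n}. norm (fps_nth a k) * (c k * (real n + 1) powr - \<alpha>))"
    unfolding fps_compose_nth by (rule sum_norm_le) (auto simp: norm_mult intro!: mult_left_mono c)
  also have "\<dots> = (\<Sum>k\<in>{0..n}. norm (fps_nth a k) * c k) * (real n + 1) powr - \<alpha>"
    by (simp add: sum_distrib_right mult.assoc)
  also have "\<dots> \<le> (\<Sum>k. norm (fps_nth a k) * c k) * (real n + 1) powr - \<alpha>"
    by (intro mult_right_mono sum_le_suminf sm) (auto intro!: mult_nonneg_nonneg c0)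
  finally show "norm (fps_nth (a oo f) n) \<le> (\<Sum>k. norm (fps_nth a k) * c k) * (real n + 1) powr - \<alpha>" .
qed

lemma decay_exp_compose:
  fixes f :: "real fps"
  assumes "decay \<alpha> f" "\<alpha> > 1"
  shows "decay \<alpha> (fps_exp 1 oo f)"
proof -
  obtain A where A: "A > 0" "\<And>n. norm (fps_nth f n) \<le> A * (real n + 1) powr - \<alpha>"
    using decayE[OF assms(1)] by blast
  define S where "S = (\<Sum>i. norm (fps_nth f i)) + 1"
  have S: "(\<Sum>i\<le>n. norm (fps_nth f i)) \<le> S" for n
    using decay_partial_sums[OF assms, of n] by (simp add: S_def)
  have S0: "S > 0" unfolding S_def 
    by (intro add_nonneg_pos suminf_nonneg decay_summable[OF assms]) auto
  define c where "c k = (if k = 0 then 1 else real k powr (\<alpha> + 1) * S ^ (k - 1) * A)" for k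
  show ?thesis
  proof (rule decay_compose[where c = c])
    fix k n
    show "norm (fps_nth (f ^ k) n) \<le> c k * (real n + 1) powr - \<alpha>"
    proof (cases k)
      case 0
      then show ?thesis by (cases n) (auto simp: c_def)
    next
      case (Suc j)
      then show ?thesis using fps_power_decay_bound[of \<alpha> f A S j n] assms A S by (auto simp: c_def add_ac)
    qed
  next
    have "summable (\<lambda>k. (1 / fact (Suc k)) * ((real (Suc k)) powr (\<alpha> + 1) * S ^ k * A))"
    proof (rule summable_comparison_test_bigo)
      \<comment> \<open>One factor k + 1 cancels against the factorial; the remaining (k +
        1)^\<alpha> is absorbed by replacing S with 2 S.\<close>
      show "summable (\<lambda>k. norm (inverse (fact k) * (2 * S) ^ k))"
        using S0 summable_exp[of "2 * S"] by (simp add: norm_mult power_abs)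
      show "(\<lambda>k. (1 / fact (Suc k)) * ((real (Suc k)) powr (\<alpha> + 1) * S ^ k * A)) \<in> O(\<lambda>k. inverse (fact k) * (2 * S) ^ k)"
      proof -
        have "(\<lambda>k. real (Suc k) powr \<alpha>) \<in> O(\<lambda>k. 2 ^ k)" using assms by real_asymp
        then have "(\<lambda>k. (inverse (fact k) * S ^ k * A) * real (Suc k) powr \<alpha>) \<in> O(\<lambda>k. (inverse (fact k) * S ^ k * A) * 2 ^ k)"
          by (rule landau_o.big.mult_left)
        also have "(\<lambda>k. (inverse (fact k) * S ^ k * A) * 2 ^ k) = (\<lambda>k. A * (inverse (fact k) * (2 * S) ^ k))"
          by (simp add: power_mult_distrib mult_ac)
        also have "(\<lambda>k. (inverse (fact k) * S ^ k * A) * real (Suc k) powr \<alpha>) = (\<lambda>k. (1 / fact (Suc k)) * ((real (Suc k)) powr (\<alpha> + 1) * S ^ k * A))"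
          proof
          fix k
          have "fact (Suc k) = (real k + 1) * (fact k :: real)" by (simp add: algebra_simps)
          moreover have "real (Suc k) powr (\<alpha> + 1) = real (Suc k) powr \<alpha> * (real k + 1)" by (simp add: powr_add)
          ultimately show "(inverse (fact k) * S ^ k * A) * real (Suc k) powr \<alpha> = (1 / fact (Suc k)) * ((real (Suc k)) powr (\<alpha> + 1) * S ^ k * A)"
            by (simp only:) (simp add: divide_simps)
        qed
        finally show ?thesis using A(1) by simp
      qed
    qed
    moreover have "norm (fps_nth (fps_exp 1 :: real fps) m) = 1 / fact m" for m by simp
    moreover have "c (Suc k) = (real (Suc k)) powr (\<alpha> + 1) * S ^ k * A" for k by (simp add: c_def)
    ultimately have "summable (\<lambda>k. norm (fps_nth (fps_exp 1 :: real fps) (Suc k)) * c (Suc k))"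
      by (simp only:)
    then show "summable (\<lambda>k. norm (fps_nth (fps_exp 1 :: real fps) k) * c k)"
      by (subst (asm) summable_Suc_iff)
  qed
qed

text \<open>The Neumann series. In contrast to the exponential no factorial helps, so the majorant
  \<open>c\<close> itself has to be summable.\<close>

lemma decay_geometric_compose:
  fixes f :: "'a::real_normed_field fps"
  assumes c: "\<And>k n. norm (fps_nth (f ^ k) n) \<le> c k * (real n + 1) powr - \<alpha>"
    and sm: "summable c" and f0: "fps_nth f 0 = 0"
  shows "decay \<alpha> (inverse (1 - f))"
proof -
  have "inverse (1 - f) = inverse ((1 - fps_X) oo f)"
    by (simp add: fps_compose_sub_distrib f0)
  also have "\<dots> = inverse (1 - fps_X) oo f"
    by (rule fps_inverse_compose[symmetric]) (simp_all add: f0)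
  also have "inverse (1 - fps_X) = (Abs_fps (\<lambda>n. 1) :: 'a fps)"
    unfolding fps_inverse_gp'[symmetric] by (rule fps_inverse_idempotent) simp
  finally show ?thesis
    using decay_compose[OF c, of "Abs_fps (\<lambda>n. 1)"] sm by simp
qed

subsection \<open>Differentiation\<close>

text \<open>The Euler operator X d/dX keeps the index in place, so it moves a decay exponent by
  exactly 1 in either direction. All differential equations below are written with it.\<close>

lemma fps_X_deriv_nth: "fps_nth (fps_X * fps_deriv f) n = of_nat n * fps_nth (f :: 'a::comm_ring_1 fps) n"
  by (cases n) simp_all

lemma decay_X_deriv:
  assumes "decay (\<alpha> + 1) f"
  shows "decay \<alpha> (fps_X * fps_deriv f)"
proof -
  obtain C where C: "C > 0" "\<And>n. norm (fps_nth f n) \<le> C * (real n + 1) powr - (\<alpha> + 1)"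
    using decayE[OF assms(1)] by blast
  have "norm (fps_nth (fps_X * fps_deriv f) n) \<le> C * (real n + 1) powr - \<alpha>" for n
  proof -
    have "real n * norm (fps_nth f n) \<le> (real n + 1) * (C * (real n + 1) powr - (\<alpha> + 1))"
      by (intro mult_mono C) auto
    also have "\<dots> = C * (real n + 1) powr (1 + - (\<alpha> + 1))"
      by (subst powr_add) simp
    finally show ?thesis using C(1) by (simp add: fps_X_deriv_nth norm_mult del: fps_mult_fps_X_commute fps_X_mult_nth)
  qed
  then show ?thesis by (rule decayI)
qed

text \<open>Integration gains one order. The constant term is invisible to the derivative and
  therefore enters the bound separately.\<close>

lemma decay_of_X_deriv:
  assumes "decay \<alpha> (fps_X * fps_deriv f)"
  shows "decay (\<alpha> + 1) f"
proof -
  obtain C where C: "C > 0" "\<And>n. norm (fps_nth (fps_X * fps_deriv f) n) \<le> C * (real n + 1) powr - \<alpha>"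
    using decayE[OF assms(1)] by blast
  have "norm (fps_nth f n) \<le> (2 * C + norm (fps_nth f 0)) * (real n + 1) powr - (\<alpha> + 1)" for n
  proof (cases "n = 0")
    case True
    then show ?thesis using C by simp
  next
    case False
    have "(real n + 1) * norm (fps_nth f n) \<le> 2 * (real n * norm (fps_nth f n))"
      using False mult_right_mono[of "real n + 1" "2 * real n" "norm (fps_nth f n)"] by simp
    also have "real n * norm (fps_nth f n) \<le> C * (real n + 1) powr - \<alpha>"
      using C(2)[of n] by (simp add: fps_X_deriv_nth norm_mult del: fps_mult_fps_X_commute fps_X_mult_nth)
    also have "\<dots> = C * (real n + 1) powr (1 + - (\<alpha> + 1))" by simp
    also have "\<dots> = (real n + 1) * (C * (real n + 1) powr - (\<alpha> + 1))" by (subst powr_add) simp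
    finally have "(real n + 1) * norm (fps_nth f n) \<le> (real n + 1) * (2 * C * (real n + 1) powr - (\<alpha> + 1))" by simp
    then have "norm (fps_nth f n) \<le> 2 * C * (real n + 1) powr - (\<alpha> + 1)" by (subst (asm) mult_le_cancel_left_pos) auto
    also have "\<dots> \<le> (2 * C + norm (fps_nth f 0)) * (real n + 1) powr - (\<alpha> + 1)" by (intro mult_right_mono) auto
    finally show ?thesis .
  qed
  then show ?thesis by (rule decayI)
qed

subsection \<open>A quantitative Wiener lemma\<close>

text \<open>Cauchy's estimate for 1 / f^k on the circle of radius R. What matters is the dependence
  on k: a factor (1/m)^k and the same geometric rate R^(-n) for all powers.\<close>

lemma fps_inverse_power_bound:
  fixes f :: "complex fps"
  assumes R: "R > 0" "ereal R < fps_conv_radius f"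
    and m: "m > 0" "\<And>z. norm z \<le> R \<Longrightarrow> m \<le> norm (eval_fps f z)"
  shows "norm (fps_nth (inverse f ^ k) n) \<le> (1 / m) ^ k / R ^ n"
proof -
  define g where "g = (\<lambda>z. inverse (eval_fps f z) ^ k)"
  have "fps_nth f 0 \<noteq> 0" using m(2)[of 0] m(1) R by (auto simp: eval_fps_at_0)
  moreover have "fps_conv_radius f > 0" using R by (metis less_trans ereal_less(2))
  ultimately have exp: "g has_fps_expansion inverse f ^ k" unfolding g_def
    by (intro fps_expansion_intros eval_fps_has_fps_expansion) auto
  have nz: "eval_fps f z \<noteq> 0" if "norm z \<le> R" for z
    using m(2)[OF that] m(1) by auto
  have sub: "cball 0 R \<subseteq> eball 0 (fps_conv_radius f)"
    by (auto simp: in_eball_iff intro!: le_less_trans[OF _ R(2)])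
  have hol: "g holomorphic_on cball 0 R" unfolding g_def
    using nz sub by (intro holomorphic_intros) (auto simp: dist_norm)
  have "norm ((deriv ^^ n) g 0) \<le> (fact n) * (1 / m) ^ k / R ^ n"
  proof (rule Cauchy_inequality)
    show "g holomorphic_on ball 0 R" using hol by (rule holomorphic_on_subset) auto
    show "continuous_on (cball 0 R) g" using hol by (rule holomorphic_on_imp_continuous_on)
    fix x :: complex assume x: "norm (0 - x) = R"
    then have "inverse (norm (eval_fps f x)) \<le> 1 / m"
      using m(2)[of x] m(1) by (simp add: divide_simps)
    then show "norm (g x) \<le> (1 / m) ^ k"
      unfolding g_def by (simp add: norm_power norm_inverse power_mono)
  qed (rule R)
  moreover have "fps_nth (inverse f ^ k) n = (deriv ^^ n) g 0 / fact n"
    by (rule fps_nth_fps_expansion[OF exp])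
  ultimately have "norm (fps_nth (inverse f ^ k) n) \<le> ((fact n) * (1 / m) ^ k / R ^ n) / fact n"
    by (simp only: norm_divide norm_fact) (rule divide_right_mono, auto)
  then show ?thesis by simp
qed

text \<open>Compactness: the minimum over the closed unit disc exceeds m by a positive amount, and
  uniform continuity carries the bound over to a slightly larger disc.\<close>

lemma eval_fps_lower_bound_larger_disc:
  fixes f :: "complex fps"
  assumes rad: "fps_conv_radius f > 1"
    and m: "\<And>z. norm z \<le> 1 \<Longrightarrow> m < norm (eval_fps f z)"
  obtains R where "R > 1" "ereal R < fps_conv_radius f" "\<And>z. norm z \<le> R \<Longrightarrow> m \<le> norm (eval_fps f z)"
proof -
  obtain R0 where R0: "1 < R0" "ereal R0 < fps_conv_radius f"
    using ereal_dense2[OF rad] by (metis ereal_less(3) one_ereal_def ereal_less_ereal_Ex less_ereal.simps(1))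
  have sub: "cball 0 R0 \<subseteq> eball 0 (fps_conv_radius f)"
    by (auto simp: in_eball_iff intro!: le_less_trans[OF _ R0(2)])
  have cont: "continuous_on (cball 0 R0) (eval_fps f)"
    by (rule continuous_on_subset[OF continuous_on_eval_fps sub])
  have "continuous_on (cball 0 1) (\<lambda>z. norm (eval_fps f z))"
    by (intro continuous_on_norm continuous_on_subset[OF cont]) (use R0 in auto)
  then obtain z0 where z0: "z0 \<in> cball 0 1" "\<And>z. z \<in> cball 0 1 \<Longrightarrow> norm (eval_fps f z0) \<le> norm (eval_fps f z)"
    using continuous_attains_inf[of "cball (0::complex) 1" "\<lambda>z. norm (eval_fps f z)"] by auto
  define e where "e = norm (eval_fps f z0) - m"
  have e: "e > 0" using m[of z0] z0 by (simp add: e_def)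
  have "uniformly_continuous_on (cball 0 R0) (eval_fps f)"
    by (rule compact_uniformly_continuous[OF cont]) auto
  then obtain d where d: "d > 0" "\<And>x y. x \<in> cball 0 R0 \<Longrightarrow> y \<in> cball 0 R0 \<Longrightarrow> dist y x < d \<Longrightarrow> dist (eval_fps f y) (eval_fps f x) < e"
    unfolding uniformly_continuous_on_def using e by metis
  define R where "R = min R0 (1 + d / 2)"
  show ?thesis
  proof (rule that[of R])
    show "R > 1" using R0 d by (simp add: R_def)
    have "ereal R \<le> ereal R0" by (simp add: R_def)
    then show "ereal R < fps_conv_radius f" using R0(2) by (rule le_less_trans)
    fix z :: complex assume z: "norm z \<le> R"
    \<comment> \<open>The radial projection of z to the unit disc; it moves z by at most d /
      2.\<close>
    define w where "w = z / of_real (max 1 (norm z))"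
    have w: "norm w \<le> 1" by (simp add: w_def norm_divide divide_simps)
    have "norm (z - w) = norm z * (1 - 1 / max 1 (norm z))"
    proof -
      have "z - w = z * of_real (1 - 1 / max 1 (norm z))" by (simp add: w_def field_simps)
      then show ?thesis by (simp only: norm_mult norm_of_real) (simp add: divide_simps)
    qed
    also have "\<dots> \<le> d / 2" using z d by (auto simp: R_def max_def field_simps)
    finally have "dist w z < d" using d by (simp add: dist_norm norm_minus_commute)
    moreover have "z \<in> cball 0 R0" "w \<in> cball 0 R0" using z w R0 by (auto simp: R_def)
    ultimately have "dist (eval_fps f w) (eval_fps f z) < e" using d(2) by blast
    then have "norm (eval_fps f w) - norm (eval_fps f z) < e"
      by (metis dist_norm norm_triangle_ineq2 le_less_trans)
    moreover have "norm (eval_fps f z0) \<le> norm (eval_fps f w)" using w z0(2) by simp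
    ultimately show "m \<le> norm (eval_fps f z)" by (simp add: e_def)
  qed
qed

lemma continuous_on_l1_power_series:
  fixes f :: "complex fps"
  assumes "summable (\<lambda>n. norm (fps_nth f n))"
  shows "continuous_on (cball 0 1) (\<lambda>z. \<Sum>n. fps_nth f n * z ^ n)"
proof -
  have "uniform_limit (cball 0 1) (\<lambda>n z. \<Sum>i<n. fps_nth f i * z ^ i) (\<lambda>z. \<Sum>n. fps_nth f n * z ^ n) sequentially"
  proof (rule Weierstrass_m_test[OF _ assms])
    fix n and z :: complex assume "z \<in> cball 0 1"
    then show "norm (fps_nth f n * z ^ n) \<le> norm (fps_nth f n)"
      by (simp add: norm_mult norm_power mult_left_le power_le_one)
  qed
  then show ?thesis
    by (rule uniform_limit_theorem[rotated]) (auto intro!: continuous_intros always_eventually)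
qed

lemma summable_l1_power_series:
  fixes f :: "'a::{real_normed_field,banach} fps"
  assumes "summable (\<lambda>n. norm (fps_nth f n))" "norm z \<le> 1"
  shows "summable (\<lambda>n. norm (fps_nth f n * z ^ n))"
  by (rule summable_comparison_test'[OF assms(1)])
    (use assms(2) in \<open>simp add: norm_mult norm_power mult_left_le power_le_one\<close>)

lemma bigo_cmult:
  fixes f g :: "'a \<Rightarrow> real"
  assumes "f \<in> O[F](g)"
  shows "(\<lambda>x. c * f x) \<in> O[F](g)"
proof (cases "c = 0")
  case False
  then show ?thesis using assms by (subst landau_o.big.cmult_in_iff)
qed simp

text \<open>Newman's argument for Wiener's lemma, with the decay weight carried along. V is split
  into a truncation P and a rest R that is small in l1. The polynomial P has no zero in the closed
  disc, hence none in a larger one, so all powers of 1 / P have geometrically decaying coefficients;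
  and 1 / V is 1 / P times the Neumann series in - R / P.\<close>

theorem decay_inverse_complex:
  fixes V :: "complex fps"
  assumes dec: "decay \<alpha> V" and \<alpha>: "\<alpha> > 1"
    and nz: "\<And>z. norm z \<le> 1 \<Longrightarrow> (\<Sum>n. fps_nth V n * z ^ n) \<noteq> 0"
  shows "decay \<alpha> (inverse V)"
proof -
  note sumV = decay_summable[OF dec \<alpha>]
  define v where "v z = (\<Sum>n. fps_nth V n * z ^ n)" for z
  have "continuous_on (cball 0 1) (\<lambda>z. norm (v z))"
    unfolding v_def by (intro continuous_on_norm continuous_on_l1_power_series sumV)
  then obtain z0 where z0: "z0 \<in> cball 0 1" "\<And>z. z \<in> cball 0 1 \<Longrightarrow> norm (v z0) \<le> norm (v z)"
    using continuous_attains_inf[of "cball (0::complex) 1" "\<lambda>z. norm (v z)"] by auto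
  \<comment> \<open>A quarter of the minimum of |V|: once a tail of l1 norm at most \<delta> is
    removed, |P| still exceeds 2 \<delta>, and R / P contributes the ratio 1/2.\<close>
  define \<delta> where "\<delta> = norm (v z0) / 4"
  have \<delta>: "\<delta> > 0" using nz[of z0] z0 by (simp add: \<delta>_def v_def)
  have vge: "norm (v z) \<ge> 4 * \<delta>" if "norm z \<le> 1" for z using z0 that by (simp add: \<delta>_def)
  obtain N0 where N0: "\<And>n. n \<ge> N0 \<Longrightarrow> norm (\<Sum>i. norm (fps_nth V (i + n))) < \<delta>"
    using suminf_exist_split[OF \<delta> sumV] by blast
  \<comment> \<open>The successor makes N positive, so the constant term of V stays in P and R has
    constant term 0, as the Neumann series requires.\<close>
  define N where "N = Suc N0"
  have sumN: "summable (\<lambda>i. norm (fps_nth V (i + N)))" using sumV by (subst summable_iff_shift)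
  have tail: "(\<Sum>i. norm (fps_nth V (i + N))) \<le> \<delta>" using N0[of N] by (simp add: N_def)
  define P R where "P = fps_cutoff N V" and "R = V - P"
  have Pn: "fps_nth P n = (if n < N then fps_nth V n else 0)" for n by (simp add: P_def fps_cutoff_def)
  have Rn: "fps_nth R n = (if n < N then 0 else fps_nth V n)" for n by (simp add: R_def Pn)
  have radP: "fps_conv_radius P = \<infinity>" unfolding fps_conv_radius_def
    by (rule conv_radius_inftyI'', rule summable_finite[of "{..<N}"]) (auto simp: Pn)
  have evP: "eval_fps P z = (\<Sum>n<N. fps_nth V n * z ^ n)" for z
    unfolding eval_fps_def by (subst suminf_finite[of "{..<N}"]) (auto simp: Pn)
  have Pge: "2 * \<delta> < norm (eval_fps P z)" if z: "norm z \<le> 1" for z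
  proof -
    note sz = summable_l1_power_series[OF sumV z]
    have "v z = (\<Sum>n. fps_nth V (n + N) * z ^ (n + N)) + eval_fps P z"
      unfolding v_def evP by (rule suminf_split_initial_segment[OF summable_norm_cancel[OF sz]])
    moreover have "norm (\<Sum>n. fps_nth V (n + N) * z ^ (n + N)) \<le> (\<Sum>n. norm (fps_nth V (n + N)))"
      by (rule norm_suminf_le[OF _ sumN])
        (use z in \<open>simp add: norm_mult norm_power mult_left_le power_le_one\<close>)
    ultimately have "norm (v z) \<le> \<delta> + norm (eval_fps P z)"
      using tail by (simp only:) (rule norm_triangle_le, linarith)
    then show ?thesis using vge[OF z] \<delta> by simp
  qed
  obtain r where r: "r > 1" "\<And>z. norm z \<le> r \<Longrightarrow> 2 * \<delta> \<le> norm (eval_fps P z)"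
    by (rule eval_fps_lower_bound_larger_disc[of P "2 * \<delta>"]) (use radP Pge in auto)
  have iP: "norm (fps_nth (inverse P ^ k) n) \<le> (1 / (2 * \<delta>)) ^ k * (1 / r) ^ n" for k n
    using fps_inverse_power_bound[of r P "2 * \<delta>" k n] r \<delta> radP by (simp add: power_divide)
  obtain C where C: "\<And>n. (1 / r) ^ n \<le> C * (real n + 1) powr - \<alpha>"
  proof -
    define y where "y = 1 / r"
    have y: "0 < y" "y < 1" using r(1) by (simp_all add: y_def)
    have "(\<lambda>n. y ^ n) \<in> O(\<lambda>n. (real n + 1) powr - \<alpha>)" proof -
      have "(\<lambda>n. (real n + 1) powr \<alpha> * y ^ n) \<longlonglongrightarrow> 0" using y \<alpha> by real_asymp
      then have "(\<lambda>n. (real n + 1) powr \<alpha> * y ^ n) \<in> O(\<lambda>n. 1)"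
        by (intro bigoI_tendsto[where c = 0]) auto
      then have "(\<lambda>n. (real n + 1) powr - \<alpha> * ((real n + 1) powr \<alpha> * y ^ n)) \<in> O(\<lambda>n. (real n + 1) powr - \<alpha> * 1)"
        by (rule landau_o.big.mult_left)
      moreover have "(real n + 1) powr - \<alpha> * ((real n + 1) powr \<alpha> * y ^ n) = y ^ n" for n
        by (simp add: mult.assoc[symmetric] powr_add[symmetric])
      ultimately show ?thesis by simp
    qed
    then have "(\<lambda>n. (1 / r) ^ n) \<in> O(\<lambda>n. (real n + 1) powr - \<alpha>)" unfolding y_def .
    then obtain D where "D > 0" "eventually (\<lambda>n. norm ((1 / r) ^ n) \<le> D * norm ((real n + 1) powr - \<alpha>)) sequentially"
      by (elim landau_o.bigE) auto
    then obtain n0 where D: "D > 0" "\<And>n. n \<ge> n0 \<Longrightarrow> (1 / r) ^ n \<le> D * (real n + 1) powr - \<alpha>"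
      using r(1) by (auto simp: eventually_sequentially)
    have "decay \<alpha> (Abs_fps (\<lambda>n. if n < n0 then (1 / r) ^ n else 0))"
      by (rule decay_eventually_0[of n0]) simp
    then obtain C1 where C1: "C1 > 0" "\<And>n. norm (if n < n0 then (1 / r) ^ n else 0) \<le> C1 * (real n + 1) powr - \<alpha>"
      by (elim decayE) simp
    have "(1 / r) ^ n \<le> max D C1 * (real n + 1) powr - \<alpha>" for n
    proof (cases "n < n0")
      case True
      then have "(1 / r) ^ n \<le> C1 * (real n + 1) powr - \<alpha>" using C1(2)[of n] r(1) by simp
      also have "\<dots> \<le> max D C1 * (real n + 1) powr - \<alpha>" by (intro mult_right_mono) auto
      finally show ?thesis .
    next
      case False
      then have "(1 / r) ^ n \<le> D * (real n + 1) powr - \<alpha>" using D(2) by simp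
      also have "\<dots> \<le> max D C1 * (real n + 1) powr - \<alpha>" by (intro mult_right_mono) auto
      finally show ?thesis .
    qed
    then show ?thesis by (rule that)
  qed
  have C0: "C \<ge> 0" using C[of 0] by simp
  \<comment> \<open>T does not depend on k: all powers of 1 / P share one geometric rate, up to the
    factor (1 / (2 \<delta>))^k.\<close>
  define T where "T = (\<Sum>n. (1 / r) ^ n)"
  have sr: "summable (\<lambda>n. (1 / r) ^ n)" using r by (intro summable_geometric) auto
  have T0: "T \<ge> 0" unfolding T_def using r by (intro suminf_nonneg sr) auto
  have iP1: "(\<Sum>i\<le>n. norm (fps_nth (inverse P ^ k) i)) \<le> (1 / (2 * \<delta>)) ^ k * T" for k n
  proof -
    have "(\<Sum>i\<le>n. norm (fps_nth (inverse P ^ k) i)) \<le> (\<Sum>i\<le>n. (1 / (2 * \<delta>)) ^ k * (1 / r) ^ i)"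
      by (intro sum_mono iP)
    also have "\<dots> = (1 / (2 * \<delta>)) ^ k * (\<Sum>i\<le>n. (1 / r) ^ i)" by (simp add: sum_distrib_left)
    also have "\<dots> \<le> (1 / (2 * \<delta>)) ^ k * T" unfolding T_def
      using \<delta> r by (intro mult_left_mono sum_le_suminf sr) auto
    finally show ?thesis .
  qed
  have iP2: "norm (fps_nth (inverse P ^ k) n) \<le> ((1 / (2 * \<delta>)) ^ k * C) * (real n + 1) powr - \<alpha>" for k n
  proof -
    have "(1 / (2 * \<delta>)) ^ k * (1 / r) ^ n \<le> (1 / (2 * \<delta>)) ^ k * (C * (real n + 1) powr - \<alpha>)"
      using \<delta> by (intro mult_left_mono C) auto
    then show ?thesis using iP[of k n] by (simp add: mult.assoc)
  qed
  obtain A where A: "A > 0" "\<And>n. norm (fps_nth V n) \<le> A * (real n + 1) powr - \<alpha>"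
    using decayE[OF dec] by blast
  have R1: "norm (fps_nth R n) \<le> A * (real n + 1) powr - \<alpha>" for n using A by (simp add: Rn)
  have R2: "(\<Sum>i\<le>n. norm (fps_nth R i)) \<le> \<delta>" for n
  proof -
    have s: "summable (\<lambda>i. norm (fps_nth R i))"
      by (rule summable_comparison_test'[OF sumV]) (simp add: Rn)
    have "(\<Sum>i\<le>n. norm (fps_nth R i)) \<le> (\<Sum>i. norm (fps_nth R i))" by (rule sum_le_suminf[OF s]) auto
    also have "\<dots> = (\<Sum>i. norm (fps_nth R (i + N))) + (\<Sum>i<N. norm (fps_nth R i))"
      by (rule suminf_split_initial_segment[OF s])
    also have "\<dots> = (\<Sum>i. norm (fps_nth V (i + N)))" by (simp add: Rn)
    finally show ?thesis using tail by simp
  qed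
  define x where "x = - R * inverse P"
  \<comment> \<open>The l1 bound \<delta>^k for R^k meets (1 / (2 \<delta>))^k from the powers of 1
    / P; what is left is (1/2)^k times a factor of polynomial growth.\<close>
  define c where "c k = (if k = 0 then 1 else 2 powr \<alpha> * (1 / 2) ^ k * (real k powr (\<alpha> + 1) * (A * T / \<delta>) + C))" for k
  have xk: "norm (fps_nth (x ^ k) n) \<le> c k * (real n + 1) powr - \<alpha>" for k n
  proof (cases k)
    case 0
    then show ?thesis by (cases n) (auto simp: c_def)
  next
    case (Suc j)
    have "x ^ k = (- 1) ^ k * (R ^ k * inverse P ^ k)"
      by (simp add: x_def power_mult_distrib[symmetric])
    then have "norm (fps_nth (x ^ k) n) = norm (fps_nth (R ^ k * inverse P ^ k) n)"
      by (cases "even k") auto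
    also have "\<dots> \<le> ((1/2) powr - \<alpha> * (real k powr (\<alpha> + 1) * \<delta> ^ j * A) * ((1 / (2 * \<delta>)) ^ k * T)
        + (1/2) powr - \<alpha> * \<delta> ^ k * ((1 / (2 * \<delta>)) ^ k * C)) * (real n + 1) powr - \<alpha>"
    proof (rule fps_mult_decay_bound)
      fix n
      show "norm (fps_nth (R ^ k) n) \<le> (real k powr (\<alpha> + 1) * \<delta> ^ j * A) * (real n + 1) powr - \<alpha>"
        using fps_power_decay_bound[of \<alpha> R A \<delta> j n] R1 R2 \<alpha> by (simp add: Suc add_ac)
      show "(\<Sum>i\<le>n. norm (fps_nth (R ^ k) i)) \<le> \<delta> ^ k"
        using fps_power_decay_bound[of \<alpha> R A \<delta> j n] R1 R2 \<alpha> by (simp add: Suc)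
      show "norm (fps_nth (inverse P ^ k) n) \<le> ((1 / (2 * \<delta>)) ^ k * C) * (real n + 1) powr - \<alpha>" by (rule iP2)
      show "(\<Sum>i\<le>n. norm (fps_nth (inverse P ^ k) i)) \<le> (1 / (2 * \<delta>)) ^ k * T" by (rule iP1)
    qed (use \<alpha> in auto)
    also have "(1/2) powr - \<alpha> * (real k powr (\<alpha> + 1) * \<delta> ^ j * A) * ((1 / (2 * \<delta>)) ^ k * T)
        + (1/2) powr - \<alpha> * \<delta> ^ k * ((1 / (2 * \<delta>)) ^ k * C) = c k"
    proof -
      have half: "(1/2) powr - \<alpha> = 2 powr \<alpha>" by (simp add: powr_minus powr_divide)
      have d: "\<delta> ^ k * (1 / (2 * \<delta>)) ^ k = (1/2) ^ k"
        using \<delta> by (simp add: power_mult_distrib[symmetric])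
      have d': "\<delta> ^ j * (1 / (2 * \<delta>)) ^ k = (1/2) ^ k / \<delta>"
        using d \<delta> by (simp add: Suc field_simps)
      have 1: "x * (y * u * A) * (v * T) + x * u' * (v * C) = x * (y * A * T * (u * v) + C * (u' * v))"
        for x y u v u' :: real by (simp add: algebra_simps)
      have 2: "x * (y * A * T * (h / \<delta>) + C * h) = x * h * (y * (A * T / \<delta>) + C)"
        for x y h :: real by (simp add: algebra_simps)
      have "k \<noteq> 0" using Suc by simp
      then show ?thesis unfolding half 1 d d' 2 c_def by simp
    qed
    finally show ?thesis .
  qed
  have "summable c"
  proof -
    have "summable (\<lambda>k. 2 powr \<alpha> * (1 / 2) ^ Suc k * (real (Suc k) powr (\<alpha> + 1) * (A * T / \<delta>) + C))"
    proof (rule summable_comparison_test_bigo)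
      show "summable (\<lambda>k. norm ((3/4::real) ^ k))" by (simp add: summable_geometric)
      have 1: "(\<lambda>k. (1 / 2) ^ Suc k * real (Suc k) powr (\<alpha> + 1)) \<in> O(\<lambda>k. (3/4::real) ^ k)"
        using \<alpha> by real_asymp
      have 2: "(\<lambda>k. (1 / 2) ^ Suc k) \<in> O(\<lambda>k. (3/4::real) ^ k)"
        by real_asymp
      have "(\<lambda>k. (2 powr \<alpha> * (A * T / \<delta>)) * ((1 / 2) ^ Suc k * real (Suc k) powr (\<alpha> + 1)) + (2 powr \<alpha> * C) * (1 / 2) ^ Suc k) \<in> O(\<lambda>k. (3/4::real) ^ k)"
        by (rule sum_in_bigo(1)[OF bigo_cmult[OF 1] bigo_cmult[OF 2]])
      moreover have "2 powr \<alpha> * (A * T / \<delta>) * (h * y) + 2 powr \<alpha> * C * h = 2 powr \<alpha> * h * (y * (A * T / \<delta>) + C)"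
        for h y :: real by (simp add: algebra_simps)
      ultimately show "(\<lambda>k. 2 powr \<alpha> * (1 / 2) ^ Suc k * (real (Suc k) powr (\<alpha> + 1) * (A * T / \<delta>) + C)) \<in> O(\<lambda>k. (3/4::real) ^ k)"
        by (simp only:)
    qed
    then have "summable (\<lambda>k. c (Suc k))" by (simp add: c_def)
    then show ?thesis by (subst (asm) summable_Suc_iff)
  qed
  moreover have R0: "fps_nth R 0 = 0" by (simp add: Rn N_def)
  moreover have P0: "fps_nth P 0 \<noteq> 0" using Pge[of 0] \<delta> by (auto simp: eval_fps_at_0)
  ultimately have "decay \<alpha> (inverse (1 - x))"
    by (intro decay_geometric_compose[where c = c] xk) (auto simp: x_def)
  moreover have "decay \<alpha> (inverse P)"
    using iP2[of 1] by (intro decayI[of _ "(1 / (2 * \<delta>)) ^ 1 * C"]) (simp only: power_one_right)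
  ultimately have "decay \<alpha> (inverse P * inverse (1 - x))" using \<alpha> by (intro decay_mult)
  also have "inverse P * inverse (1 - x) = inverse (P * (1 - x))" by (simp add: fps_inverse_mult)
  also have "P * (1 - x) = P + R * (inverse P * P)" by (simp add: x_def algebra_simps)
  also have "\<dots> = V" by (subst inverse_mult_eq_1[OF P0]) (simp add: R_def)
  finally show ?thesis .
qed

definition fps_complex :: "real fps \<Rightarrow> complex fps" where
  "fps_complex f = Abs_fps (\<lambda>n. of_real (fps_nth f n))"

lemma fps_complex_nth [simp]: "fps_nth (fps_complex f) n = of_real (fps_nth f n)"
  by (simp add: fps_complex_def)

lemma fps_complex_mult: "fps_complex (f * g) = fps_complex f * fps_complex g"
  by (rule fps_ext) (simp add: fps_mult_nth)

lemma fps_complex_inverse: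
  assumes "fps_nth f 0 \<noteq> 0"
  shows "fps_complex (inverse f) = inverse (fps_complex f)"
proof -
  have "fps_complex f * fps_complex (inverse f) = fps_complex (f * inverse f)" by (simp add: fps_complex_mult)
  also have "f * inverse f = 1" using assms by (simp add: inverse_mult_eq_1')
  also have "fps_complex 1 = 1" by (rule fps_ext) simp
  finally show ?thesis by (rule fps_inverse_unique[symmetric])
qed

theorem decay_inverse:
  fixes V :: "real fps"
  assumes dec: "decay \<alpha> V" and \<alpha>: "\<alpha> > 1"
    and nz: "\<And>z::complex. norm z \<le> 1 \<Longrightarrow> (\<Sum>n. of_real (fps_nth V n) * z ^ n) \<noteq> 0"
  shows "decay \<alpha> (inverse V)"
proof -
  have "fps_nth V 0 \<noteq> 0" using nz[of 0] by (auto simp: powser_zero)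
  then have "inverse (fps_complex V) = fps_complex (inverse V)" by (simp add: fps_complex_inverse)
  moreover have "decay \<alpha> (inverse (fps_complex V))"
    by (rule decay_inverse_complex) (use assms in \<open>auto simp: decay_def\<close>)
  ultimately show ?thesis by (simp add: decay_def)
qed

subsection \<open>Evaluation on the closed disc\<close>

text \<open>Cauchy products under absolute convergence: the values are needed on the circle of
  convergence itself, at z = 1 in particular.\<close>

lemma eval_fps_mult_l1:
  fixes f g :: "'a::{real_normed_field,banach} fps"
  assumes "summable (\<lambda>n. norm (fps_nth f n))" "summable (\<lambda>n. norm (fps_nth g n))" "norm z \<le> 1"
  shows "eval_fps (f * g) z = eval_fps f z * eval_fps g z"
proof -
  have "eval_fps f z * eval_fps g z = (\<Sum>k. \<Sum>i\<le>k. (fps_nth f i * z ^ i) * (fps_nth g (k - i) * z ^ (k - i)))"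
    unfolding eval_fps_def using assms by (intro Cauchy_product summable_l1_power_series)
  also have "(\<lambda>k. \<Sum>i\<le>k. (fps_nth f i * z ^ i) * (fps_nth g (k - i) * z ^ (k - i))) = (\<lambda>k. fps_nth (f * g) k * z ^ k)"
  proof
    fix k
    have "(\<Sum>i\<le>k. (fps_nth f i * z ^ i) * (fps_nth g (k - i) * z ^ (k - i))) = (\<Sum>i\<le>k. fps_nth f i * fps_nth g (k - i) * z ^ k)"
      by (intro sum.cong refl) (simp add: power_add[symmetric] mult_ac)
    then show "(\<Sum>i\<le>k. (fps_nth f i * z ^ i) * (fps_nth g (k - i) * z ^ (k - i))) = fps_nth (f * g) k * z ^ k"
      by (simp add: fps_mult_nth atLeast0AtMost sum_distrib_right)
  qed
  finally show ?thesis by (simp add: eval_fps_def)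
qed

lemma eval_fps_add_l1:
  fixes f g :: "'a::{real_normed_field,banach} fps"
  assumes "summable (\<lambda>n. norm (fps_nth f n))" "summable (\<lambda>n. norm (fps_nth g n))" "norm z \<le> 1"
  shows "eval_fps (f + g) z = eval_fps f z + eval_fps g z"
  unfolding eval_fps_def fps_add_nth distrib_right
  by (rule suminf_add[symmetric]) (rule summable_norm_cancel[OF summable_l1_power_series], fact+)+

lemma eval_fps_diff_l1:
  fixes f g :: "'a::{real_normed_field,banach} fps"
  assumes "summable (\<lambda>n. norm (fps_nth f n))" "summable (\<lambda>n. norm (fps_nth g n))" "norm z \<le> 1"
  shows "eval_fps (f - g) z = eval_fps f z - eval_fps g z"
  unfolding eval_fps_def fps_sub_nth left_diff_distrib
  by (rule suminf_diff[symmetric]) (rule summable_norm_cancel[OF summable_l1_power_series], fact+)+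

lemmas eval_fps_mult_decay = eval_fps_mult_l1[OF decay_summable decay_summable]
lemmas eval_fps_add_decay = eval_fps_add_l1[OF decay_summable decay_summable]
lemmas eval_fps_diff_decay = eval_fps_diff_l1[OF decay_summable decay_summable]

subsection \<open>Multiplication by slowly varying series\<close>

lemma half_powr_minus: "x \<ge> 0 \<Longrightarrow> (x / 2) powr - c = 2 powr c * x powr - (c::real)"
  by (simp add: powr_divide powr_minus_divide)

text \<open>For i <= n/2 the coefficients x_(n-i) and x_n differ by at most i times a bound on the
  increments of x, and the sum of i |g_i| is finite because 5/2 > 2. For i > n/2 the factor g_i is
  already O(n^(-5/2)), and the partial sums of |x| restore the right power of n. So the convolution
  equals g(1) x_n with a gain of one order.\<close>

lemma decay_smooth_mult:
  fixes x g :: "real fps"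
  assumes x: "decay \<beta> x" and dx: "decay (\<beta> + 1) ((1 - fps_X) * x)" and g: "decay (5/2) g"
    and \<beta>: "\<beta> \<ge> 0" "\<beta> \<le> 3/2"
    and sx: "\<And>n. (\<Sum>i\<le>n. \<bar>fps_nth x i\<bar>) \<le> C * (real n + 1) powr (3/2 - \<beta>)"
  shows "decay (\<beta> + 1) (x * g - fps_const (eval_fps g 1) * x)"
proof -
  obtain A where A: "A > 0" "\<And>n. norm (fps_nth x n) \<le> A * (real n + 1) powr - \<beta>"
    using decayE[OF x] by blast
  obtain B where B: "B > 0" "\<And>n. norm (fps_nth ((1 - fps_X) * x) n) \<le> B * (real n + 1) powr - (\<beta> + 1)"
    using decayE[OF dx] by blast
  obtain G where G: "G > 0" "\<And>n. norm (fps_nth g n) \<le> G * (real n + 1) powr - (5/2)"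
    using decayE[OF g] by blast
  have sg: "summable (\<lambda>n. real n * \<bar>fps_nth g n\<bar>)" using decay_summable_of_nat[OF g] by simp
  have sg0: "summable (\<lambda>n. \<bar>fps_nth g n\<bar>)" using decay_summable[OF g] by simp
  define K where "K = (\<Sum>n. real n * \<bar>fps_nth g n\<bar>)"
  have K0: "K \<ge> 0" unfolding K_def by (intro suminf_nonneg sg) auto
  define D where "D = B * 2 powr (\<beta> + 1) + 2 * A"
  define E where "E = G * 2 powr (5/2)"
  have D0: "D \<ge> 0" and E0: "E \<ge> 0" using A B G by (auto simp: D_def E_def)
  show ?thesis
  proof (rule decayI)
    fix n
    define w where "w = (real n + 1) powr - (\<beta> + 1)"
    have w0: "w \<ge> 0" by (simp add: w_def)
    have wA: "\<bar>fps_nth x n\<bar> \<le> A * (w * (real n + 1))"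
      using A(2)[of n] by (simp add: w_def powr_add[symmetric] powr_mult_base mult.commute[of "_ powr _"])
    have step: "\<bar>fps_nth x m - fps_nth x (Suc m)\<bar> \<le> B * 2 powr (\<beta> + 1) * w" if "2 * (m + 1) \<ge> n + 1" for m
    proof -
      have "\<bar>fps_nth x m - fps_nth x (Suc m)\<bar> = norm (fps_nth ((1 - fps_X) * x) (Suc m))"
        by (simp add: algebra_simps)
      also have "\<dots> \<le> B * (real (Suc m) + 1) powr - (\<beta> + 1)" by (rule B(2))
      also have "(real (Suc m) + 1) powr - (\<beta> + 1) \<le> ((real n + 1) / 2) powr - (\<beta> + 1)"
        using \<beta> that by (intro powr_mono2') auto
      also have "\<dots> = 2 powr (\<beta> + 1) * w" unfolding w_def by (rule half_powr_minus) simp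
      finally show ?thesis using B(1) by (simp add: mult.assoc)
    qed
    have walk: "\<bar>fps_nth x (n - i) - fps_nth x n\<bar> \<le> real i * (B * 2 powr (\<beta> + 1) * w)" if "2 * i \<le> n" for i
      using that
    proof (induction i)
      case (Suc i)
      have "\<bar>fps_nth x (n - Suc i) - fps_nth x n\<bar> \<le> \<bar>fps_nth x (n - Suc i) - fps_nth x (Suc (n - Suc i))\<bar> + \<bar>fps_nth x (n - i) - fps_nth x n\<bar>"
        using Suc.prems by (simp add: Suc_diff_Suc)
      also have "\<dots> \<le> B * 2 powr (\<beta> + 1) * w + real i * (B * 2 powr (\<beta> + 1) * w)"
        by (intro add_mono step Suc.IH) (use Suc.prems in auto)
      finally show ?case by (simp add: algebra_simps)
    qed simp
    \<comment> \<open>One bound for both ranges of i. In the second range x_n and x_(n-i) are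
      estimated separately: the former goes into the term with D, the latter into the term with
      E.\<close>
    have trm: "\<bar>fps_nth g i * (fps_nth x (n - i) - fps_nth x n)\<bar> \<le>
        (real i * \<bar>fps_nth g i\<bar>) * (D * w) + E * (real n + 1) powr - (5/2) * \<bar>fps_nth x (n - i)\<bar>" for i
    proof (cases "2 * i \<le> n")
      case True
      have "\<bar>fps_nth g i * (fps_nth x (n - i) - fps_nth x n)\<bar> \<le> \<bar>fps_nth g i\<bar> * (real i * (B * 2 powr (\<beta> + 1) * w))"
        unfolding abs_mult by (intro mult_left_mono walk True) auto
      also have "\<dots> = (real i * \<bar>fps_nth g i\<bar>) * (B * 2 powr (\<beta> + 1) * w)" by simp
      also have "\<dots> \<le> (real i * \<bar>fps_nth g i\<bar>) * (D * w)"
        using A w0 by (intro mult_left_mono mult_right_mono) (auto simp: D_def)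
      also have "\<dots> \<le> (real i * \<bar>fps_nth g i\<bar>) * (D * w) + E * (real n + 1) powr - (5/2) * \<bar>fps_nth x (n - i)\<bar>"
        using E0 by simp
      finally show ?thesis .
    next
      case False
      have "\<bar>fps_nth g i\<bar> \<le> G * (real i + 1) powr - (5/2)" using G(2)[of i] by simp
      also have "(real i + 1) powr - (5/2) \<le> ((real n + 1) / 2) powr - (5/2)"
        using False by (intro powr_mono2') auto
      also have "\<dots> = 2 powr (5/2) * (real n + 1) powr - (5/2)" by (rule half_powr_minus) simp
      finally have g1: "\<bar>fps_nth g i\<bar> \<le> E * (real n + 1) powr - (5/2)" using G(1) by (simp add: E_def mult.assoc)
      have "\<bar>fps_nth g i\<bar> * \<bar>fps_nth x n\<bar> \<le> \<bar>fps_nth g i\<bar> * (A * (w * (real n + 1)))"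
        by (intro mult_left_mono wA) auto
      \<comment> \<open>Here n + 1 <= 2 i trades the factor n + 1 of \<open>wA\<close> for the
        weight i of the first moment.\<close>
      also have "\<dots> \<le> \<bar>fps_nth g i\<bar> * (A * (w * (2 * real i)))"
        using False A(1) w0 by (intro mult_left_mono) auto
      also have "\<dots> = (real i * \<bar>fps_nth g i\<bar>) * (2 * A * w)" by simp
      also have "\<dots> \<le> (real i * \<bar>fps_nth g i\<bar>) * (D * w)"
        using B w0 by (intro mult_left_mono mult_right_mono) (auto simp: D_def)
      finally have g2: "\<bar>fps_nth g i\<bar> * \<bar>fps_nth x n\<bar> \<le> (real i * \<bar>fps_nth g i\<bar>) * (D * w)" .
      have "\<bar>fps_nth g i * (fps_nth x (n - i) - fps_nth x n)\<bar> \<le> \<bar>fps_nth g i\<bar> * (\<bar>fps_nth x (n - i)\<bar> + \<bar>fps_nth x n\<bar>)"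
        unfolding abs_mult by (intro mult_left_mono) auto
      also have "\<dots> = \<bar>fps_nth g i\<bar> * \<bar>fps_nth x (n - i)\<bar> + \<bar>fps_nth g i\<bar> * \<bar>fps_nth x n\<bar>" by (simp add: algebra_simps)
      also have "\<dots> \<le> E * (real n + 1) powr - (5/2) * \<bar>fps_nth x (n - i)\<bar> + (real i * \<bar>fps_nth g i\<bar>) * (D * w)"
        by (intro add_mono mult_right_mono g1 g2) auto
      finally show ?thesis by simp
    qed
    have ev: "eval_fps g 1 = (\<Sum>i. fps_nth g (i + Suc n)) + (\<Sum>i\<le>n. fps_nth g i)"
      unfolding eval_fps_def using suminf_split_initial_segment[OF summable_rabs_cancel[OF sg0], of "Suc n"]
      by (simp add: lessThan_Suc_atMost)
    have "fps_nth (x * g - fps_const (eval_fps g 1) * x) n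
        = (\<Sum>i\<le>n. fps_nth g i * fps_nth x (n - i)) - (\<Sum>i\<le>n. fps_nth g i) * fps_nth x n - (\<Sum>i. fps_nth g (i + Suc n)) * fps_nth x n"
      by (subst mult.commute[of x]) (simp add: fps_mult_nth[of g] atLeast0AtMost ev algebra_simps)
    also have "(\<Sum>i\<le>n. fps_nth g i * fps_nth x (n - i)) - (\<Sum>i\<le>n. fps_nth g i) * fps_nth x n
        = (\<Sum>i\<le>n. fps_nth g i * (fps_nth x (n - i) - fps_nth x n))"
      by (simp add: sum_distrib_right sum_subtractf right_diff_distrib)
    finally have eq: "fps_nth (x * g - fps_const (eval_fps g 1) * x) n
        = (\<Sum>i\<le>n. fps_nth g i * (fps_nth x (n - i) - fps_nth x n)) - (\<Sum>i. fps_nth g (i + Suc n)) * fps_nth x n" .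
    have t1: "\<bar>\<Sum>i\<le>n. fps_nth g i * (fps_nth x (n - i) - fps_nth x n)\<bar> \<le> K * (D * w) + E * (C * w)"
    proof -
      have "\<bar>\<Sum>i\<le>n. fps_nth g i * (fps_nth x (n - i) - fps_nth x n)\<bar> \<le>
        (\<Sum>i\<le>n. (real i * \<bar>fps_nth g i\<bar>) * (D * w) + E * (real n + 1) powr - (5/2) * \<bar>fps_nth x (n - i)\<bar>)"
        by (intro order.trans[OF sum_abs] sum_mono trm)
      also have "\<dots> = (\<Sum>i\<le>n. real i * \<bar>fps_nth g i\<bar>) * (D * w) + E * (real n + 1) powr - (5/2) * (\<Sum>i\<le>n. \<bar>fps_nth x (n - i)\<bar>)"
        by (simp add: sum.distrib sum_distrib_left sum_distrib_right)
      also have "(\<Sum>i\<le>n. \<bar>fps_nth x (n - i)\<bar>) = (\<Sum>i\<le>n. \<bar>fps_nth x i\<bar>)"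
        by (rule sum.nat_diff_reindex[of _ "Suc n", unfolded lessThan_Suc_atMost, simplified])
      also have "(\<Sum>i\<le>n. real i * \<bar>fps_nth g i\<bar>) * (D * w) + E * (real n + 1) powr - (5/2) * (\<Sum>i\<le>n. \<bar>fps_nth x i\<bar>)
          \<le> K * (D * w) + E * (real n + 1) powr - (5/2) * (C * (real n + 1) powr (3/2 - \<beta>))"
        unfolding K_def using D0 E0 w0
        by (intro add_mono mult_left_mono mult_right_mono sum_le_suminf sg sx) auto
      also have "E * (real n + 1) powr - (5/2) * (C * (real n + 1) powr (3/2 - \<beta>)) = E * (C * w)"
      proof -
        have "(real n + 1) powr - (5/2) * (real n + 1) powr (3/2 - \<beta>) = w"
          unfolding w_def powr_add[symmetric] by (simp add: algebra_simps)
        moreover have "E * (real n + 1) powr - (5/2) * (C * (real n + 1) powr (3/2 - \<beta>))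
            = E * (C * ((real n + 1) powr - (5/2) * (real n + 1) powr (3/2 - \<beta>)))" by (simp only: mult_ac)
        ultimately show ?thesis by simp
      qed
      finally show ?thesis .
    qed
    have t2: "\<bar>(\<Sum>i. fps_nth g (i + Suc n)) * fps_nth x n\<bar> \<le> K * (A * w)"
    proof -
      have sgn: "summable (\<lambda>i. real (i + Suc n) * \<bar>fps_nth g (i + Suc n)\<bar>)"
        using sg by (rule summable_ignore_initial_segment)
      have sgn0: "summable (\<lambda>i. \<bar>fps_nth g (i + Suc n)\<bar>)"
        using sg0 by (rule summable_ignore_initial_segment)
      \<comment> \<open>Every index in the tail is at least n + 1, so the tail is at most the first
        moment divided by n + 1.\<close>
      have "(real n + 1) * \<bar>\<Sum>i. fps_nth g (i + Suc n)\<bar> \<le> (real n + 1) * (\<Sum>i. \<bar>fps_nth g (i + Suc n)\<bar>)"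
        by (intro mult_left_mono summable_rabs sgn0) auto
      also have "\<dots> = (\<Sum>i. (real n + 1) * \<bar>fps_nth g (i + Suc n)\<bar>)" by (rule suminf_mult[OF sgn0, symmetric])
      also have "\<dots> \<le> (\<Sum>i. real (i + Suc n) * \<bar>fps_nth g (i + Suc n)\<bar>)"
        by (intro suminf_le sgn summable_mult sgn0 mult_right_mono) auto
      also have "\<dots> \<le> K" unfolding K_def
        using suminf_split_initial_segment[OF sg, of "Suc n"] by (simp add: sum_nonneg del: sum.lessThan_Suc)
      finally have 1: "(real n + 1) * \<bar>\<Sum>i. fps_nth g (i + Suc n)\<bar> \<le> K" .
      have "\<bar>(\<Sum>i. fps_nth g (i + Suc n)) * fps_nth x n\<bar> \<le> \<bar>\<Sum>i. fps_nth g (i + Suc n)\<bar> * (A * (w * (real n + 1)))"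
        unfolding abs_mult by (intro mult_left_mono wA) auto
      also have "\<dots> = ((real n + 1) * \<bar>\<Sum>i. fps_nth g (i + Suc n)\<bar>) * (A * w)" by simp
      also have "\<dots> \<le> K * (A * w)" using A w0 by (intro mult_right_mono 1) auto
      finally show ?thesis .
    qed
    show "norm (fps_nth (x * g - fps_const (eval_fps g 1) * x) n) \<le> (K * D + E * C + K * A) * (real n + 1) powr - (\<beta> + 1)"
      unfolding eq w_def[symmetric] real_norm_def using t1 t2 by (simp add: algebra_simps)
  qed
qed

lemma decay_smooth_mult_three_halves:
  fixes x g :: "real fps"
  assumes x: "decay (3/2) x" and dx: "decay (5/2) ((1 - fps_X) * x)" and g: "decay (5/2) g"
  shows "decay (5/2) (x * g - fps_const (eval_fps g 1) * x)"
proof -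
  have "decay (3/2 + 1) (x * g - fps_const (eval_fps g 1) * x)"
  proof (rule decay_smooth_mult[where C = "\<Sum>i. \<bar>fps_nth x i\<bar>"])
    fix n
    show "(\<Sum>i\<le>n. \<bar>fps_nth x i\<bar>) \<le> (\<Sum>i. \<bar>fps_nth x i\<bar>) * (real n + 1) powr (3/2 - 3/2)"
      using decay_partial_sums[OF x, of n] by simp
  qed (use assms in simp_all)
  then show ?thesis by simp
qed

text \<open>For coefficients of order n^(-1/2) the crude bound A (n + 1) on the partial sums is
  already what \<open>decay_smooth_mult\<close> asks for at \<beta> = 1/2.\<close>

lemma decay_smooth_mult_half:
  fixes x g :: "real fps"
  assumes x: "decay (1/2) x" and dx: "decay (3/2) ((1 - fps_X) * x)" and g: "decay (5/2) g"
  shows "decay (3/2) (x * g - fps_const (eval_fps g 1) * x)"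
proof -
  obtain A where A: "A > 0" "\<And>n. norm (fps_nth x n) \<le> A * (real n + 1) powr - (1/2)"
    using decayE[OF x] by blast
  have "\<bar>fps_nth x n\<bar> \<le> A" for n
  proof -
    have "(real n + 1) powr - (1/2) \<le> 1" by (simp add: powr_minus inverse_le_1_iff ge_one_powr_ge_zero)
    then show ?thesis using A(2)[of n] A(1) by (smt (verit) mult_left_le real_norm_def)
  qed
  then have "(\<Sum>i\<le>n. \<bar>fps_nth x i\<bar>) \<le> A * (real n + 1) powr (3/2 - 1/2)" for n
    using sum_bounded_above[of "{..n}" "\<lambda>i. \<bar>fps_nth x i\<bar>" A] by (simp add: mult_ac add_ac)
  then show ?thesis using decay_smooth_mult[of "1/2" x g A] assms by simp
qed

subsection \<open>The square root\<close>

definition sqrt_fps :: "real fps" where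
  "sqrt_fps = fps_binomial (1/2) oo (fps_const (- 1) * fps_X)"

text \<open>The coefficients are the central binomial numbers binom(2n, n) / 4^n.\<close>

definition inv_sqrt_fps :: "real fps" where
  "inv_sqrt_fps = fps_binomial (- (1/2)) oo (fps_const (- 1) * fps_X)"

lemma sqrt_fps_0 [simp]: "fps_nth sqrt_fps 0 = 1" and inv_sqrt_fps_0 [simp]: "fps_nth inv_sqrt_fps 0 = 1"
  by (simp_all add: sqrt_fps_def inv_sqrt_fps_def)

lemma sqrt_fps_square: "sqrt_fps * sqrt_fps = 1 - fps_X"
proof -
  have "sqrt_fps * sqrt_fps = (fps_binomial (1/2) * fps_binomial (1/2)) oo (fps_const (- 1) * fps_X)"
    unfolding sqrt_fps_def by (rule fps_compose_mult_distrib[symmetric]) simp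
  also have "fps_binomial (1/2) * fps_binomial (1/2) = (1 + fps_X :: real fps)"
    by (simp add: fps_binomial_add_mult[symmetric] fps_binomial_1)
  finally show ?thesis by (simp add: fps_compose_add_distrib)
qed

lemma sqrt_fps_mult_inv: "sqrt_fps * inv_sqrt_fps = 1"
proof -
  have "sqrt_fps * inv_sqrt_fps = (fps_binomial (1/2) * fps_binomial (- (1/2))) oo (fps_const (- 1) * fps_X)"
    unfolding sqrt_fps_def inv_sqrt_fps_def by (rule fps_compose_mult_distrib[symmetric]) simp
  also have "fps_binomial (1/2) * fps_binomial (- (1/2)) = (1 :: real fps)"
    by (simp add: fps_binomial_add_mult[symmetric])
  finally show ?thesis by simp
qed

lemma inv_sqrt_fps_mult: "(1 - fps_X) * inv_sqrt_fps = sqrt_fps"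
  by (simp only: sqrt_fps_square[symmetric] mult.assoc sqrt_fps_mult_inv mult_1_right)

lemma sqrt_fps_mult_deriv: "sqrt_fps * fps_deriv sqrt_fps = fps_const (- (1/2))"
proof -
  have "fps_deriv (sqrt_fps * sqrt_fps) = - 1" by (simp add: sqrt_fps_square)
  then have "fps_const 2 * (sqrt_fps * fps_deriv sqrt_fps) = - 1" by (simp add: algebra_simps flip: numeral_fps_const)
  then have "fps_const (1/2) * (fps_const 2 * (sqrt_fps * fps_deriv sqrt_fps)) = fps_const (1/2) * (- 1)" by simp
  then show ?thesis by (simp flip: mult.assoc)
qed

lemma sqrt_fps_deriv: "fps_deriv sqrt_fps = fps_const (- (1/2)) * inv_sqrt_fps"
proof -
  have "inv_sqrt_fps * (sqrt_fps * fps_deriv sqrt_fps) = inv_sqrt_fps * fps_const (- (1/2))"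
    by (simp only: sqrt_fps_mult_deriv)
  also have "inv_sqrt_fps * (sqrt_fps * fps_deriv sqrt_fps) = (sqrt_fps * inv_sqrt_fps) * fps_deriv sqrt_fps"
    by (simp only: mult_ac)
  finally show ?thesis unfolding sqrt_fps_mult_inv by (simp only: mult_1_left mult.commute)
qed

text \<open>With s for \<open>sqrt_fps\<close> and r for \<open>inv_sqrt_fps\<close>,
  differentiating s r = 1 and multiplying by s gives (1 - X) r' = r / 2, because s s' = -
  1/2.\<close>

lemma inv_sqrt_fps_Suc: "fps_nth inv_sqrt_fps (Suc n) = fps_nth inv_sqrt_fps n * (2 * real n + 1) / (2 * real n + 2)"
proof -
  have "fps_deriv (sqrt_fps * inv_sqrt_fps) = 0" by (simp add: sqrt_fps_mult_inv)
  then have "sqrt_fps * (sqrt_fps * fps_deriv inv_sqrt_fps) + sqrt_fps * (fps_deriv sqrt_fps * inv_sqrt_fps) = 0"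
    by (simp only: fps_deriv_mult distrib_left[symmetric]) simp
  then have "sqrt_fps * sqrt_fps * fps_deriv inv_sqrt_fps + (sqrt_fps * fps_deriv sqrt_fps) * inv_sqrt_fps = 0"
    by (simp only: mult.assoc)
  then have "(1 - fps_X) * fps_deriv inv_sqrt_fps + fps_const (- (1/2)) * inv_sqrt_fps = 0"
    by (simp only: sqrt_fps_mult_deriv sqrt_fps_square)
  then have "fps_nth ((1 - fps_X) * fps_deriv inv_sqrt_fps + fps_const (- (1/2)) * inv_sqrt_fps) n = 0" by simp
  then show ?thesis by (cases n) (simp_all add: algebra_simps field_simps)
qed

lemma inv_sqrt_fps_pos: "fps_nth inv_sqrt_fps n > 0"
  by (induction n) (simp_all add: inv_sqrt_fps_Suc)

lemma sqrt_fps_Suc: "fps_nth sqrt_fps (Suc n) = - fps_nth inv_sqrt_fps n / (2 * (real n + 1))"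
proof -
  have "fps_nth (fps_deriv sqrt_fps) n = - (1/2) * fps_nth inv_sqrt_fps n" by (simp add: sqrt_fps_deriv)
  then show ?thesis by (simp add: field_simps)
qed

text \<open>The squared coefficients are reciprocals of partial Wallis products; this is where pi
  enters the asymptotics.\<close>

lemma inv_sqrt_fps_wallis:
  "(2 * real n + 1) * (fps_nth inv_sqrt_fps n)\<^sup>2 = inverse (\<Prod>k=1..n. (4 * real k ^ 2) / (4 * real k ^ 2 - 1))"
proof (induction n)
  case (Suc n)
  define r where "r = fps_nth inv_sqrt_fps n"
  have 1: "(4 * real (Suc n) ^ 2 - 1) = (2 * real n + 1) * (2 * real n + 3)" by (simp add: power2_eq_square algebra_simps)
  have 2: "(4 * real (Suc n) ^ 2) = (2 * real n + 2) ^ 2" by (simp add: power2_eq_square algebra_simps)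
  have "(2 * real (Suc n) + 1) * (fps_nth inv_sqrt_fps (Suc n))\<^sup>2 = (2 * real n + 3) * (r * (2 * real n + 1) / (2 * real n + 2))\<^sup>2"
    by (simp add: inv_sqrt_fps_Suc r_def algebra_simps)
  also have "\<dots> = ((2 * real n + 1) * r\<^sup>2) * ((2 * real n + 1) * (2 * real n + 3) / (2 * real n + 2) ^ 2)"
    by (simp add: power2_eq_square)
  also have "\<dots> = inverse (\<Prod>k=1..n. (4 * real k ^ 2) / (4 * real k ^ 2 - 1)) * inverse ((4 * real (Suc n) ^ 2) / (4 * real (Suc n) ^ 2 - 1))"
    unfolding Suc[folded r_def] 1 unfolding 2 by (simp only: inverse_divide)
  also have "\<dots> = inverse (\<Prod>k=1..Suc n. (4 * real k ^ 2) / (4 * real k ^ 2 - 1))"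
    by (simp only: prod.nat_ivl_Suc' le_add2 One_nat_def inverse_mult_distrib mult.commute Suc_le_mono le0)
  finally show ?case .
qed simp

text \<open>With r_n the coefficient, n r_n^2 increases and (n + 1/2) r_n^2 decreases, and by Wallis
  both tend to 1 / pi. Monotonicity makes the bounds valid for every n > 0 and precise up to a
  relative error O(1/n).\<close>

lemma inv_sqrt_fps_bounds:
  assumes "n > 0"
  shows "1 / (pi * (real n + 1/2)) \<le> (fps_nth inv_sqrt_fps n)\<^sup>2" "(fps_nth inv_sqrt_fps n)\<^sup>2 \<le> 1 / (pi * real n)"
proof -
  define r where "r n = (fps_nth inv_sqrt_fps n)\<^sup>2" for n
  have rS: "r (Suc n) = r n * ((2 * real n + 1) / (2 * real n + 2))\<^sup>2" for n
    by (simp add: r_def inv_sqrt_fps_Suc power_mult_distrib power_divide)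
  have r0: "r n \<ge> 0" for n by (simp add: r_def)
  have "(\<lambda>n. inverse (\<Prod>k=1..n. (4 * real k ^ 2) / (4 * real k ^ 2 - 1))) \<longlonglongrightarrow> inverse (pi / 2)"
    by (intro tendsto_inverse wallis) auto
  then have "(\<lambda>n. (2 * real n + 1) * r n) \<longlonglongrightarrow> 2 / pi"
    by (simp add: inv_sqrt_fps_wallis r_def)
  then have lim2: "(\<lambda>n. (1/2) * ((2 * real n + 1) * r n)) \<longlonglongrightarrow> (1/2) * (2 / pi)"
    by (intro tendsto_mult tendsto_const)
  then have lim: "(\<lambda>n. (real n + 1/2) * r n) \<longlonglongrightarrow> 1 / pi" by (simp add: algebra_simps)
  have dec: "decseq (\<lambda>n. (real n + 1/2) * r n)"
  proof (rule decseq_SucI)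
    fix n
    have "(real n + 3/2) * ((2 * real n + 1) / (2 * real n + 2))\<^sup>2 \<le> real n + 1/2"
      by (simp add: divide_simps power2_eq_square) (simp add: algebra_simps)
    then have "r n * ((real n + 3/2) * ((2 * real n + 1) / (2 * real n + 2))\<^sup>2) \<le> r n * (real n + 1/2)"
      by (rule mult_left_mono) (rule r0)
    then show "(real (Suc n) + 1/2) * r (Suc n) \<le> (real n + 1/2) * r n" unfolding rS by (simp add: mult_ac add_ac)
  qed
  have "1 / pi \<le> (real n + 1/2) * r n" by (rule decseq_ge[OF dec lim])
  then show "1 / (pi * (real n + 1/2)) \<le> (fps_nth inv_sqrt_fps n)\<^sup>2" by (simp add: r_def divide_simps mult_ac)
  have inc: "incseq (\<lambda>n. real n * r n)"
  proof (rule incseq_SucI)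
    fix n
    have "real n \<le> (real n + 1) * ((2 * real n + 1) / (2 * real n + 2))\<^sup>2"
      by (simp add: divide_simps power2_eq_square) (simp add: algebra_simps)
    then have "r n * real n \<le> r n * ((real n + 1) * ((2 * real n + 1) / (2 * real n + 2))\<^sup>2)"
      by (rule mult_left_mono) (rule r0)
    then show "real n * r n \<le> real (Suc n) * r (Suc n)" unfolding rS by (simp add: mult_ac add_ac)
  qed
  have "(\<lambda>n. (real n + 1/2) * r n * (real n / (real n + 1/2))) \<longlonglongrightarrow> 1 / pi * 1"
    by (intro tendsto_mult lim) real_asymp
  moreover have "(\<lambda>n. (real n + 1/2) * r n * (real n / (real n + 1/2))) = (\<lambda>n. real n * r n)"
    by (rule ext) (simp add: divide_simps)
  ultimately have "real n * r n \<le> 1 / pi" by (intro incseq_le[OF inc]) simp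
  then show "(fps_nth inv_sqrt_fps n)\<^sup>2 \<le> 1 / (pi * real n)" using assms by (simp add: r_def divide_simps mult_ac)
qed

lemma inv_sqrt_fps_approx:
  assumes "n > 0"
  shows "\<bar>fps_nth inv_sqrt_fps n - 1 / sqrt (pi * real n)\<bar> \<le> real n powr - (3/2)"
proof -
  define a b where "a = 1 / sqrt (pi * real n)" and "b = fps_nth inv_sqrt_fps n"
  have a: "a > 0" using assms by (simp add: a_def)
  have a2: "a\<^sup>2 = 1 / (pi * real n)" using assms by (simp add: a_def power_divide)
  have b: "b > 0" by (simp add: b_def inv_sqrt_fps_pos)
  have le: "b \<le> a" using inv_sqrt_fps_bounds(2)[OF assms] a b by (simp flip: a2 b_def add: power2_le_iff_abs_le)
  \<comment> \<open>As a + b >= a, the difference a - b is at most (a^2 - b^2) / a, and squares are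
    what the Wallis bounds control.\<close>
  have "(a - b) * a \<le> (a - b) * (a + b)" using le b by (intro mult_left_mono) auto
  also have "\<dots> = a\<^sup>2 - b\<^sup>2" by (simp add: power2_eq_square algebra_simps)
  also have "\<dots> \<le> 1 / (pi * real n) - 1 / (pi * (real n + 1/2))"
    unfolding a2 b_def using inv_sqrt_fps_bounds(1)[OF assms] by simp
  also have "\<dots> \<le> 1 / (2 * pi * (real n)\<^sup>2)"
    using assms by (simp add: divide_simps power2_eq_square)
  finally have "a - b \<le> 1 / (2 * pi * (real n)\<^sup>2) / a" by (subst pos_le_divide_eq[OF a])
  also have "\<dots> = sqrt (pi * real n) / (2 * pi * (real n)\<^sup>2)" by (simp add: a_def)
  also have "\<dots> = (sqrt pi / (2 * pi)) * (real n powr (1/2) * real n powr - 2)"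
    using assms by (simp add: real_sqrt_mult powr_half_sqrt powr_minus powr_numeral field_simps)
  also have "real n powr (1/2) * real n powr - 2 = real n powr - (3/2)" by (simp flip: powr_add)
  also have "sqrt pi / (2 * pi) * real n powr - (3/2) \<le> 1 * real n powr - (3/2)"
  proof (rule mult_right_mono)
    have "sqrt pi \<le> pi" using pi_ge_two by (intro real_le_lsqrt) (auto simp: power2_eq_square)
    then have "sqrt pi \<le> 2 * pi" using pi_gt_zero by linarith
    then show "sqrt pi / (2 * pi) \<le> 1" by (subst divide_le_eq_1_pos) simp_all
  qed simp
  finally show ?thesis using le unfolding a_def b_def by simp
qed

lemma decay_inv_sqrt_fps: "decay (1/2) inv_sqrt_fps"
proof (rule decayI)
  fix n
  have "fps_nth inv_sqrt_fps n \<le> (real n + 1) powr - (1/2)"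
  proof (cases "n = 0")
    case False
    have "(fps_nth inv_sqrt_fps n)\<^sup>2 \<le> 1 / (pi * real n)" using inv_sqrt_fps_bounds False by simp
    also have "\<dots> \<le> 1 / (real n + 1)"
      proof (rule divide_left_mono)
      have "real n + 1 \<le> 2 * real n" using False by simp
      also have "\<dots> \<le> pi * real n" by (intro mult_right_mono pi_ge_two) simp
      finally show "real n + 1 \<le> pi * real n" .
    qed (use False in auto)
    finally have "fps_nth inv_sqrt_fps n \<le> sqrt (1 / (real n + 1))" by (rule real_le_rsqrt)
    also have "\<dots> = (real n + 1) powr - (1/2)" by (simp add: powr_minus powr_half_sqrt real_sqrt_divide field_simps)
    finally show ?thesis .
  qed simp
  then show "norm (fps_nth inv_sqrt_fps n) \<le> 1 * (real n + 1) powr - (1/2)"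
    using inv_sqrt_fps_pos[of n] by simp
qed

lemma decay_X_mult: "decay \<alpha> f \<Longrightarrow> \<alpha> \<ge> 0 \<Longrightarrow> decay \<alpha> (fps_X * f)"
proof -
  assume f: "decay \<alpha> f" and \<alpha>: "\<alpha> \<ge> 0"
  obtain C where C: "C > 0" "\<And>n. norm (fps_nth f n) \<le> C * (real n + 1) powr - \<alpha>"
    using decayE[OF f] by blast
  show ?thesis
  proof (rule decayI)
    fix n
    show "norm (fps_nth (fps_X * f) n) \<le> (C * 2 powr \<alpha>) * (real n + 1) powr - \<alpha>"
    proof (cases n)
      case (Suc m)
      have "norm (fps_nth f m) \<le> C * (real m + 1) powr - \<alpha>" by (rule C)
      also have "\<dots> \<le> C * ((real n + 1) / 2) powr - \<alpha>"
        using C(1) \<alpha> Suc by (intro mult_left_mono powr_mono2') auto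
      also have "\<dots> = (C * 2 powr \<alpha>) * (real n + 1) powr - \<alpha>" by (simp add: half_powr_minus)
      finally show ?thesis using Suc by simp
    qed (use C in auto)
  qed
qed

lemma decay_sqrt_fps: "decay (3/2) sqrt_fps"
proof -
  have "fps_X * fps_deriv sqrt_fps = fps_const (- (1/2)) * (fps_X * inv_sqrt_fps)"
    unfolding sqrt_fps_deriv by (simp only: mult.left_commute)
  then have "decay (1/2) (fps_X * fps_deriv sqrt_fps)"
    by (simp only: ) (intro decay_cmult decay_X_mult decay_inv_sqrt_fps, simp)
  then have "decay (1/2 + 1) sqrt_fps" by (rule decay_of_X_deriv)
  then show ?thesis by simp
qed

text \<open>By the product rule X d/dX of (1 - X) F is (1 - X) X F' minus X F, and both have order
  3/2. This is how solutions of the linear equations below are seen to vary slowly, as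
  \<open>decay_smooth_mult_three_halves\<close> demands.\<close>

lemma decay_one_minus_X_mult:
  fixes F :: "real fps"
  assumes "decay (3/2) F" "decay (3/2) ((1 - fps_X) * (fps_X * fps_deriv F))"
  shows "decay (5/2) ((1 - fps_X) * F)"
proof -
  have "fps_X * fps_deriv ((1 - fps_X) * F) = (1 - fps_X) * (fps_X * fps_deriv F) - fps_X * F"
    by (simp add: algebra_simps)
  then have "decay (3/2) (fps_X * fps_deriv ((1 - fps_X) * F))"
    using assms by (simp only:) (intro decay_diff decay_X_mult, auto)
  then have "decay (3/2 + 1) ((1 - fps_X) * F)" by (rule decay_of_X_deriv)
  then show ?thesis by simp
qed

lemma X_deriv_sqrt_fps: "(1 - fps_X) * (fps_X * fps_deriv sqrt_fps) = fps_const (- (1/2)) * (fps_X * sqrt_fps)"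
proof -
  have "(1 - fps_X) * (fps_X * (fps_const (- (1/2)) * inv_sqrt_fps)) = fps_const (- (1/2)) * (fps_X * ((1 - fps_X) * inv_sqrt_fps))"
    by (simp only: mult_ac)
  then show ?thesis by (simp only: inv_sqrt_fps_mult sqrt_fps_deriv)
qed

lemma decay_one_minus_X_sqrt_fps: "decay (5/2) ((1 - fps_X) * sqrt_fps)"
  by (rule decay_one_minus_X_mult, rule decay_sqrt_fps, unfold X_deriv_sqrt_fps)
    (intro decay_cmult decay_X_mult decay_sqrt_fps, simp)

lemma decay_sqrt_fps_mult:
  "decay (5/2) g \<Longrightarrow> decay (5/2) (sqrt_fps * g - fps_const (eval_fps g 1) * sqrt_fps)"
  by (rule decay_smooth_mult_three_halves[OF decay_sqrt_fps decay_one_minus_X_sqrt_fps])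

lemma decay_inv_sqrt_fps_mult:
  "decay (5/2) g \<Longrightarrow> decay (3/2) (inv_sqrt_fps * g - fps_const (eval_fps g 1) * inv_sqrt_fps)"
  by (rule decay_smooth_mult_half[OF decay_inv_sqrt_fps]) (simp_all only: inv_sqrt_fps_mult decay_sqrt_fps)


text \<open>Squaring determines the value only up to sign. The sign follows because all coefficients
  from index 1 on are negative, so the value at x is at least the value at 1, which is 0.\<close>

lemma eval_sqrt_fps:
  fixes x :: real
  assumes "0 \<le> x" "x \<le> 1"
  shows "eval_fps sqrt_fps x = sqrt (1 - x)"
proof -
  note s = decay_summable[OF decay_sqrt_fps, simplified]
  have sq: "(eval_fps sqrt_fps y)\<^sup>2 = 1 - y" if "0 \<le> y" "y \<le> 1" for y :: real
  proof -
    have "(eval_fps sqrt_fps y)\<^sup>2 = eval_fps (sqrt_fps * sqrt_fps) y"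
      unfolding power2_eq_square by (rule eval_fps_mult_decay[OF decay_sqrt_fps _ decay_sqrt_fps, symmetric]) (use that in auto)
    also have "\<dots> = 1 - y" unfolding sqrt_fps_square by (subst eval_fps_diff) auto
    finally show ?thesis .
  qed
  have "eval_fps sqrt_fps 1 \<le> eval_fps sqrt_fps x"
    unfolding eval_fps_def
  proof (rule suminf_le)
    show "summable (\<lambda>n. fps_nth sqrt_fps n * 1 ^ n)" "summable (\<lambda>n. fps_nth sqrt_fps n * x ^ n)"
      by (rule summable_norm_cancel[OF summable_l1_power_series]; use s assms in simp)+
    fix n show "fps_nth sqrt_fps n * 1 ^ n \<le> fps_nth sqrt_fps n * x ^ n"
    proof (cases n)
      case (Suc m)
      have "x ^ Suc m \<le> 1" using assms by (intro power_le_one)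
      then show ?thesis unfolding Suc sqrt_fps_Suc
        using inv_sqrt_fps_pos[of m] by (simp add: divide_simps mult_left_le)
    qed simp
  qed
  moreover have "eval_fps sqrt_fps 1 = 0" using sq[of 1] by simp
  ultimately have "0 \<le> eval_fps sqrt_fps x" by simp
  then show ?thesis using real_sqrt_unique[OF sq[OF assms]] by simp
qed

subsection \<open>Series with a square-root singularity\<close>

text \<open>The coefficient form of an expansion f(1) + b (1 - z)^(1/2) + O(1 - z) at z = 1: the
  whole part of order n^(-3/2) sits in b times \<open>sqrt_fps\<close>, and the remainder has an
  absolutely convergent derivative at 1.\<close>

definition sqrt_class :: "real \<Rightarrow> real fps \<Rightarrow> bool" where
  "sqrt_class b f \<longleftrightarrow> decay (5/2) (f - fps_const b * sqrt_fps)"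

lemma eval_sqrt_fps_1: "eval_fps sqrt_fps 1 = 0"
  using eval_sqrt_fps[of 1] by simp

lemma sqrt_class_decay:
  assumes "sqrt_class b f"
  shows "decay (3/2) f"
proof -
  have "decay (3/2) (f - fps_const b * sqrt_fps)"
    using assms unfolding sqrt_class_def by (rule decay_mono) simp
  then have "decay (3/2) (f - fps_const b * sqrt_fps + fps_const b * sqrt_fps)"
    by (intro decay_add decay_cmult decay_sqrt_fps)
  then show ?thesis by simp
qed

lemma sqrt_class_of_decay: "decay (5/2) f \<Longrightarrow> sqrt_class 0 f"
  by (simp add: sqrt_class_def)

lemma sqrt_class_add:
  assumes "sqrt_class b f" "sqrt_class c g"
  shows "sqrt_class (b + c) (f + g)"
proof -
  have "decay (5/2) ((f - fps_const b * sqrt_fps) + (g - fps_const c * sqrt_fps))"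
    using assms unfolding sqrt_class_def by (rule decay_add)
  also have "(f - fps_const b * sqrt_fps) + (g - fps_const c * sqrt_fps) = f + g - fps_const (b + c) * sqrt_fps"
    by (simp add: fps_const_add[symmetric] distrib_right del: fps_const_add)
  finally show ?thesis by (simp add: sqrt_class_def)
qed

lemma sqrt_class_cmult:
  assumes "sqrt_class b f"
  shows "sqrt_class (c * b) (fps_const c * f)"
proof -
  have "decay (5/2) (fps_const c * (f - fps_const b * sqrt_fps))"
    using assms unfolding sqrt_class_def by (rule decay_cmult)
  also have "fps_const c * (f - fps_const b * sqrt_fps) = fps_const c * f - fps_const (c * b) * sqrt_fps"
    by (simp add: fps_const_mult[symmetric] right_diff_distrib mult.assoc del: fps_const_mult)
  finally show ?thesis by (simp add: sqrt_class_def)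
qed

lemma sqrt_class_diff:
  assumes "sqrt_class b f" "sqrt_class c g"
  shows "sqrt_class (b - c) (f - g)"
proof -
  have "sqrt_class (b + (- 1) * c) (f + fps_const (- 1) * g)"
    by (intro sqrt_class_add sqrt_class_cmult assms)
  moreover have "f + fps_const (- 1) * g = f - g"
    by (rule fps_ext) simp
  ultimately show ?thesis by simp
qed

lemma sqrt_class_sum: 
  assumes "\<And>i. i \<in> I \<Longrightarrow> \<exists>b. sqrt_class b (f i)"
  shows "\<exists>b. sqrt_class b (\<Sum>i\<in>I. f i)"
  using assms
proof (induction I rule: infinite_finite_induct)
  case (insert x F)
  then show ?case by (metis sqrt_class_add insertCI sum.insert)
qed (auto intro!: exI[of _ 0] sqrt_class_of_decay decay_0)

lemma sqrt_fps_mult_class: "decay (5/2) g \<Longrightarrow> sqrt_class (eval_fps g 1) (sqrt_fps * g)"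
  unfolding sqrt_class_def by (rule decay_sqrt_fps_mult)

lemma decay_one_minus_X: "decay \<alpha> (1 - fps_X :: real fps)"
  by (intro decay_diff decay_1 decay_X)

text \<open>In the product of b s + f1 and c s + g1 the term s^2 is the polynomial 1 - X, and s f1
  and s g1 are multiples of s up to order 5/2, so no new kind of singularity arises.\<close>

lemma sqrt_class_mult:
  assumes f: "sqrt_class b f" and g: "sqrt_class c g"
  shows "\<exists>e. sqrt_class e (f * g)"
proof -
  define f1 g1 where "f1 = f - fps_const b * sqrt_fps" and "g1 = g - fps_const c * sqrt_fps"
  have d: "decay (5/2) f1" "decay (5/2) g1" using assms by (simp_all add: sqrt_class_def f1_def g1_def)
  have "f * g = (fps_const b * sqrt_fps + f1) * (fps_const c * sqrt_fps + g1)"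
    by (simp add: f1_def g1_def)
  also have "\<dots> = fps_const (b * c) * (sqrt_fps * sqrt_fps) + fps_const b * (sqrt_fps * g1)
      + fps_const c * (sqrt_fps * f1) + f1 * g1"
    by (simp add: fps_const_mult[symmetric] algebra_simps del: fps_const_mult)
  also have "\<dots> = fps_const (b * c) * (1 - fps_X) + fps_const b * (sqrt_fps * g1)
      + fps_const c * (sqrt_fps * f1) + f1 * g1" by (simp only: sqrt_fps_square)
  finally have "f * g = fps_const (b * c) * (1 - fps_X) + fps_const b * (sqrt_fps * g1)
      + fps_const c * (sqrt_fps * f1) + f1 * g1" .
  moreover have "sqrt_class (0 + b * eval_fps g1 1 + c * eval_fps f1 1 + 0)
    (fps_const (b * c) * (1 - fps_X) + fps_const b * (sqrt_fps * g1) + fps_const c * (sqrt_fps * f1) + f1 * g1)"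
    by (intro sqrt_class_add sqrt_class_cmult sqrt_fps_mult_class d sqrt_class_of_decay decay_cmult decay_one_minus_X decay_mult) simp
  ultimately show ?thesis by auto
qed

lemma X_deriv_sqrt_fps': "fps_X * fps_deriv sqrt_fps = fps_const (- (1/2)) * (fps_X * inv_sqrt_fps)"
  unfolding sqrt_fps_deriv by (simp only: mult.left_commute)

lemma sqrt_class_of_X_deriv:
  assumes "decay (3/2) (fps_X * fps_deriv f - fps_const b * (fps_X * fps_deriv sqrt_fps))"
  shows "sqrt_class b f"
proof -
  have "fps_X * fps_deriv (f - fps_const b * sqrt_fps) = fps_X * fps_deriv f - fps_const b * (fps_X * fps_deriv sqrt_fps)"
    by (simp add: right_diff_distrib mult.left_commute)
  with assms have "decay (3/2) (fps_X * fps_deriv (f - fps_const b * sqrt_fps))" by (simp only:)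
  then have "decay (3/2 + 1) (f - fps_const b * sqrt_fps)" by (rule decay_of_X_deriv)
  then show ?thesis by (simp add: sqrt_class_def)
qed

lemma X_deriv_sqrt_class:
  assumes "sqrt_class b L"
  obtains g where "decay (5/2) g" "decay (3/2) (fps_X * fps_deriv g)"
    "L = fps_const b * sqrt_fps + g"
    "fps_X * fps_deriv L = fps_const b * (fps_X * fps_deriv sqrt_fps) + fps_X * fps_deriv g"
proof -
  define g where "g = L - fps_const b * sqrt_fps"
  have g: "decay (5/2) g" using assms by (simp add: sqrt_class_def g_def)
  have L: "L = fps_const b * sqrt_fps + g" by (simp add: g_def)
  have "fps_X * fps_deriv L = fps_const b * (fps_X * fps_deriv sqrt_fps) + fps_X * fps_deriv g"
    unfolding L by (simp add: distrib_left mult.left_commute)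
  moreover have "decay (3/2) (fps_X * fps_deriv g)" using decay_X_deriv[of "3/2" g] g by simp
  ultimately show ?thesis using that g L by blast
qed

lemma decay_one_minus_X_deriv_sqrt_class:
  assumes "sqrt_class b L"
  shows "decay (3/2) ((1 - fps_X) * (fps_X * fps_deriv L))"
proof -
  obtain g where g: "decay (3/2) (fps_X * fps_deriv g)"
    "fps_X * fps_deriv L = fps_const b * (fps_X * fps_deriv sqrt_fps) + fps_X * fps_deriv g"
    using X_deriv_sqrt_class[OF assms] by metis
  have "(1 - fps_X) * (fps_X * fps_deriv L) = fps_const b * ((1 - fps_X) * (fps_X * fps_deriv sqrt_fps)) + (1 - fps_X) * (fps_X * fps_deriv g)"
    unfolding g(2) by (simp only: distrib_left mult.left_commute)
  also have "decay (3/2) \<dots>" unfolding X_deriv_sqrt_fps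
    by (intro decay_add decay_cmult decay_X_mult decay_sqrt_fps decay_mult g decay_one_minus_X) simp_all
  finally show ?thesis .
qed

text \<open>The derivative of s has order 1/2 only, which is outside the range \<alpha> > 1 of
  \<open>decay_mult\<close>. The product is therefore split by hand: s s' is constant, and s' times
  the regular part of N is handled by \<open>decay_inv_sqrt_fps_mult\<close>.\<close>

lemma X_deriv_mult_class:
  assumes L: "sqrt_class b L" and N: "sqrt_class c N"
  shows "\<exists>e. decay (3/2) (fps_X * fps_deriv L * N - fps_const e * (fps_X * fps_deriv sqrt_fps))"
proof -
  obtain g where g: "decay (5/2) g" "decay (3/2) (fps_X * fps_deriv g)"
    "fps_X * fps_deriv L = fps_const b * (fps_X * fps_deriv sqrt_fps) + fps_X * fps_deriv g"
    using X_deriv_sqrt_class[OF L] by metis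
  define h where "h = N - fps_const c * sqrt_fps"
  have h: "decay (5/2) h" using N by (simp add: sqrt_class_def h_def)
  have N: "N = fps_const c * sqrt_fps + h" by (simp add: h_def)
  define e where "e = b * eval_fps h 1"
  have "fps_X * fps_deriv L * N = fps_const (b * c) * (fps_X * (sqrt_fps * fps_deriv sqrt_fps))
      + fps_const b * ((fps_X * fps_deriv sqrt_fps) * h) + fps_X * fps_deriv g * N"
    unfolding g(3) N by (simp add: fps_const_mult[symmetric] algebra_simps del: fps_const_mult)
  then have "fps_X * fps_deriv L * N - fps_const e * (fps_X * fps_deriv sqrt_fps)
    = fps_const (b * c) * (fps_X * fps_const (- (1/2))) + (fps_const b * ((fps_X * fps_deriv sqrt_fps) * h)
      - fps_const e * (fps_X * fps_deriv sqrt_fps)) + fps_X * fps_deriv g * N"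
    by (simp only: sqrt_fps_mult_deriv) (simp add: algebra_simps)
  also have "fps_const b * ((fps_X * fps_deriv sqrt_fps) * h) - fps_const e * (fps_X * fps_deriv sqrt_fps)
     = fps_const b * (fps_const (- (1/2)) * (fps_X * (inv_sqrt_fps * h - fps_const (eval_fps h 1) * inv_sqrt_fps)))" (is "?l = ?r")
    unfolding X_deriv_sqrt_fps' e_def 
    by (simp add: fps_const_mult[symmetric] algebra_simps del: fps_const_mult)
  finally have eq: "fps_X * fps_deriv L * N - fps_const e * (fps_X * fps_deriv sqrt_fps)
    = fps_const (b * c) * (fps_X * fps_const (- (1/2))) + ?r + fps_X * fps_deriv g * N" .
  have "decay (3/2) (fps_const (b * c) * (fps_X * fps_const (- (1/2))) + ?r + fps_X * fps_deriv g * N)"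
    by (intro decay_add decay_cmult decay_X_mult decay_inv_sqrt_fps_mult h decay_const decay_mult g sqrt_class_decay[OF assms(2)]) simp_all
  then show ?thesis unfolding eq[symmetric] by blast
qed

text \<open>As K has no constant term, the equation is a recursion that expresses n H_n through
  earlier coefficients. It identifies a solution with the composed exponential.\<close>

lemma X_deriv_linear_unique:
  fixes F G K :: "real fps"
  assumes "fps_X * fps_deriv F = F * K" "fps_X * fps_deriv G = G * K" "fps_nth K 0 = 0" "fps_nth F 0 = fps_nth G 0"
  shows "F = G"
proof -
  define H where "H = F - G"
  have H: "fps_X * fps_deriv H = H * K" using assms by (simp add: H_def algebra_simps)
  have "fps_nth H n = 0" for n
  proof (induction n rule: less_induct)
    case (less n)
    show ?case
    proof (cases "n = 0")
      case False
      have "real n * fps_nth H n = fps_nth (fps_X * fps_deriv H) n" by (simp only: fps_X_deriv_nth)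
      also have "\<dots> = (\<Sum>i=0..n. fps_nth H i * fps_nth K (n - i))" unfolding H by (rule fps_mult_nth)
      also have "\<dots> = 0"
      proof (rule sum.neutral, rule ballI)
        fix i assume "i \<in> {0..n}"
        then show "fps_nth H i * fps_nth K (n - i) = 0"
          using less assms(3) by (cases "i = n") auto
      qed
      finally show ?thesis using False by simp
    qed (simp add: H_def assms)
  qed
  then have "H = 0" by (intro fps_ext) simp
  then show ?thesis by (simp add: H_def)
qed

text \<open>With L = b s + g, the product Y = F (1 - b s) satisfies
  X Y' = F (X g' (1 - b s) + b^2 X / 2), so the singular part of F is b Y(1) s.\<close>

lemma sqrt_class_exp:
  assumes L: "sqrt_class b L" and ode: "fps_X * fps_deriv F = F * (fps_X * fps_deriv L)" and F0: "fps_nth F 0 = 1"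
  shows "\<exists>e. sqrt_class e F"
proof -
  define L0 where "L0 = L - fps_const (fps_nth L 0)"
  have "F = fps_exp 1 oo L0"
  proof (rule X_deriv_linear_unique[OF ode])
    have "fps_deriv (fps_exp 1 oo L0) = (fps_deriv (fps_exp 1) oo L0) * fps_deriv L0"
      by (rule fps_compose_deriv) (simp add: L0_def)
    also have "\<dots> = (fps_exp 1 oo L0) * fps_deriv L" by (simp add: L0_def)
    finally show "fps_X * fps_deriv (fps_exp 1 oo L0) = (fps_exp 1 oo L0) * (fps_X * fps_deriv L)"
      by (simp add: mult.left_commute)
  qed (simp_all add: F0)
  \<comment> \<open>The exponential series gives the order 3/2 only; the differential equation is
    then used again to extract the singular part at order 5/2.\<close>
  moreover have "decay (3/2) (fps_exp 1 oo L0)" unfolding L0_def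
    by (intro decay_exp_compose decay_diff sqrt_class_decay[OF L] decay_const) simp
  ultimately have dF: "decay (3/2) F" by simp
  obtain g where g: "decay (5/2) g" "decay (3/2) (fps_X * fps_deriv g)"
    "fps_X * fps_deriv L = fps_const b * (fps_X * fps_deriv sqrt_fps) + fps_X * fps_deriv g"
    using X_deriv_sqrt_class[OF L] by metis
  define s where "s = fps_const b * sqrt_fps"
  define Y where "Y = F * (1 - s)"
  have ss: "s * (fps_X * fps_deriv s) = fps_const (- (b\<^sup>2 / 2)) * fps_X"
  proof -
    have "s * (fps_X * fps_deriv s) = fps_const (b * b) * (fps_X * (sqrt_fps * fps_deriv sqrt_fps))"
      by (simp add: s_def fps_const_mult[symmetric] mult_ac del: fps_const_mult)
    also have "\<dots> = fps_const (- (b\<^sup>2 / 2)) * fps_X"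
      by (simp add: sqrt_fps_mult_deriv power2_eq_square mult.commute mult.left_commute)
    finally show ?thesis .
  qed
  have gs: "fps_X * fps_deriv L = fps_X * fps_deriv s + fps_X * fps_deriv g"
    unfolding g(3) s_def by (simp add: mult.left_commute)
  have "fps_X * fps_deriv Y = (fps_X * fps_deriv F) * (1 - s) - F * (fps_X * fps_deriv s)"
    by (simp add: Y_def algebra_simps)
  also have "\<dots> = F * (fps_X * fps_deriv g * (1 - s) - s * (fps_X * fps_deriv s))"
    unfolding ode gs by (simp add: algebra_simps)
  also have "decay (3/2) \<dots>"
    unfolding ss unfolding s_def by (intro decay_mult dF decay_diff g decay_1 decay_cmult decay_sqrt_fps decay_X) simp_all
  finally have "decay (3/2 + 1) Y" by (rule decay_of_X_deriv)
  then have dY: "decay (5/2) Y" by simp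
  have "(1 - fps_X) * (fps_X * fps_deriv F) = F * ((1 - fps_X) * (fps_X * fps_deriv L))"
    unfolding ode by (simp only: mult.left_commute)
  also have "decay (3/2) \<dots>"
    by (intro decay_mult dF decay_one_minus_X_deriv_sqrt_class[OF L]) simp
  finally have smooth: "decay (5/2) ((1 - fps_X) * F)" by (rule decay_one_minus_X_mult[OF dF])
  \<comment> \<open>Since s s = 1 - X, the unknown product s F reduces to s Y with Y of order 5/2,
    and to (1 - X) F, which has order 5/2 by slow variation.\<close>
  have sF: "sqrt_fps * F = sqrt_fps * Y + fps_const b * ((1 - fps_X) * F)"
    unfolding Y_def s_def sqrt_fps_square[symmetric] by (simp add: algebra_simps)
  have "F = Y + fps_const b * (sqrt_fps * F)" by (simp add: Y_def s_def algebra_simps)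
  also have "sqrt_class (0 + b * (eval_fps Y 1 + b * 0)) (Y + fps_const b * (sqrt_fps * F))"
    unfolding sF by (intro sqrt_class_add sqrt_class_cmult sqrt_class_of_decay dY smooth sqrt_fps_mult_class)
  finally show ?thesis by blast
qed

text \<open>With D = 1 / f and f = b s + g, multiplying a D + b s D = Y by s gives
  a s D = s Y - b (1 - X) D, and D in turn is (Y - b s D) / a.\<close>

lemma sqrt_class_inverse:
  assumes f: "sqrt_class b f"
    and nz: "\<And>z::complex. norm z \<le> 1 \<Longrightarrow> eval_fps (fps_complex f) z \<noteq> 0"
  shows "sqrt_class (- b / (eval_fps f 1)\<^sup>2) (inverse f)"
proof -
  define D where "D = inverse f"
  define a where "a = eval_fps f 1"
  have df: "decay (3/2) f" by (rule sqrt_class_decay[OF f])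
  have dD: "decay (3/2) D" unfolding D_def
    by (rule decay_inverse[OF df]) (use nz in \<open>auto simp: eval_fps_def\<close>)
  have "eval_fps (fps_complex f) 1 = of_real a"
    unfolding a_def eval_fps_def using decay_summable[OF df] by (simp add: suminf_of_real summable_rabs_cancel)
  then have a: "a \<noteq> 0" using nz[of 1] by auto
  have "fps_nth f 0 \<noteq> 0" using nz[of 0] by (simp add: eval_fps_at_0)
  then have fD: "f * D = 1" by (simp add: D_def inverse_mult_eq_1')
  define g where "g = f - fps_const b * sqrt_fps"
  have g: "decay (5/2) g" using f by (simp add: sqrt_class_def g_def)
  have fg: "f = g + fps_const b * sqrt_fps" by (simp add: g_def)
  have eg: "eval_fps g 1 = a"
  proof -
    have "eval_fps f 1 = eval_fps g 1 + eval_fps (fps_const b * sqrt_fps) 1"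
      by (subst fg, rule eval_fps_add_decay[OF g _ decay_cmult[OF decay_sqrt_fps]]) auto
    also have "eval_fps (fps_const b * sqrt_fps) 1 = eval_fps (fps_const b) 1 * eval_fps sqrt_fps 1"
      by (rule eval_fps_mult_decay[OF decay_const[of 2] _ decay_sqrt_fps]) auto
    finally show ?thesis by (simp add: a_def eval_sqrt_fps_1)
  qed
  have derD: "fps_X * fps_deriv D = - (D * D) * (fps_X * fps_deriv f)"
  proof -
    have "fps_deriv (f * D) = 0" by (simp add: fD)
    then have "D * (f * fps_deriv D) = - D * (fps_deriv f * D)"
      by (simp add: distrib_left[symmetric] eq_neg_iff_add_eq_0)
    moreover have "D * (f * fps_deriv D) = fps_deriv D" by (metis fD mult.assoc mult.commute mult_1_left)
    ultimately show ?thesis by (simp add: mult_ac)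
  qed
  have "(1 - fps_X) * (fps_X * fps_deriv D) = - (D * D) * ((1 - fps_X) * (fps_X * fps_deriv f))"
    unfolding derD by (simp only: mult.left_commute)
  also have "decay (3/2) \<dots>"
    by (intro decay_mult decay_uminus dD decay_one_minus_X_deriv_sqrt_class[OF f]) simp_all
  finally have smooth: "decay (5/2) ((1 - fps_X) * D)" by (rule decay_one_minus_X_mult[OF dD])
  define Y where "Y = fps_const a * D + fps_const b * (sqrt_fps * D)"
  \<comment> \<open>From f D = 1. The bracket has order 5/2, although D has only order 3/2, because
    D varies slowly.\<close>
  have "Y = 1 - (D * g - fps_const (eval_fps g 1) * D)"
    unfolding eg unfolding fD[symmetric] Y_def g_def by (simp add: algebra_simps)
  also have "decay (5/2) \<dots>"
    by (intro decay_diff decay_1 decay_smooth_mult_three_halves dD smooth g)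
  finally have dY: "decay (5/2) Y" .
  \<comment> \<open>At 1 the factor s vanishes, so Y(1) = a D(1) = f(1) D(1) = 1; this value yields
    the coefficient - b / a^2.\<close>
  have eY: "eval_fps Y 1 = 1"
  proof -
    have d2: "decay (3/2) (fps_const a + fps_const b * sqrt_fps)"
      by (intro decay_add decay_const decay_cmult decay_sqrt_fps)
    have "Y = (fps_const a + fps_const b * sqrt_fps) * D" by (simp add: Y_def algebra_simps)
    then have "eval_fps Y 1 = eval_fps (fps_const a + fps_const b * sqrt_fps) 1 * eval_fps D 1"
      by (simp only:) (rule eval_fps_mult_decay[OF d2 _ dD], auto)
    also have "eval_fps (fps_const a + fps_const b * sqrt_fps) 1 = eval_fps (fps_const a) 1 + eval_fps (fps_const b * sqrt_fps) 1"
      by (rule eval_fps_add_decay[OF decay_const[of 2] _ decay_cmult[OF decay_sqrt_fps]]) auto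
    also have "eval_fps (fps_const b * sqrt_fps) 1 = eval_fps (fps_const b) 1 * eval_fps sqrt_fps 1"
      by (rule eval_fps_mult_decay[OF decay_const[of 2] _ decay_sqrt_fps]) auto
    finally have "eval_fps Y 1 = a * eval_fps D 1" by (simp add: eval_sqrt_fps_1)
    also have "\<dots> = eval_fps (f * D) 1"
      unfolding a_def by (rule eval_fps_mult_decay[OF df _ dD, symmetric]) auto
    finally show ?thesis by (simp add: fD)
  qed
  have "fps_const a * (sqrt_fps * D) = sqrt_fps * Y - fps_const b * ((1 - fps_X) * D)"
    unfolding Y_def sqrt_fps_square[symmetric] by (simp add: algebra_simps)
  then have "fps_const (1 / a) * (fps_const a * (sqrt_fps * D)) = fps_const (1 / a) * (sqrt_fps * Y - fps_const b * ((1 - fps_X) * D))"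
    by simp
  then have sD: "sqrt_fps * D = fps_const (1 / a) * (sqrt_fps * Y - fps_const b * ((1 - fps_X) * D))"
    using a by (simp add: mult.assoc[symmetric])
  have "fps_const (1 / a) * (fps_const a * D) = fps_const (1 / a) * (Y - fps_const b * (sqrt_fps * D))"
    by (simp add: Y_def)
  then have DY: "D = fps_const (1 / a) * (Y - fps_const b * (sqrt_fps * D))"
    using a by (simp add: mult.assoc[symmetric])
  have "sqrt_class ((1 / a) * (0 - b * ((1 / a) * (eval_fps Y 1 - b * 0)))) (fps_const (1 / a) * (Y - fps_const b * (sqrt_fps * D)))"
    unfolding sD by (intro sqrt_class_diff sqrt_class_cmult sqrt_class_of_decay dY smooth sqrt_fps_mult_class)
  then show ?thesis unfolding DY[symmetric] eY by (simp add: D_def a_def power2_eq_square)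
qed

subsection \<open>Lattice walks and the Wiener--Hopf factorisation\<close>

notation fls_nth (infixl "$$" 75)

lemma fls_times_nth_wide:
  fixes f g :: "real fls"
  assumes "lo \<le> fls_subdegree f" "n - fls_subdegree g \<le> hi"
  shows "(f * g) $$ n = (\<Sum>i\<in>{lo..hi}. f $$ i * g $$ (n - i))"
  unfolding fls_times_nth(2)
  by (rule sum.mono_neutral_left) (use assms in auto)

text \<open>Bivariate series are power series in z whose coefficients are Laurent series in u, and
  the factorisation separates them by the sign of the exponent of u. The strictly negative part
  absorbs multiplication by non-positive exponents, which keeps the logarithmic derivative of the
  second factor strictly negative.\<close>

definition nonneg_fls :: "real fls set" where "nonneg_fls = {f. \<forall>k<0. f $$ k = 0}"
definition nonpos_fls :: "real fls set" where "nonpos_fls = {f. \<forall>k>0. f $$ k = 0}"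
definition neg_fls :: "real fls set" where "neg_fls = {f. \<forall>k\<ge>0. f $$ k = 0}"

lemma nonneg_fls_mult:
  assumes "f \<in> nonneg_fls" "g \<in> nonneg_fls"
  shows "(f * g) $$ k = (\<Sum>i\<in>{0..k}. f $$ i * g $$ (k - i))" "f * g \<in> nonneg_fls"
proof -
  have *: "(f * g) $$ k = (\<Sum>i\<in>{0..k}. f $$ i * g $$ (k - i))" for k
  proof -
    have "(f * g) $$ k = (\<Sum>i\<in>{min 0 (fls_subdegree f)..max k (k - fls_subdegree g)}. f $$ i * g $$ (k - i))"
      by (rule fls_times_nth_wide) auto
    also have "\<dots> = (\<Sum>i\<in>{0..k}. f $$ i * g $$ (k - i))"
      by (rule sum.mono_neutral_right) (use assms in \<open>auto simp: nonneg_fls_def\<close>)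
    finally show ?thesis .
  qed
  show "(f * g) $$ k = (\<Sum>i\<in>{0..k}. f $$ i * g $$ (k - i))" by (rule *)
  show "f * g \<in> nonneg_fls" by (auto simp: nonneg_fls_def *)
qed

lemma nonpos_fls_mult:
  assumes "f \<in> nonpos_fls" "g \<in> nonpos_fls"
  shows "f * g \<in> nonpos_fls"
proof -
  have "(f * g) $$ k = 0" if "k > 0" for k
    unfolding fls_times_nth(2)
  proof (rule sum.neutral, rule ballI)
    fix i show "f $$ i * g $$ (k - i) = 0"
      using assms that by (cases "i > 0") (auto simp: nonpos_fls_def)
  qed
  then show ?thesis by (simp add: nonpos_fls_def)
qed

lemma neg_fls_mult:
  assumes "f \<in> neg_fls" "g \<in> nonpos_fls"
  shows "f * g \<in> neg_fls"
proof -
  have "(f * g) $$ k = 0" if "k \<ge> 0" for k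
    unfolding fls_times_nth(2)
  proof (rule sum.neutral, rule ballI)
    fix i show "f $$ i * g $$ (k - i) = 0"
      using assms that by (cases "i \<ge> 0") (auto simp: nonpos_fls_def neg_fls_def)
  qed
  then show ?thesis by (simp add: neg_fls_def)
qed

lemma fls_sum_closed:
  assumes "\<And>i. i \<in> I \<Longrightarrow> f i \<in> S" "S \<in> {nonneg_fls, nonpos_fls, neg_fls}"
  shows "(\<Sum>i\<in>I. f i) \<in> S"
  using assms by (fastforce simp: nonneg_fls_def nonpos_fls_def neg_fls_def fls_nth_sum intro!: sum.neutral)

text \<open>The constant term 1 makes the recursion for the inverse free of divisions, so only sums
  and products inside the half-plane algebra occur.\<close>

lemma fps_inverse_coeffs_closed:
  fixes F :: "real fls fps"
  assumes F0: "fps_nth F 0 = 1" and F: "\<And>n. fps_nth F n \<in> S" and S: "S \<in> {nonneg_fls, nonpos_fls}"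
  shows "fps_nth (inverse F) n \<in> S"
proof (induction n rule: less_induct)
  case (less n)
  have one: "1 \<in> S" using S by (auto simp: nonneg_fls_def nonpos_fls_def)
  have "F * inverse F = 1" by (rule inverse_mult_eq_1') (simp add: F0)
  then have "fps_nth (F * inverse F) n = (if n = 0 then 1 else 0)" by simp
  then have "fps_nth (inverse F) n + (\<Sum>i=1..n. fps_nth F i * fps_nth (inverse F) (n - i)) = (if n = 0 then 1 else 0)"
    by (simp add: fps_mult_nth sum.atLeast_Suc_atMost F0)
  then have "fps_nth (inverse F) n = (if n = 0 then 1 else 0) - (\<Sum>i=1..n. fps_nth F i * fps_nth (inverse F) (n - i))"
    by (simp add: eq_diff_eq)
  moreover have "(\<Sum>i=1..n. fps_nth F i * fps_nth (inverse F) (n - i)) \<in> S"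
    by (rule fls_sum_closed) (use S F less in \<open>auto intro: nonneg_fls_mult nonpos_fls_mult\<close>)
  ultimately show ?case using S one by (auto simp: nonneg_fls_def nonpos_fls_def)
qed

locale jump_weights =
  fixes c d :: nat and p :: "int \<Rightarrow> real"
  assumes c_pos: "c \<ge> 1" and d_pos: "d \<ge> 1"
    and p_nonneg: "\<And>i. p i \<ge> 0"
    and p_support: "\<And>i. i < - int c \<or> i > int d \<Longrightarrow> p i = 0"
    and p_c: "p (- int c) \<noteq> 0" and p_d: "p (int d) \<noteq> 0"
begin

lemma jumps_subset: "jumps p \<subseteq> {- int c..int d}"
proof
  fix i assume "i \<in> jumps p"
  then have "p i \<noteq> 0" by (simp add: jumps_def)
  then have "\<not> (i < - int c \<or> i > int d)" using p_support by blast
  then show "i \<in> {- int c..int d}" by auto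
qed

lemma finite_jumps: "finite (jumps p)"
  using jumps_subset finite_subset by blast

lemma minus_c_jump: "- int c \<in> jumps p" and d_jump: "int d \<in> jumps p"
  using p_c p_d by (auto simp: jumps_def)

lemma p_c_pos: "p (- int c) > 0" and p_d_pos: "p (int d) > 0"
  using p_c p_d p_nonneg[of "- int c"] p_nonneg[of "int d"] by auto

text \<open>The coefficient of u^k in P(u)^n. The recursion serves as definition because the powers
  of \<open>jump_fls\<close> and the local limit theorem share it.\<close>

fun walk_count :: "nat \<Rightarrow> int \<Rightarrow> real" where
  "walk_count 0 k = (if k = 0 then 1 else 0)"
| "walk_count (Suc n) k = (\<Sum>i\<in>jumps p. p i * walk_count n (k - i))"

lemma walk_count_nonneg: "walk_count n k \<ge> 0"
  by (induction n arbitrary: k) (auto intro!: sum_nonneg mult_nonneg_nonneg p_nonneg)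

lemma walk_count_support: "k > int (d * n) \<or> k < - int (c * n) \<Longrightarrow> walk_count n k = 0"
proof (induction n arbitrary: k)
  case (Suc n)
  have "p i * walk_count n (k - i) = 0" if "i \<in> jumps p" for i
  proof -
    have "i \<in> {- int c..int d}" using that jumps_subset by blast
    then have "k - i > int (d * n) \<or> k - i < - int (c * n)" using Suc.prems by (auto simp: algebra_simps)
    then show ?thesis using Suc.IH by simp
  qed
  then show ?case by (simp only: walk_count.simps sum.neutral[OF ballI])
qed auto

lemma finite_meanders: "finite (meanders p n)"
proof -
  have "meanders p n \<subseteq> {xs. set xs \<subseteq> jumps p \<and> length xs = n}" by (auto simp: meanders_def)
  then show ?thesis using finite_lists_length_eq[OF finite_jumps, of n] finite_subset by blast
qed

lemma path_weight_nonneg: "path_weight p xs \<ge> 0"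
  unfolding path_weight_def by (induction xs) (auto intro: mult_nonneg_nonneg p_nonneg)

lemma meanders_snoc:
  "ys @ [i] \<in> meanders p (Suc n) \<longleftrightarrow> ys \<in> meanders p n \<and> i \<in> jumps p \<and> sum_list ys + i \<ge> 0"
proof
  assume a: "ys @ [i] \<in> meanders p (Suc n)"
  then have len: "length ys = n" and J: "set ys \<subseteq> jumps p" "i \<in> jumps p"
    and pos: "\<And>m. m \<le> Suc n \<Longrightarrow> 0 \<le> sum_list (take m (ys @ [i]))" by (auto simp: meanders_def)
  have "0 \<le> sum_list (take m ys)" if "m \<le> n" for m using pos[of m] that len by simp
  moreover have "0 \<le> sum_list ys + i" using pos[of "Suc n"] len by simp
  ultimately show "ys \<in> meanders p n \<and> i \<in> jumps p \<and> sum_list ys + i \<ge> 0"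
    using len J by (auto simp: meanders_def)
next
  assume "ys \<in> meanders p n \<and> i \<in> jumps p \<and> sum_list ys + i \<ge> 0"
  then show "ys @ [i] \<in> meanders p (Suc n)"
    by (auto simp: meanders_def le_Suc_eq)
qed

lemma meander_count_0: "meander_count p 0 k = (if k = 0 then 1 else 0)"
proof -
  have "{xs \<in> meanders p 0. sum_list xs = k} = (if k = 0 then {[]} else {})"
    by (auto simp: meanders_def)
  then show ?thesis by (simp add: meander_count_def path_weight_def)
qed

lemma meander_count_neg: "k < 0 \<Longrightarrow> meander_count p n k = 0"
proof -
  assume "k < 0"
  have "sum_list xs \<ge> 0" if "xs \<in> meanders p n" for xs
  proof -
    have "0 \<le> sum_list (take n xs)" using that unfolding meanders_def by blast
    then show ?thesis using that by (simp add: meanders_def)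
  qed
  then have "{xs \<in> meanders p n. sum_list xs = k} = {}" using \<open>k < 0\<close> by force
  then show ?thesis by (simp only: meander_count_def sum.empty)
qed

lemma meander_count_Suc:
  assumes "k \<ge> 0"
  shows "meander_count p (Suc n) k = (\<Sum>i\<in>jumps p. p i * meander_count p n (k - i))"
proof -
  have "(\<Sum>i\<in>jumps p. p i * meander_count p n (k - i))
      = (\<Sum>i\<in>jumps p. \<Sum>ys\<in>{ys \<in> meanders p n. sum_list ys = k - i}. p i * path_weight p ys)"
    by (simp add: meander_count_def sum_distrib_left)
  also have "\<dots> = (\<Sum>(i,ys)\<in>(SIGMA i:jumps p. {ys \<in> meanders p n. sum_list ys = k - i}). p i * path_weight p ys)"
    by (rule sum.Sigma) (auto intro: finite_jumps finite_subset[OF _ finite_meanders])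
  also have "\<dots> = meander_count p (Suc n) k" unfolding meander_count_def
  proof (rule sum.reindex_bij_witness[of _ "\<lambda>xs. (last xs, butlast xs)" "\<lambda>(i, ys). ys @ [i]"])
    fix xs assume xs: "xs \<in> {xs \<in> meanders p (Suc n). sum_list xs = k}"
    then have ne: "xs \<noteq> []" by (auto simp: meanders_def)
    then have e: "butlast xs @ [last xs] = xs" by simp
    have s: "sum_list (butlast xs) + last xs = sum_list xs" by (subst (3) e[symmetric]) simp
    show "(case (last xs, butlast xs) of (i, ys) \<Rightarrow> ys @ [i]) = xs" using e by simp
    have "butlast xs @ [last xs] \<in> meanders p (Suc n)" using xs e by simp
    then show "(last xs, butlast xs) \<in> (SIGMA i:jumps p. {ys \<in> meanders p n. sum_list ys = k - i})"
      unfolding meanders_snoc using s xs by auto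
  qed (use assms in \<open>auto simp: meanders_snoc path_weight_def\<close>)
  finally show ?thesis by simp
qed

lemma meander_count_nonneg: "meander_count p n k \<ge> 0"
  unfolding meander_count_def by (intro sum_nonneg path_weight_nonneg)

lemma meander_count_le_walk_count: "meander_count p n k \<le> walk_count n k"
proof (induction n arbitrary: k)
  case (Suc n)
  show ?case
  proof (cases "k \<ge> 0")
    case True
    then show ?thesis unfolding meander_count_Suc[OF True]
      by (auto intro!: sum_mono mult_left_mono Suc p_nonneg)
  next
    case False
    then show ?thesis using walk_count_nonneg[of "Suc n" k] by (simp add: meander_count_neg)
  qed
qed (simp add: meander_count_0)

lemma meander_count_support: "k > int (d * n) \<Longrightarrow> meander_count p n k = 0"
  using meander_count_le_walk_count[of n k] meander_count_nonneg[of n k] walk_count_support[of n k] by simp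

lemma Mall_nth: "fps_nth (Mall p) n = (\<Sum>k\<in>{0..int (d * n)}. meander_count p n k)"
proof -
  have range: "sum_list xs \<in> {0..int (d * n)}" if xs: "xs \<in> meanders p n" for xs
  proof -
    have "0 \<le> sum_list (take n xs)" using xs unfolding meanders_def by blast
    moreover have "set xs \<subseteq> jumps p" "length xs = n" using xs by (auto simp: meanders_def)
    moreover have "sum_list ys \<le> int (d * length ys)" if "set ys \<subseteq> jumps p" for ys
      using that jumps_subset by (induction ys) (force simp: algebra_simps)+
    ultimately show ?thesis by fastforce
  qed
  have "(\<Sum>xs\<in>meanders p n. path_weight p xs)
     = (\<Sum>k\<in>{0..int (d * n)}. \<Sum>xs\<in>{xs \<in> meanders p n. sum_list xs = k}. path_weight p xs)"
    by (rule sum.group[symmetric]) (use finite_meanders range in auto)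
  then show ?thesis by (simp add: Mall_def meander_count_def)
qed

definition jump_fls :: "real fls" where
  "jump_fls = (\<Sum>i\<in>jumps p. fls_const (p i) * fls_X_intpow i)"

lemma jump_fls_times_nth: "(jump_fls * f) $$ k = (\<Sum>i\<in>jumps p. p i * f $$ (k - i))"
proof -
  have "(fls_const (p i) * fls_X_intpow i * f) $$ k = p i * f $$ (k - i)" for i
    by (subst mult.assoc, subst fls_X_intpow_times_conv_shift(1)) simp
  then show ?thesis unfolding jump_fls_def sum_distrib_right fls_nth_sum by simp
qed

lemma jump_fls_power_nth: "(jump_fls ^ n) $$ k = walk_count n k"
  by (induction n arbitrary: k) (simp_all add: jump_fls_times_nth)

text \<open>Taking \<open>fls_regpart\<close> after each step deletes the negative powers of u, that
  is, the paths that drop below 0. The deleted parts, with opposite sign, make up the other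
  Wiener-Hopf factor.\<close>

fun meander_fls :: "nat \<Rightarrow> real fls" where
  "meander_fls 0 = 1"
| "meander_fls (Suc n) = fps_to_fls (fls_regpart (jump_fls * meander_fls n))"

lemma meander_fls_nth: "meander_fls n $$ k = meander_count p n k"
proof (induction n arbitrary: k)
  case (Suc n)
  then show ?case
    by (cases "k < 0") (simp_all add: meander_count_neg meander_count_Suc jump_fls_times_nth)
qed (simp add: meander_count_0)

text \<open>Spitzer's identity, from the uniqueness of the Wiener--Hopf factorisation
  (1 - z P) M = G: the logarithmic derivative of M lives on non-negative powers of u,
  the one of G on negative powers, and they differ by z P / (1 - z P).\<close>

theorem spitzer_identity:
  assumes "k \<ge> 0"
  shows "real n * meander_count p n k =
    (\<Sum>m=1..n. \<Sum>i\<in>{0..k}. walk_count m i * meander_count p (n - m) (k - i))"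
proof -
  define M where "M = Abs_fps meander_fls"
  define W where "W = Abs_fps (\<lambda>n. jump_fls ^ n)"
  define G where "G = (1 - fps_const jump_fls * fps_X) * M"
  define A where "A = fps_X * fps_deriv M * inverse M"
  define B where "B = fps_X * fps_deriv G * inverse G"
  have Mpos: "fps_nth M n \<in> nonneg_fls" for n
    by (simp add: M_def nonneg_fls_def meander_fls_nth meander_count_neg)
  have M0: "fps_nth M 0 = 1" by (simp add: M_def)
  have G0: "fps_nth G 0 = 1" by (simp add: G_def M0)
  \<comment> \<open>Beyond the constant term G consists of minus the parts deleted by
    \<open>fls_regpart\<close>, hence of negative powers only.\<close>
  have GS: "fps_nth G (Suc n) \<in> neg_fls" for n
  proof -
    have "fps_nth G (Suc n) = meander_fls (Suc n) - jump_fls * meander_fls n"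
      by (simp add: G_def M_def left_diff_distrib mult.assoc del: meander_fls.simps)
    then show ?thesis by (simp add: neg_fls_def)
  qed
  have Gnp: "fps_nth G n \<in> nonpos_fls" for n
    using G0 GS[of "n - 1"] by (cases n) (auto simp: neg_fls_def nonpos_fls_def)
  have W: "(1 - fps_const jump_fls * fps_X) * W = 1"
  proof (rule fps_ext)
    fix n show "fps_nth ((1 - fps_const jump_fls * fps_X) * W) n = fps_nth 1 n"
      by (cases n) (simp_all add: W_def left_diff_distrib mult.assoc)
  qed
  have MI: "M * inverse M = 1" by (rule inverse_mult_eq_1') (simp add: M0)
  have "inverse G = W * inverse M"
  proof (rule fps_inverse_unique)
    have "G * (W * inverse M) = ((1 - fps_const jump_fls * fps_X) * W) * (M * inverse M)"
      unfolding G_def by (simp only: mult_ac)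
    then show "G * (W * inverse M) = 1" by (simp add: W MI)
  qed
  have "fps_X * fps_deriv G = (1 - fps_const jump_fls * fps_X) * (fps_X * fps_deriv M) - fps_const jump_fls * fps_X * M"
    unfolding G_def by (simp add: algebra_simps)
  then have "B = (1 - fps_const jump_fls * fps_X) * (fps_X * fps_deriv M) * (W * inverse M) - fps_const jump_fls * fps_X * M * (W * inverse M)"
    unfolding B_def \<open>inverse G = W * inverse M\<close> by (simp add: left_diff_distrib)
  also have "\<dots> = ((1 - fps_const jump_fls * fps_X) * W) * A - fps_const jump_fls * fps_X * W * (M * inverse M)"
    unfolding A_def by (simp only: mult_ac)
  \<comment> \<open>The logarithmic derivative of G = (1 - z P) M, where W = 1 / (1 - z P).\<close>
  finally have AB: "A = B + fps_const jump_fls * fps_X * W" by (simp add: W MI)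
  have A_pos: "fps_nth A n \<in> nonneg_fls" for n
    unfolding A_def fps_mult_nth[of "fps_X * fps_deriv M"] fps_X_deriv_nth
  proof (rule fls_sum_closed)
    fix i
    have "of_nat i * fps_nth M i \<in> nonneg_fls" using Mpos[of i] by (auto simp: nonneg_fls_def)
    then show "of_nat i * fps_nth M i * fps_nth (inverse M) (n - i) \<in> nonneg_fls"
      using fps_inverse_coeffs_closed[OF M0 Mpos, of "n - i"] by (rule nonneg_fls_mult(2)) auto
  qed auto
  have B_neg: "fps_nth B n \<in> neg_fls" for n
    unfolding B_def fps_mult_nth[of "fps_X * fps_deriv G"] fps_X_deriv_nth
  proof (rule fls_sum_closed)
    fix i
    have "of_nat i * fps_nth G i \<in> neg_fls" using GS[of "i - 1"] by (cases i) (auto simp: neg_fls_def simp del: of_nat_Suc)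
    then show "of_nat i * fps_nth G i * fps_nth (inverse G) (n - i) \<in> neg_fls"
      using fps_inverse_coeffs_closed[OF G0 Gnp, of "n - i"] by (rule neg_fls_mult) auto
  qed auto
  have A0: "fps_nth A 0 = 0" by (simp add: A_def)
  \<comment> \<open>At exponents i >= 0 the series B is invisible, so A shows the coefficient of u^i
    in P^m there.\<close>
  have A_nth: "fps_nth A m $$ i = walk_count m i" if "i \<ge> 0" "m \<ge> 1" for m i
  proof -
    have "fps_nth A m = fps_nth B m + jump_fls ^ m"
      unfolding AB using that(2) by (cases m) (simp_all add: W_def mult.assoc)
    then show ?thesis using B_neg[of m] that by (simp add: neg_fls_def jump_fls_power_nth)
  qed
  have "of_nat n * meander_fls n = fps_nth (fps_X * fps_deriv M) n" by (simp only: fps_X_deriv_nth) (simp add: M_def)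
  also have "fps_X * fps_deriv M = fps_X * fps_deriv M * (inverse M * M)"
    using MI by (simp add: mult.commute)
  also have "\<dots> = A * M" by (simp only: A_def mult_ac)
  also have "fps_nth (A * M) n = (\<Sum>m=1..n. fps_nth A m * meander_fls (n - m))"
    by (simp add: fps_mult_nth sum.atLeast_Suc_atMost A0 M_def)
  finally have "(of_nat n * meander_fls n) $$ k = (\<Sum>m=1..n. (fps_nth A m * meander_fls (n - m)) $$ k)"
    by (simp only: fls_nth_sum)
  also have "\<dots> = (\<Sum>m=1..n. \<Sum>i\<in>{0..k}. walk_count m i * meander_count p (n - m) (k - i))"
  proof (rule sum.cong[OF refl])
    fix m assume m: "m \<in> {1..n}"
    have "(fps_nth A m * meander_fls (n - m)) $$ k = (\<Sum>i\<in>{0..k}. fps_nth A m $$ i * meander_fls (n - m) $$ (k - i))"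
      by (rule nonneg_fls_mult(1)) (use A_pos Mpos[of "n - m"] in \<open>simp_all add: M_def\<close>)
    also have "\<dots> = (\<Sum>i\<in>{0..k}. walk_count m i * meander_count p (n - m) (k - i))"
      by (rule sum.cong[OF refl]) (use A_nth m in \<open>simp add: meander_fls_nth\<close>)
    finally show "(fps_nth A m * meander_fls (n - m)) $$ k = (\<Sum>i\<in>{0..k}. walk_count m i * meander_count p (n - m) (k - i))" .
  qed
  finally show ?thesis by (simp add: meander_fls_nth)
qed

end

subsection \<open>A local limit theorem with error term\<close>

lemma gaussian_has_integral:
  assumes "a > 0"
  shows "((\<lambda>x::real. exp (- a * x\<^sup>2)) has_integral sqrt (pi / a)) UNIV"
proof -
  define s where "s = 1 / sqrt (2 * a)"
  have s: "s > 0" "s\<^sup>2 = 1 / (2 * a)" using assms by (simp_all add: s_def power_divide)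
  have "(normal_density 0 s has_integral 1) UNIV"
    using has_integral_integral_lborel[of "normal_density 0 s"] s by simp
  then have "((\<lambda>x. sqrt (pi / a) * normal_density 0 s x) has_integral (sqrt (pi / a) * 1)) UNIV"
    by (rule has_integral_mult_right)
  moreover have "sqrt (pi / a) * normal_density 0 s x = exp (- a * x\<^sup>2)" for x
    using assms unfolding normal_density_def s(2) by (simp add: real_sqrt_divide field_simps)
  ultimately show ?thesis by simp
qed

text \<open>Cutting off at pi costs at most a factor of order 1/a relative to the full integral.
  With a proportional to n this is the relative error 1/n that is allowed later.\<close>

lemma gaussian_truncated:
  assumes "a > 0"
  shows "(\<lambda>x::real. exp (- a * x\<^sup>2)) integrable_on {-pi..pi}"
    "integral {-pi..pi} (\<lambda>x. exp (- a * x\<^sup>2)) \<le> sqrt (pi / a)"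
    "sqrt (pi / a) - integral {-pi..pi} (\<lambda>x. exp (- a * x\<^sup>2)) \<le> sqrt (2 * pi / a) / a"
proof -
  let ?g = "\<lambda>x::real. exp (- a * x\<^sup>2)"
  show int: "?g integrable_on {-pi..pi}" by (intro integrable_continuous_interval continuous_intros)
  then have "(?g has_integral integral {-pi..pi} ?g) {-pi..pi}" by (rule integrable_integral)
  then have R: "((\<lambda>x. if x \<in> {-pi..pi} then ?g x else 0) has_integral integral {-pi..pi} ?g) UNIV"
    by (simp only: has_integral_restrict_UNIV)
  show "integral {-pi..pi} ?g \<le> sqrt (pi / a)"
    by (rule has_integral_le[OF R gaussian_has_integral[OF assms]]) auto
  \<comment> \<open>Outside [-pi, pi] half of the exponent is bounded by its value at pi, and the
    other half is kept for integrability.\<close>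
  have "((\<lambda>x::real. exp (- (a * pi\<^sup>2 / 2)) * exp (- (a / 2) * x\<^sup>2)) has_integral exp (- (a * pi\<^sup>2 / 2)) * sqrt (pi / (a / 2))) UNIV"
    by (intro has_integral_mult_right gaussian_has_integral) (use assms in auto)
  note has_integral_add[OF R this]
  then have "sqrt (pi / a) \<le> integral {-pi..pi} ?g + exp (- (a * pi\<^sup>2 / 2)) * sqrt (pi / (a / 2))"
  proof (rule has_integral_le[OF gaussian_has_integral[OF assms]])
    fix x :: real
    show "?g x \<le> (if x \<in> {-pi..pi} then ?g x else 0) + exp (- (a * pi\<^sup>2 / 2)) * exp (- (a / 2) * x\<^sup>2)"
    proof (cases "x \<in> {-pi..pi}")
      case False
      then have "pi \<le> \<bar>x\<bar>" by auto
      then have "pi\<^sup>2 \<le> x\<^sup>2" by (metis abs_le_square_iff abs_of_pos pi_gt_zero)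
      then have "a * pi\<^sup>2 \<le> a * x\<^sup>2" using assms by simp
      then have "?g x \<le> exp (- (a * pi\<^sup>2 / 2) + - (a / 2) * x\<^sup>2)" by simp
      then show ?thesis using False by (simp add: exp_add[symmetric])
    qed simp
  qed
  moreover have "exp (- (a * pi\<^sup>2 / 2)) * sqrt (pi / (a / 2)) \<le> 1 / a * sqrt (pi / (a / 2))"
  proof (rule mult_right_mono)
    have "a * 1 \<le> a * (pi\<^sup>2 / 2)" using assms pi_ge_two
      by (intro mult_left_mono) (auto simp: power2_eq_square intro: order.trans[OF _ mult_mono[of 2 pi 2 pi]])
    also have "\<dots> \<le> exp (a * pi\<^sup>2 / 2)" using exp_ge_add_one_self[of "a * pi\<^sup>2 / 2"] by linarith
    finally show "exp (- (a * pi\<^sup>2 / 2)) \<le> 1 / a" using assms by (simp add: exp_minus divide_simps)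
  qed (use assms in simp)
  moreover have "1 / a * sqrt (pi / (a / 2)) = sqrt (2 * pi / a) / a" by (simp add: mult.commute)
  ultimately show "sqrt (pi / a) - integral {-pi..pi} ?g \<le> sqrt (2 * pi / a) / a" by linarith
qed

text \<open>This removes the skewness term and the term linear in k, both of relative order n^(-1/2)
  or larger before integration, and so makes a relative error of order 1/n possible.\<close>

lemma integral_odd_eq_0:
  fixes f :: "real \<Rightarrow> complex"
  assumes "\<And>x. f (- x) = - f x"
  shows "integral {-pi..pi} f = 0"
proof -
  have "integral {-pi..pi} (\<lambda>x. f (- x)) = integral {-pi..pi} f"
    using Henstock_Kurzweil_Integration.integral_reflect_real[of pi "-pi" f] by simp
  then have "integral {-pi..pi} f = - integral {-pi..pi} f" by (simp add: assms)
  then show ?thesis by (simp add: eq_neg_iff_add_eq_0)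
qed

lemma power_le_exp:
  fixes y :: real assumes "y \<ge> 0" shows "y ^ j \<le> fact j * exp y"
proof -
  have "y ^ j / fact j \<le> (\<Sum>i<Suc j. y ^ i / fact i)" using assms by (intro member_le_sum) auto
  also have "\<dots> \<le> exp y"
    using assms sum_le_suminf[OF summable_exp[of y], of "{..<Suc j}"] unfolding exp_def
    by (simp add: divide_inverse mult.commute)
  finally show ?thesis by (simp add: field_simps)
qed

text \<open>The remainder obeys E_(n+1) = x E_n + n y^(n-1) (x - y)^2, which gives the bound by
  induction. The factor m^2 on the left stands for the exponent n - 2 without truncated subtraction
  or division by m.\<close>

lemma power_second_order:
  fixes x y :: complex
  assumes "norm x \<le> m" "norm y \<le> m"
  shows "norm (x ^ n - y ^ n - of_nat n * y ^ (n - 1) * (x - y)) * m\<^sup>2 \<le> (real n)\<^sup>2 * (norm (x - y))\<^sup>2 * m ^ n"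
proof (induction n)
  case (Suc n)
  define E where "E n = x ^ n - y ^ n - of_nat n * y ^ (n - 1) * (x - y)" for n
  have m0: "m \<ge> 0" using assms norm_ge_zero order.trans by blast
  have "E (Suc n) = x * E n + of_nat n * y ^ (n - 1) * (x - y)\<^sup>2"
    by (cases n) (simp_all add: E_def power2_eq_square algebra_simps)
  then have "norm (E (Suc n)) \<le> norm x * norm (E n) + real n * norm y ^ (n - 1) * (norm (x - y))\<^sup>2"
    by (simp add: norm_triangle_le norm_mult norm_power)
  then have "norm (E (Suc n)) * m\<^sup>2 \<le> norm x * (norm (E n) * m\<^sup>2) + real n * (norm y ^ (n - 1) * m\<^sup>2) * (norm (x - y))\<^sup>2"
    using mult_right_mono[of "norm (E (Suc n))" "norm x * norm (E n) + real n * norm y ^ (n - 1) * (norm (x - y))\<^sup>2" "m\<^sup>2"]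
    by (simp add: algebra_simps)
  also have "\<dots> \<le> m * ((real n)\<^sup>2 * (norm (x - y))\<^sup>2 * m ^ n) + real n * m ^ Suc n * (norm (x - y))\<^sup>2"
  proof (rule add_mono)
    show "norm x * (norm (E n) * m\<^sup>2) \<le> m * ((real n)\<^sup>2 * (norm (x - y))\<^sup>2 * m ^ n)"
      by (rule mult_mono) (use Suc assms m0 in \<open>simp_all add: E_def\<close>)
    have "real n * (norm y ^ (n - 1) * m\<^sup>2) \<le> real n * m ^ Suc n"
    proof (cases n)
      case (Suc j)
      have "norm y ^ j * m\<^sup>2 \<le> m ^ j * m\<^sup>2" using assms by (intro mult_right_mono power_mono) auto
      then have "real n * (norm y ^ j * m\<^sup>2) \<le> real n * (m ^ j * m\<^sup>2)" by (rule mult_left_mono) simp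
      then show ?thesis using Suc by (simp add: power2_eq_square mult_ac)
    qed simp
    then show "real n * (norm y ^ (n - 1) * m\<^sup>2) * (norm (x - y))\<^sup>2 \<le> real n * m ^ Suc n * (norm (x - y))\<^sup>2"
      by (rule mult_right_mono) simp
  qed
  also have "\<dots> = ((real n)\<^sup>2 + real n) * ((norm (x - y))\<^sup>2 * m ^ Suc n)" by (simp add: algebra_simps)
  also have "\<dots> \<le> (real (Suc n))\<^sup>2 * ((norm (x - y))\<^sup>2 * m ^ Suc n)"
    using m0 by (intro mult_right_mono) (auto simp: power2_eq_square algebra_simps)
  finally show ?case by (simp add: E_def mult.assoc)
qed simp

text \<open>\<open>span\<close> says that the differences of elements of \<open>J\<close> generate
  the integers, in the form in which the characteristic function uses it.\<close>

locale centered_law =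
  fixes J :: "int set" and w :: "int \<Rightarrow> real"
  assumes finite_J: "finite J"
    and w_pos: "\<And>i. i \<in> J \<Longrightarrow> w i > 0"
    and w_sum: "(\<Sum>i\<in>J. w i) = 1"
    and w_mean: "(\<Sum>i\<in>J. w i * of_int i) = 0"
    and nontrivial: "\<exists>i\<in>J. i \<noteq> 0"
    and span: "\<And>t. (\<And>i j. i \<in> J \<Longrightarrow> j \<in> J \<Longrightarrow> cis (t * of_int (i - j)) = 1) \<Longrightarrow> cis t = 1"
begin

definition chf :: "real \<Rightarrow> complex" where
  "chf t = (\<Sum>i\<in>J. of_real (w i) * cis (t * of_int i))"

definition var :: real where "var = (\<Sum>i\<in>J. w i * (of_int i)\<^sup>2)"

lemma var_pos: "var > 0"
proof -
  obtain i where i: "i \<in> J" "i \<noteq> 0" using nontrivial by blast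
  have "0 < w i * (of_int i)\<^sup>2" using w_pos[OF i(1)] i by simp
  also have "\<dots> \<le> var" unfolding var_def
    by (rule member_le_sum[OF i(1)]) (use w_pos finite_J in \<open>auto simp: less_imp_le\<close>)
  finally show ?thesis .
qed

lemma continuous_chf [continuous_intros]: "continuous_on S chf"
  unfolding chf_def by (intro continuous_intros)

lemma norm_chf_le_1: "norm (chf t) \<le> 1"
proof -
  have "norm (chf t) \<le> (\<Sum>i\<in>J. w i)"
    unfolding chf_def by (rule sum_norm_le) (use w_pos in \<open>auto simp: norm_mult less_imp_le\<close>)
  then show ?thesis by (simp add: w_sum)
qed

text \<open>Equality in the triangle inequality: a convex combination of unit vectors has norm 1
  only if all of them coincide with it. Then cis (t (i - j)) = 1 on \<open>J\<close>, and
  \<open>span\<close> makes t a multiple of 2 pi.\<close>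

lemma norm_chf_less_1:
  assumes "t \<noteq> 0" "\<bar>t\<bar> \<le> pi"
  shows "norm (chf t) < 1"
proof (rule ccontr)
  assume "\<not> ?thesis"
  then have n1: "norm (chf t) = 1" using norm_chf_le_1[of t] by simp
  define s where "s = chf t"
  have s1: "s * cnj s = 1" using n1 by (simp add: complex_norm_square[symmetric] s_def)
  have "(\<Sum>i\<in>J. w i * (1 - Re (cis (t * of_int i) * cnj s))) = (\<Sum>i\<in>J. w i) - Re (\<Sum>i\<in>J. of_real (w i) * cis (t * of_int i) * cnj s)"
    by (simp add: right_diff_distrib sum_subtractf mult.assoc)
  also have "(\<Sum>i\<in>J. of_real (w i) * cis (t * of_int i) * cnj s) = s * cnj s"
    by (simp add: s_def chf_def sum_distrib_right)
  finally have sum0: "(\<Sum>i\<in>J. w i * (1 - Re (cis (t * of_int i) * cnj s))) = 0" by (simp add: s1 w_sum)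
  have le: "Re (cis (t * of_int i) * cnj s) \<le> 1" for i
    using complex_Re_le_cmod[of "cis (t * of_int i) * cnj s"] n1 by (simp add: norm_mult s_def)
  have eq: "cis (t * of_int i) = s" if "i \<in> J" for i
  proof -
    have "w i * (1 - Re (cis (t * of_int i) * cnj s)) = 0"
      using sum0 by (subst (asm) sum_nonneg_eq_0_iff) (use finite_J that w_pos le in \<open>auto simp: less_imp_le\<close>)
    then have re: "Re (cis (t * of_int i) * cnj s) = 1" using w_pos[OF that] by simp
    have "norm (cis (t * of_int i) * cnj s) = 1" using n1 by (simp add: norm_mult s_def)
    then have "(Im (cis (t * of_int i) * cnj s)) = 0"
      using re by (metis cmod_power2 add_cancel_left_right power2_eq_iff power_one zero_eq_power2)
    then have "cis (t * of_int i) * cnj s = 1" using re by (simp add: complex_eq_iff)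
    then have "cis (t * of_int i) * (cnj s * s) = s" by (simp add: mult.assoc[symmetric])
    then show ?thesis using s1 by (simp add: mult.commute)
  qed
  have "cis t = 1"
  proof (rule span)
    fix i j assume ij: "i \<in> J" "j \<in> J"
    have "cis (t * of_int (i - j)) = cis (t * of_int i) / cis (t * of_int j)"
      by (simp add: cis_divide algebra_simps)
    then show "cis (t * of_int (i - j)) = 1" using eq ij s1 by auto
  qed
  then have "cos t = 1" by (simp add: cis.code complex_eq_iff)
  then obtain k :: int where k: "t = of_int k * 2 * pi" using cos_one_2pi_int by auto
  then have "k = 0"
  proof -
    have "\<bar>of_int k * 2\<bar> * pi \<le> pi" using assms(2) unfolding k by (simp add: abs_mult)
    then have "\<bar>of_int k * 2 :: real\<bar> \<le> 1" by simp
    then show ?thesis by simp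
  qed
  then show False using k assms by simp
qed

text \<open>The cubic Taylor coefficient of the characteristic function; being purely imaginary, it
  has no counterpart in the Gaussian.\<close>

definition skew :: complex where "skew = - \<i> * of_real (\<Sum>i\<in>J. w i * (of_int i) ^ 3) / 6"

lemma chf_taylor:
  "norm (chf t - (1 - of_real (var * t\<^sup>2 / 2) + skew * of_real t ^ 3)) \<le> (\<Sum>i\<in>J. w i * (of_int i) ^ 4) / 24 * t ^ 4"
proof -
  define T where "T x = (\<Sum>k\<le>3. (\<i> * complex_of_real x) ^ k / fact k)" for x
  have T: "T x = 1 + \<i> * of_real x - of_real (x\<^sup>2 / 2) - \<i> * of_real (x ^ 3) / 6" for x
    by (simp add: T_def numeral_3_eq_3 power2_eq_square field_simps fact_numeral)
  have "(\<Sum>i\<in>J. of_real (w i) * T (t * of_int i)) =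
     of_real (\<Sum>i\<in>J. w i) + \<i> * of_real (t * (\<Sum>i\<in>J. w i * of_int i)) - of_real (var * t\<^sup>2 / 2) + skew * of_real t ^ 3"
    unfolding T var_def skew_def
    by (simp add: algebra_simps sum.distrib sum_subtractf sum_distrib_left sum_distrib_right sum_divide_distrib power_mult_distrib sum_negf)
  then have main: "(\<Sum>i\<in>J. of_real (w i) * T (t * of_int i)) = 1 - of_real (var * t\<^sup>2 / 2) + skew * of_real t ^ 3"
    by (simp add: w_sum w_mean)
  have "chf t - (\<Sum>i\<in>J. of_real (w i) * T (t * of_int i)) = (\<Sum>i\<in>J. of_real (w i) * (cis (t * of_int i) - T (t * of_int i)))"
    by (simp add: chf_def sum_subtractf right_diff_distrib)
  also have "norm \<dots> \<le> (\<Sum>i\<in>J. w i * ((t * of_int i) ^ 4 / 24))"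
  proof (rule sum_norm_le)
    fix i assume i: "i \<in> J"
    have "norm (cis (t * of_int i) - T (t * of_int i)) \<le> \<bar>t * of_int i\<bar> ^ Suc 3 / fact (Suc 3)"
      unfolding T_def cis_conv_exp using iexp_approx1[of "t * of_int i" 3] by simp
    also have "\<dots> = (t * of_int i) ^ 4 / 24" by (simp add: fact_numeral)
    finally show "norm (of_real (w i) * (cis (t * of_int i) - T (t * of_int i))) \<le> w i * ((t * of_int i) ^ 4 / 24)"
      using w_pos[OF i] by (simp add: norm_mult mult_left_mono)
  qed
  also have "\<dots> = (\<Sum>i\<in>J. w i * (of_int i) ^ 4) / 24 * t ^ 4"
    unfolding sum_divide_distrib sum_distrib_right power_mult_distrib by (rule sum.cong) auto
  finally show ?thesis by (simp add: main)
qed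

definition gauss :: "real \<Rightarrow> complex" where "gauss t = of_real (exp (- (var / 2) * t\<^sup>2))"

text \<open>Mean 0 and equal variance make the two functions agree to second order. The difference
  is cubic, and quartic once the \<open>skew\<close> term is removed. Both orders are needed: the
  cubic one enters the n-th power squared, the quartic one linearly.\<close>

lemma chf_minus_gauss:
  obtains C where "C > 0"
    "\<And>t. \<bar>t\<bar> \<le> pi \<Longrightarrow> norm (chf t - gauss t) \<le> C * \<bar>t\<bar> ^ 3"
    "\<And>t. \<bar>t\<bar> \<le> pi \<Longrightarrow> norm (chf t - gauss t - skew * of_real t ^ 3) \<le> C * t ^ 4"
proof -
  define K where "K = (\<Sum>i\<in>J. w i * (of_int i) ^ 4) / 24 + var\<^sup>2 / 4"
  have K0: "K \<ge> 0" unfolding K_def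
    by (intro add_nonneg_nonneg divide_nonneg_nonneg sum_nonneg mult_nonneg_nonneg) (use w_pos in \<open>auto simp: less_imp_le\<close>)
  have 1: "norm (chf t - gauss t - skew * of_real t ^ 3) \<le> K * t ^ 4" for t
  proof -
    define y where "y = var * t\<^sup>2 / 2"
    have y: "y \<ge> 0" using var_pos by (simp add: y_def)
    have "exp (- y) \<ge> 1 - y" using exp_ge_add_one_self[of "- y"] by simp
    \<comment> \<open>Obtained from exp (- y) <= 1 / (1 + y) and (1 - y + y^2) (1 + y) = 1 +
      y^3.\<close>
    moreover have "exp (- y) \<le> 1 - y + y\<^sup>2"
    proof -
      have "exp (- y) \<le> 1 / (1 + y)"
        using exp_ge_add_one_self[of y] y by (simp add: exp_minus divide_simps)
      also have "\<dots> \<le> 1 - y + y\<^sup>2"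
      proof -
        have "(1 - y + y\<^sup>2) * (1 + y) = 1 + y ^ 3" by (simp add: power2_eq_square power3_eq_cube algebra_simps)
        then show ?thesis using y by (simp add: divide_le_eq)
      qed
      finally show ?thesis .
    qed
    ultimately have "\<bar>1 - y - exp (- y)\<bar> \<le> y\<^sup>2" by simp
    moreover have "1 - of_real (var * t\<^sup>2 / 2) - gauss t = complex_of_real (1 - y - exp (- y))"
      by (simp add: gauss_def y_def)
    ultimately have g: "norm (1 - of_real (var * t\<^sup>2 / 2) - gauss t) \<le> y\<^sup>2" by (simp only: norm_of_real)
    have "chf t - gauss t - skew * of_real t ^ 3 = (chf t - (1 - of_real (var * t\<^sup>2 / 2) + skew * of_real t ^ 3)) + (1 - of_real (var * t\<^sup>2 / 2) - gauss t)"
      by simp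
    also have "norm \<dots> \<le> (\<Sum>i\<in>J. w i * (of_int i) ^ 4) / 24 * t ^ 4 + y\<^sup>2"
      by (intro norm_triangle_mono chf_taylor g)
    also have "y\<^sup>2 = var\<^sup>2 / 4 * t ^ 4" by (simp add: y_def power2_eq_square power4_eq_xxxx)
    finally show ?thesis by (simp add: K_def algebra_simps)
  qed
  have 2: "norm (chf t - gauss t) \<le> (norm skew + K * pi) * \<bar>t\<bar> ^ 3" if "\<bar>t\<bar> \<le> pi" for t
  proof -
    have "norm (chf t - gauss t) \<le> norm (chf t - gauss t - skew * of_real t ^ 3) + norm (skew * of_real t ^ 3)"
      using norm_triangle_sub[of "chf t - gauss t" "skew * of_real t ^ 3"] by simp
    also have "\<dots> \<le> K * t ^ 4 + norm skew * \<bar>t\<bar> ^ 3"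
      by (intro add_mono 1) (simp add: norm_mult norm_power)
    also have "t ^ 4 = \<bar>t\<bar> * \<bar>t\<bar> ^ 3" by (simp add: power4_eq_xxxx power3_eq_cube)
    also have "K * (\<bar>t\<bar> * \<bar>t\<bar> ^ 3) \<le> K * (pi * \<bar>t\<bar> ^ 3)"
      using that K0 by (intro mult_left_mono mult_right_mono) auto
    finally show ?thesis by (simp add: algebra_simps)
  qed
  define C where "C = norm skew + K * pi + K + 1"
  have nn: "norm skew \<ge> 0" "K * pi \<ge> 0" using K0 by auto
  show ?thesis
  proof (rule that[of C])
    show "C > 0" using nn K0 unfolding C_def by linarith
    fix t :: real assume t: "\<bar>t\<bar> \<le> pi"
    have "(norm skew + K * pi) * \<bar>t\<bar> ^ 3 \<le> C * \<bar>t\<bar> ^ 3" using K0 by (intro mult_right_mono) (auto simp: C_def)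
    then show "norm (chf t - gauss t) \<le> C * \<bar>t\<bar> ^ 3" using 2[OF t] by linarith
    have "K * t ^ 4 \<le> C * t ^ 4" using nn by (intro mult_right_mono) (auto simp: C_def)
    then show "norm (chf t - gauss t - skew * of_real t ^ 3) \<le> C * t ^ 4" using 1[of t] by linarith
  qed
qed

text \<open>Near 0 the comparison with the Gaussian gives the bound; away from 0 the norm is at most
  some m < 1 by compactness. Requiring a <= var / 2 lets the same majorant serve for
  \<open>gauss\<close> too.\<close>

lemma norm_chf_le_gauss:
  obtains a where "0 < a" "a \<le> var / 2" "\<And>t. \<bar>t\<bar> \<le> pi \<Longrightarrow> norm (chf t) \<le> exp (- a * t\<^sup>2)"
proof -
  obtain C where C: "C > 0"
    "\<And>t. \<bar>t\<bar> \<le> pi \<Longrightarrow> norm (chf t - gauss t) \<le> C * \<bar>t\<bar> ^ 3"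
    "\<And>t. \<bar>t\<bar> \<le> pi \<Longrightarrow> norm (chf t - gauss t - skew * of_real t ^ 3) \<le> C * t ^ 4"
    by (rule chf_minus_gauss) (rule that)
  define V where "V = exp (- (var / 2) * pi\<^sup>2)"
  \<comment> \<open>Chosen so that the cubic error C |t|^3 consumes at most half of the quadratic
    gain (var V / 2) t^2, where V bounds the Gaussian from below on [-pi, pi].\<close>
  define e where "e = min pi (var * V / (4 * C))"
  have e: "e > 0" "e \<le> pi" using C var_pos by (auto simp: e_def V_def)
  have near: "norm (chf t) \<le> exp (- (var * V / 4) * t\<^sup>2)" if t: "\<bar>t\<bar> \<le> e" for t
  proof -
    have tpi: "\<bar>t\<bar> \<le> pi" using t e by simp
    define y where "y = (var / 2) * t\<^sup>2"
    have y: "y \<ge> 0" using var_pos by (simp add: y_def)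
    have yV: "exp (- y) \<ge> V"
    proof -
      have "t\<^sup>2 \<le> pi\<^sup>2" using tpi by (metis abs_le_square_iff abs_of_pos pi_gt_zero)
      then show ?thesis using var_pos by (simp add: y_def V_def mult_left_mono)
    qed
    have "norm (chf t) \<le> exp (- y) + C * \<bar>t\<bar> ^ 3"
    proof -
      have "norm (chf t) \<le> norm (gauss t) + norm (chf t - gauss t)" by (metis norm_triangle_sub)
      also have "norm (gauss t) = exp (- y)" by (simp add: gauss_def y_def)
      finally show ?thesis using C(2)[OF tpi] by linarith
    qed
    also have "exp (- y) \<le> 1 - y * V"
    proof -
      have "1 + y \<le> exp y" using exp_ge_add_one_self[of y] by simp
      then have "exp (- y) * (1 + y) \<le> exp (- y) * exp y" by (intro mult_left_mono) auto
      then have "exp (- y) * (1 + y) \<le> 1" by (simp add: exp_minus)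
      moreover have "y * V \<le> y * exp (- y)" using y yV by (intro mult_left_mono)
      ultimately show ?thesis by (simp add: algebra_simps)
    qed
    also have "C * \<bar>t\<bar> ^ 3 \<le> (var * V / 4) * t\<^sup>2"
    proof -
      have "C * \<bar>t\<bar> \<le> C * (var * V / (4 * C))" using t C by (intro mult_left_mono) (auto simp: e_def)
      also have "\<dots> = var * V / 4" using C by simp
      finally have "(C * \<bar>t\<bar>) * t\<^sup>2 \<le> (var * V / 4) * t\<^sup>2" by (intro mult_right_mono) auto
      then show ?thesis by (simp add: power3_eq_cube power2_eq_square mult_ac)
    qed
    finally have "norm (chf t) \<le> 1 + - (var * V / 4) * t\<^sup>2" by (simp add: y_def mult_ac)
    also have "\<dots> \<le> exp (- (var * V / 4) * t\<^sup>2)" by (rule exp_ge_add_one_self)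
    finally show ?thesis .
  qed
  define S where "S = {-pi..-e} \<union> {e..pi}"
  have "compact S" "S \<noteq> {}" using e by (auto simp: S_def)
  then obtain x where x: "x \<in> S" "\<And>y. y \<in> S \<Longrightarrow> norm (chf y) \<le> norm (chf x)"
    using continuous_attains_sup[of S "\<lambda>t. norm (chf t)"] by (auto intro!: continuous_intros)
  \<comment> \<open>The maximum with 1/2 keeps m positive, so that its logarithm can define the rate
    b.\<close>
  define m where "m = max (norm (chf x)) (1/2)"
  have "norm (chf x) < 1" using x e by (intro norm_chf_less_1) (auto simp: S_def)
  then have m: "0 < m" "m < 1" by (auto simp: m_def)
  define b where "b = - ln m / pi\<^sup>2"
  have b: "b > 0" using m by (simp add: b_def divide_neg_pos)
  have far: "norm (chf t) \<le> exp (- b * t\<^sup>2)" if "\<bar>t\<bar> \<le> pi" "\<bar>t\<bar> \<ge> e" for t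
  proof -
    have "t \<in> S" using that by (auto simp: S_def)
    then have "norm (chf t) \<le> m" using x by (simp add: m_def le_max_iff_disj)
    also have "m = exp (- b * pi\<^sup>2)" using m by (simp add: b_def)
    also have "\<dots> \<le> exp (- b * t\<^sup>2)"
    proof -
      have "t\<^sup>2 \<le> pi\<^sup>2" using that by (metis abs_le_square_iff abs_of_pos pi_gt_zero)
      then show ?thesis using b by simp
    qed
    finally show ?thesis .
  qed
  define a where "a = min (var / 2) (min (var * V / 4) b)"
  show ?thesis
  proof (rule that[of a])
    show "0 < a" using var_pos b by (simp add: a_def V_def)
    show "a \<le> var / 2" by (simp add: a_def)
    fix t :: real assume t: "\<bar>t\<bar> \<le> pi"
    have le: "exp (- x * t\<^sup>2) \<le> exp (- a * t\<^sup>2)" if "a \<le> x" for x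
      using that by (simp add: mult_right_mono)
    show "norm (chf t) \<le> exp (- a * t\<^sup>2)"
    proof (cases "\<bar>t\<bar> \<le> e")
      case True
      show ?thesis by (rule order.trans[OF near[OF True] le]) (simp add: a_def)
    next
      case False
      show ?thesis by (rule order.trans[OF far[OF t] le]) (use False in \<open>simp_all add: a_def\<close>)
    qed
  qed
qed

text \<open>The main term is the first-order expansion in two perturbations, of \<open>chf\<close>
  around \<open>gauss\<close> and of the phase around 1. Both corrections are odd in t and will
  integrate to 0; the rest is of second order, that is O(1/n) against a slightly wider
  Gaussian.\<close>

lemma chf_power_pointwise:
  obtains a C where "a > 0" "C > 0"
    "\<And>n k t. n \<ge> 1 \<Longrightarrow> \<bar>t\<bar> \<le> pi \<Longrightarrow>
      norm (chf t ^ n * cis (- (of_int k * t)) - (gauss t ^ n * (1 - \<i> * of_real (of_int k * t)) + of_nat n * skew * of_real t ^ 3 * gauss t ^ (n - 1)))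
      \<le> C * (1 + (of_int k)\<^sup>2) / real n * exp (- (a * real n) * t\<^sup>2)"
proof -
  obtain C where C: "C > 0"
    "\<And>t. \<bar>t\<bar> \<le> pi \<Longrightarrow> norm (chf t - gauss t) \<le> C * \<bar>t\<bar> ^ 3"
    "\<And>t. \<bar>t\<bar> \<le> pi \<Longrightarrow> norm (chf t - gauss t - skew * of_real t ^ 3) \<le> C * t ^ 4"
    by (rule chf_minus_gauss) (rule that)
  obtain a where a: "0 < a" "a \<le> var / 2" "\<And>t. \<bar>t\<bar> \<le> pi \<Longrightarrow> norm (chf t) \<le> exp (- a * t\<^sup>2)"
    by (rule norm_chf_le_gauss) (rule that)
  \<comment> \<open>On [-pi, pi] one has 1 <= B m for m = exp (- a t^2), so B pays for every missing
    power of m: in \<open>gauss t ^ (n - 1)\<close> and in the factor m^2 of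
    \<open>power_second_order\<close>.\<close>
  define B where "B = exp (a * pi\<^sup>2)"
  have B1: "B \<ge> 1" using a by (simp add: B_def)
  define D where "D = C\<^sup>2 * B\<^sup>2 + 1 + 2 * (B * C)"
  have D0: "D > 0" unfolding D_def using C B1 by (intro add_pos_nonneg add_nonneg_pos) auto
  \<comment> \<open>Half of the Gaussian decay is spent on polynomial factors: x^j <= j! h^j exp (a
    x / 2) for x = n t^2, and F collects j = 1, 2, 3.\<close>
  define h where "h = 2 / a"
  define F where "F = h + 2 * h\<^sup>2 + 6 * h ^ 3"
  have h0: "h > 0" using a by (simp add: h_def)
  have F0: "F > 0" unfolding F_def using h0 by (intro add_pos_pos) auto
  have bound: "norm (chf t ^ n * cis (- (of_int k * t)) - (gauss t ^ n * (1 - \<i> * of_real (of_int k * t)) + of_nat n * skew * of_real t ^ 3 * gauss t ^ (n - 1)))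
      \<le> (D * F) * (1 + (of_int k)\<^sup>2) / real n * exp (- (a / 2 * real n) * t\<^sup>2)"
    if n: "n \<ge> 1" and t: "\<bar>t\<bar> \<le> pi" for n k t
  proof -
    define m where "m = exp (- a * t\<^sup>2)"
    define H where "H = cis (- (of_int k * t))"
    define K where "K = 1 + (real_of_int k)\<^sup>2"
    have K1: "\<bar>real_of_int k\<bar> \<le> K" "(real_of_int k)\<^sup>2 \<le> K" "1 \<le> K"
    proof -
      have "0 \<le> (\<bar>real_of_int k\<bar> - 1)\<^sup>2" by simp
      also have "\<dots> = (real_of_int k)\<^sup>2 - 2 * \<bar>real_of_int k\<bar> + 1" by (simp add: power2_diff)
      finally show "\<bar>real_of_int k\<bar> \<le> K" unfolding K_def by simp
    qed (simp_all add: K_def)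
    have m0: "m > 0" by (simp add: m_def)
    have "a * t\<^sup>2 \<le> (var / 2) * t\<^sup>2" by (intro mult_right_mono a) simp
    then have gm: "norm (gauss t) \<le> m" by (simp add: gauss_def m_def)
    have cm: "norm (chf t) \<le> m" using a(3)[OF t] by (simp add: m_def)
    have Bm: "1 \<le> B * m"
    proof -
      have "t\<^sup>2 \<le> pi\<^sup>2" using t by (metis abs_le_square_iff abs_of_pos pi_gt_zero)
      then have "1 \<le> exp (a * pi\<^sup>2 + - a * t\<^sup>2)" using a by simp
      then show ?thesis by (simp add: B_def m_def exp_add[symmetric])
    qed
    have gn1: "norm (gauss t ^ (n - 1)) \<le> B * m ^ n"
    proof -
      have "norm (gauss t ^ (n - 1)) \<le> m ^ (n - 1)" using gm by (simp add: norm_power power_mono)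
      also have "\<dots> \<le> m ^ (n - 1) * (B * m)" using Bm m0 by simp
      also have "\<dots> = B * m ^ n" using n by (cases n) auto
      finally show ?thesis .
    qed
    have H1: "norm H = 1" by (simp add: H_def)
    have Hexp: "H = exp (\<i> * of_real (- (of_int k * t)))" by (simp add: H_def cis_conv_exp)
    have H2: "norm (H - 1) \<le> \<bar>real_of_int k\<bar> * \<bar>t\<bar>"
      using iexp_approx1[of "- (of_int k * t)" 0] by (simp add: Hexp abs_mult)
    have H3: "norm (H - 1 + \<i> * of_real (of_int k * t)) \<le> (real_of_int k)\<^sup>2 * t\<^sup>2"
    proof -
      have "norm (H - 1 + \<i> * of_real (of_int k * t)) \<le> \<bar>- (of_int k * t)\<bar> ^ 2 / 2"
        using iexp_approx1[of "- (of_int k * t)" 1] by (simp add: Hexp numeral_2_eq_2 algebra_simps)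
      also have "\<dots> \<le> (real_of_int k)\<^sup>2 * t\<^sup>2" by (simp add: power_mult_distrib)
      finally show ?thesis .
    qed
    define x where "x = real n * t\<^sup>2"
    have x0: "x \<ge> 0" by (simp add: x_def)
    have mn: "m ^ n = exp (- a * x)" by (simp add: m_def x_def exp_of_nat_mult[symmetric] mult_ac)
    \<comment> \<open>Three errors: the second-order remainder of the n-th power, that of the phase,
      and the cross terms. In x = n t^2 their sizes are x^3 / n, x / n and x^2 / n.\<close>
    have "chf t ^ n * H - (gauss t ^ n * (1 - \<i> * of_real (of_int k * t)) + of_nat n * skew * of_real t ^ 3 * gauss t ^ (n - 1))
      = (chf t ^ n - gauss t ^ n - of_nat n * gauss t ^ (n - 1) * (chf t - gauss t)) * H
        + gauss t ^ n * (H - 1 + \<i> * of_real (of_int k * t))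
        + of_nat n * gauss t ^ (n - 1) * ((chf t - gauss t) * (H - 1) + (chf t - gauss t - skew * of_real t ^ 3))"
      by (simp add: algebra_simps)
    also have "norm \<dots> \<le> C\<^sup>2 * B\<^sup>2 * (real n)\<^sup>2 * t ^ 6 * m ^ n * K + t\<^sup>2 * m ^ n * K
        + real n * (B * m ^ n) * (2 * C * t ^ 4 * K)"
    proof (intro norm_triangle_le add_mono)
      have "norm (chf t ^ n - gauss t ^ n - of_nat n * gauss t ^ (n - 1) * (chf t - gauss t)) * 1
         \<le> norm (chf t ^ n - gauss t ^ n - of_nat n * gauss t ^ (n - 1) * (chf t - gauss t)) * (B * m)\<^sup>2"
        using Bm by (intro mult_left_mono) auto
      also have "\<dots> = (norm (chf t ^ n - gauss t ^ n - of_nat n * gauss t ^ (n - 1) * (chf t - gauss t)) * m\<^sup>2) * B\<^sup>2"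
        by (simp add: power_mult_distrib)
      also have "\<dots> \<le> ((real n)\<^sup>2 * (norm (chf t - gauss t))\<^sup>2 * m ^ n) * B\<^sup>2"
        by (intro mult_right_mono power_second_order cm gm) auto
      also have "\<dots> \<le> ((real n)\<^sup>2 * (C * \<bar>t\<bar> ^ 3)\<^sup>2 * m ^ n) * B\<^sup>2"
        using m0 by (intro mult_right_mono mult_left_mono power_mono C t) auto
      also have "\<dots> = C\<^sup>2 * B\<^sup>2 * (real n)\<^sup>2 * t ^ 6 * m ^ n"
      proof -
        have "(\<bar>t\<bar> ^ 3)\<^sup>2 = t ^ 6" by (simp add: power_even_abs flip: power_mult)
        then show ?thesis by (simp only: power_mult_distrib mult_ac)
      qed
      also have "\<dots> \<le> C\<^sup>2 * B\<^sup>2 * (real n)\<^sup>2 * t ^ 6 * m ^ n * K"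
        using mult_left_mono[OF K1(3), of "C\<^sup>2 * B\<^sup>2 * (real n)\<^sup>2 * t ^ 6 * m ^ n"] m0 by simp
      finally show "norm ((chf t ^ n - gauss t ^ n - of_nat n * gauss t ^ (n - 1) * (chf t - gauss t)) * H) \<le> C\<^sup>2 * B\<^sup>2 * (real n)\<^sup>2 * t ^ 6 * m ^ n * K"
        by (simp add: norm_mult H1)
      have "norm (gauss t ^ n * (H - 1 + \<i> * of_real (of_int k * t))) \<le> m ^ n * ((real_of_int k)\<^sup>2 * t\<^sup>2)"
        unfolding norm_mult norm_power by (intro mult_mono power_mono gm H3) (use m0 in auto)
      also have "\<dots> \<le> m ^ n * (K * t\<^sup>2)" using K1 m0 by (intro mult_left_mono mult_right_mono) auto
      finally show "norm (gauss t ^ n * (H - 1 + \<i> * of_real (of_int k * t))) \<le> t\<^sup>2 * m ^ n * K" by (simp add: mult_ac)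
      have "norm ((chf t - gauss t) * (H - 1) + (chf t - gauss t - skew * of_real t ^ 3)) \<le> (C * \<bar>t\<bar> ^ 3) * (\<bar>real_of_int k\<bar> * \<bar>t\<bar>) + C * t ^ 4"
        unfolding norm_mult[symmetric] by (intro norm_triangle_le add_mono C t) (simp add: norm_mult, intro mult_mono C t H2, use C in auto)
      also have "(C * \<bar>t\<bar> ^ 3) * (\<bar>real_of_int k\<bar> * \<bar>t\<bar>) = C * t ^ 4 * \<bar>real_of_int k\<bar>"
        by (simp add: power3_eq_cube power4_eq_xxxx)
      also have "C * t ^ 4 * \<bar>real_of_int k\<bar> + C * t ^ 4 \<le> C * t ^ 4 * K + C * t ^ 4 * K"
        using C K1 mult_left_mono[of 1 K "C * t ^ 4"] by (intro add_mono mult_left_mono) auto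
      finally have "norm ((chf t - gauss t) * (H - 1) + (chf t - gauss t - skew * of_real t ^ 3)) \<le> 2 * C * t ^ 4 * K" by (simp add: mult_ac)
      then show "norm (of_nat n * gauss t ^ (n - 1) * ((chf t - gauss t) * (H - 1) + (chf t - gauss t - skew * of_real t ^ 3))) \<le> real n * (B * m ^ n) * (2 * C * t ^ 4 * K)"
        unfolding norm_mult norm_of_nat by (intro mult_mono gn1) (use m0 B1 in auto)
    qed
    also have "\<dots> \<le> D * (K * m ^ n) * (t\<^sup>2 + real n * t ^ 4 + (real n)\<^sup>2 * t ^ 6)"
    proof -
      have nn: "0 \<le> K * m ^ n" "0 \<le> t\<^sup>2" "0 \<le> real n * t ^ 4" "0 \<le> (real n)\<^sup>2 * t ^ 6" using m0 K1 by auto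
      have d: "C\<^sup>2 * B\<^sup>2 \<le> D" "1 \<le> D" "2 * (B * C) \<le> D" using C B1 by (auto simp: D_def)
      have "C\<^sup>2 * B\<^sup>2 * (real n)\<^sup>2 * t ^ 6 * m ^ n * K = (K * m ^ n) * ((C\<^sup>2 * B\<^sup>2) * ((real n)\<^sup>2 * t ^ 6))" by (simp only: mult_ac)
      moreover have "t\<^sup>2 * m ^ n * K = (K * m ^ n) * (1 * t\<^sup>2)" by (simp only: mult_ac mult_1_left)
      moreover have "real n * (B * m ^ n) * (2 * C * t ^ 4 * K) = (K * m ^ n) * ((2 * (B * C)) * (real n * t ^ 4))" by (simp only: mult_ac)
      moreover have "(K * m ^ n) * ((C\<^sup>2 * B\<^sup>2) * ((real n)\<^sup>2 * t ^ 6)) + (K * m ^ n) * (1 * t\<^sup>2) + (K * m ^ n) * ((2 * (B * C)) * (real n * t ^ 4))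
         \<le> (K * m ^ n) * (D * ((real n)\<^sup>2 * t ^ 6)) + (K * m ^ n) * (D * t\<^sup>2) + (K * m ^ n) * (D * (real n * t ^ 4))"
        by (intro add_mono mult_left_mono mult_right_mono d nn)
      ultimately show ?thesis by (simp add: algebra_simps)
    qed
    also have "t\<^sup>2 + real n * t ^ 4 + (real n)\<^sup>2 * t ^ 6 = (x + x\<^sup>2 + x ^ 3) / real n"
    proof -
      have e: "x\<^sup>2 = (real n)\<^sup>2 * t ^ 4" "x ^ 3 = (real n) ^ 3 * t ^ 6"
        by (simp_all add: x_def power_mult_distrib flip: power_mult)
      have "x + x\<^sup>2 + x ^ 3 = real n * (t\<^sup>2 + real n * t ^ 4 + (real n)\<^sup>2 * t ^ 6)"
        unfolding e unfolding x_def by (simp add: power2_eq_square[of "real n"] power3_eq_cube[of "real n"] distrib_left mult.assoc)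
      then show ?thesis using n by simp
    qed
    also have "x + x\<^sup>2 + x ^ 3 \<le> F * exp (a / 2 * x)"
    proof -
      have p: "x ^ j \<le> fact j * h ^ j * exp (a / 2 * x)" for j
      proof -
        have "(a / 2 * x) ^ j \<le> fact j * exp (a / 2 * x)" using a x0 by (intro power_le_exp) auto
        then have "h ^ j * (a / 2 * x) ^ j \<le> h ^ j * (fact j * exp (a / 2 * x))" using h0 by (intro mult_left_mono) auto
        moreover have "h ^ j * (a / 2 * x) ^ j = x ^ j"
          using a by (simp add: power_mult_distrib[symmetric] h_def)
        ultimately show ?thesis by (simp add: mult_ac)
      qed
      show ?thesis using p[of 1] p[of 2] p[of 3] by (simp add: F_def algebra_simps fact_numeral)
    qed
    finally have "norm (chf t ^ n * H - (gauss t ^ n * (1 - \<i> * of_real (of_int k * t)) + of_nat n * skew * of_real t ^ 3 * gauss t ^ (n - 1)))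
      \<le> D * (K * m ^ n) * (F * exp (a / 2 * x) / real n)"
      using D0 K1 m0 n by (auto simp: divide_right_mono mult_left_mono)
    also have "\<dots> = (D * F) * K / real n * (m ^ n * exp (a / 2 * x))" by simp
    also have "m ^ n * exp (a / 2 * x) = exp (- (a / 2 * real n) * t\<^sup>2)"
      unfolding mn by (simp add: exp_add[symmetric] x_def algebra_simps)
    finally show ?thesis by (simp add: H_def K_def)
  qed
  show ?thesis by (rule that[of "a / 2" "D * F"]) (use a D0 F0 bound in auto)
qed

text \<open>The pointwise error integrates to 1/n times a Gaussian integral of order n^(-1/2). It
  may grow quadratically in k, which is harmless against tau^(-k) later.\<close>

theorem chf_integral_asymp:
  obtains C where "\<And>n k. n \<ge> 1 \<Longrightarrow>
    norm (integral {-pi..pi} (\<lambda>t. chf t ^ n * cis (- (of_int k * t))) - of_real (sqrt (2 * pi / (real n * var))))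
      \<le> C * (1 + (of_int k)\<^sup>2) / (real n * sqrt (real n))"
proof -
  obtain a C where a: "a > 0" "C > 0"
    "\<And>n k t. n \<ge> 1 \<Longrightarrow> \<bar>t\<bar> \<le> pi \<Longrightarrow>
      norm (chf t ^ n * cis (- (of_int k * t)) - (gauss t ^ n * (1 - \<i> * of_real (of_int k * t)) + of_nat n * skew * of_real t ^ 3 * gauss t ^ (n - 1)))
      \<le> C * (1 + (of_int k)\<^sup>2) / real n * exp (- (a * real n) * t\<^sup>2)"
    by (rule chf_power_pointwise) (rule that)
  define D where "D = C * sqrt (pi / a) + sqrt (4 * pi / var) * (2 / var)"
  have D0: "sqrt (4 * pi / var) * (2 / var) \<ge> 0" using var_pos by simp
  have "norm (integral {-pi..pi} (\<lambda>t. chf t ^ n * cis (- (of_int k * t))) - of_real (sqrt (2 * pi / (real n * var))))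
      \<le> D * (1 + (of_int k)\<^sup>2) / (real n * sqrt (real n))" if n: "n \<ge> 1" for n k
  proof -
    define K where "K = 1 + (real_of_int k)\<^sup>2"
    have K: "K \<ge> 1" by (simp add: K_def)
    define g where "g t = exp (- (real n * var / 2) * t\<^sup>2)" for t :: real
    define h where "h t = gauss t ^ n * (1 - \<i> * of_real (of_int k * t)) + of_nat n * skew * of_real t ^ 3 * gauss t ^ (n - 1)" for t
    define f where "f t = chf t ^ n * cis (- (of_int k * t))" for t
    have gn: "gauss t ^ n = of_real (g t)" for t
      by (simp add: gauss_def g_def exp_of_nat_mult[symmetric] algebra_simps flip: of_real_power)
    have contg: "continuous_on S gauss" for S unfolding gauss_def by (intro continuous_intros) auto
    have fi: "f integrable_on {-pi..pi}" unfolding f_def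
      by (intro integrable_continuous_interval continuous_intros)
    have hi: "h integrable_on {-pi..pi}" unfolding h_def
      by (intro integrable_continuous_interval continuous_intros contg)
    define o1 where "o1 t = h t - of_real (g t)" for t
    have gi: "g integrable_on {-pi..pi}" unfolding g_def
      by (intro integrable_continuous_interval continuous_intros)
    have gi': "(\<lambda>t. complex_of_real (g t)) integrable_on {-pi..pi}" unfolding g_def
      by (intro integrable_continuous_interval continuous_intros)
    have "integral {-pi..pi} h = integral {-pi..pi} (\<lambda>t. of_real (g t) + o1 t)" by (simp add: o1_def)
    also have "\<dots> = integral {-pi..pi} (\<lambda>t. of_real (g t)) + integral {-pi..pi} o1"
      unfolding o1_def by (intro Henstock_Kurzweil_Integration.integral_add gi' integrable_diff hi)
    also have "integral {-pi..pi} o1 = 0"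
    proof (rule integral_odd_eq_0)
      fix t show "o1 (- t) = - o1 t"
        unfolding o1_def h_def gn by (simp add: g_def gauss_def algebra_simps)
    qed
    finally have hint: "integral {-pi..pi} h = of_real (integral {-pi..pi} g)"
      using integral_linear[OF gi bounded_linear_of_real] by (simp add: o_def)
    have gt: "\<bar>integral {-pi..pi} g - sqrt (2 * pi / (real n * var))\<bar> \<le> sqrt (4 * pi / var) * (2 / var) / (real n * sqrt (real n))"
    proof -
      have b: "real n * var / 2 > 0" using n var_pos by simp
      have e1: "pi / (real n * var / 2) = 2 * pi / (real n * var)" by simp
      have e2: "sqrt (2 * pi / (real n * var / 2)) / (real n * var / 2) = sqrt (4 * pi / var) * (2 / var) / (real n * sqrt (real n))"
        using n by (simp add: real_sqrt_divide real_sqrt_mult field_simps)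
      show ?thesis using gaussian_truncated(2,3)[OF b] unfolding g_def e1 e2 by linarith
    qed
    have "norm (integral {-pi..pi} f - integral {-pi..pi} h) = norm (integral {-pi..pi} (\<lambda>t. f t - h t))"
      by (subst Henstock_Kurzweil_Integration.integral_diff[OF fi hi]) simp
    also have "\<dots> \<le> integral {-pi..pi} (\<lambda>t. C * K / real n * exp (- (a * real n) * t\<^sup>2))"
    proof (rule integral_norm_bound_integral)
      show "(\<lambda>t. f t - h t) integrable_on {-pi..pi}" by (intro integrable_diff fi hi)
      show "(\<lambda>t. C * K / real n * exp (- (a * real n) * t\<^sup>2)) integrable_on {-pi..pi}"
        by (intro integrable_continuous_interval continuous_intros)
      fix t :: real assume "t \<in> {-pi..pi}"
      then show "norm (f t - h t) \<le> C * K / real n * exp (- (a * real n) * t\<^sup>2)"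
        using a(3)[OF n, of t k] unfolding f_def h_def K_def by (simp add: abs_le_iff)
    qed
    also have "\<dots> = C * K / real n * integral {-pi..pi} (\<lambda>t. exp (- (a * real n) * t\<^sup>2))"
      by (rule Henstock_Kurzweil_Integration.integral_mult_right)
    also have "\<dots> \<le> C * K / real n * sqrt (pi / (a * real n))"
      using a n K by (intro mult_left_mono gaussian_truncated(2)) auto
    also have "\<dots> = (C * sqrt (pi / a)) * K / (real n * sqrt (real n))"
      by (simp add: real_sqrt_divide real_sqrt_mult mult_ac)
    finally have fh: "norm (integral {-pi..pi} f - integral {-pi..pi} h) \<le> (C * sqrt (pi / a)) * K / (real n * sqrt (real n))" .
    have "norm (integral {-pi..pi} f - of_real (sqrt (2 * pi / (real n * var)))) \<le> norm (integral {-pi..pi} f - integral {-pi..pi} h) + norm (integral {-pi..pi} h - of_real (sqrt (2 * pi / (real n * var))))"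
      unfolding dist_norm[symmetric] by (rule dist_triangle)
    also have "norm (integral {-pi..pi} h - of_real (sqrt (2 * pi / (real n * var)))) = \<bar>integral {-pi..pi} g - sqrt (2 * pi / (real n * var))\<bar>"
      unfolding hint of_real_diff[symmetric] norm_of_real ..
    also have "\<dots> \<le> sqrt (4 * pi / var) * (2 / var) * K / (real n * sqrt (real n))"
    proof -
      have "sqrt (4 * pi / var) * (2 / var) * 1 / (real n * sqrt (real n)) \<le> sqrt (4 * pi / var) * (2 / var) * K / (real n * sqrt (real n))"
        by (intro divide_right_mono mult_left_mono K D0) auto
      then show ?thesis using gt by simp
    qed
    finally show ?thesis using fh unfolding f_def D_def K_def by (simp add: add_divide_distrib distrib_right)
  qed
  then show ?thesis by (rule that)
qed

text \<open>The Fourier coefficients of the n-th power of the characteristic function satisfy the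
  recursion of the n-step transition weights.\<close>

theorem local_limit:
  fixes v :: "nat \<Rightarrow> int \<Rightarrow> real"
  assumes v0: "\<And>k. v 0 k = (if k = 0 then 1 else 0)"
    and vS: "\<And>n k. v (Suc n) k = (\<Sum>i\<in>J. w i * v n (k - i))"
  obtains C where "\<And>n k. n \<ge> 1 \<Longrightarrow>
    \<bar>v n k - 1 / sqrt (2 * pi * var * real n)\<bar> \<le> C * (1 + (of_int k)\<^sup>2) / (real n * sqrt (real n))"
proof -
  have v_int: "integral {-pi..pi} (\<lambda>t. chf t ^ n * cis (- (of_int k * t))) = of_real (2 * pi * v n k)" for n k
  proof (induction n arbitrary: k)
    case 0
    show ?case
    proof (cases "k = 0")
      case False
      define z where "z = - \<i> * of_int k"
      have z: "z \<noteq> 0" using False by (simp add: z_def)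
      have "((\<lambda>t. cis (- (of_int k * t))) has_integral (cis (- (of_int k * pi)) / z - cis (- (of_int k * (- pi))) / z)) {-pi..pi}"
      proof (rule fundamental_theorem_of_calculus)
        fix t :: real
        have "((\<lambda>t. exp (z * of_real t) / z) has_vector_derivative (exp (z * of_real t) * z / z)) (at t within {-pi..pi})"
          by (intro derivative_eq_intros has_vector_derivative_real_field | simp)+
        moreover have "exp (z * of_real t) = cis (- (of_int k * t))" for t by (simp add: cis_conv_exp z_def mult_ac)
        ultimately show "((\<lambda>t. cis (- (of_int k * t)) / z) has_vector_derivative cis (- (of_int k * t))) (at t within {-pi..pi})"
          using z by simp
      qed simp
      moreover have "cis (- (of_int k * pi)) = cis (of_int k * pi)"
        by (simp add: complex_eq_iff sin_times_pi_eq_0)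
      ultimately have "((\<lambda>t. cis (- (of_int k * t))) has_integral 0) {-pi..pi}" by simp
      then show ?thesis using False by (simp add: v0 integral_unique)
    qed (simp add: v0 scaleR_conv_of_real)
  next
    case (Suc n)
    have int: "(\<lambda>t. chf t ^ n * cis (- (of_int j * t))) integrable_on {-pi..pi}" for j :: int
      by (intro integrable_continuous_interval continuous_intros)
    have "(\<lambda>t. chf t ^ Suc n * cis (- (of_int k * t))) = (\<lambda>t. \<Sum>i\<in>J. of_real (w i) * (chf t ^ n * cis (- (of_int (k - i) * t))))"
    proof
      fix t
      have "chf t ^ Suc n * cis (- (of_int k * t)) = (\<Sum>i\<in>J. of_real (w i) * (chf t ^ n * (cis (t * of_int i) * cis (- (of_int k * t)))))"
        by (simp add: chf_def[of t] sum_distrib_left sum_distrib_right mult_ac)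
      also have "\<dots> = (\<Sum>i\<in>J. of_real (w i) * (chf t ^ n * cis (- (of_int (k - i) * t))))"
        by (simp add: cis_mult algebra_simps)
      finally show "chf t ^ Suc n * cis (- (of_int k * t)) = (\<Sum>i\<in>J. of_real (w i) * (chf t ^ n * cis (- (of_int (k - i) * t))))" .
    qed
    then have "integral {-pi..pi} (\<lambda>t. chf t ^ Suc n * cis (- (of_int k * t))) = (\<Sum>i\<in>J. integral {-pi..pi} (\<lambda>t. of_real (w i) * (chf t ^ n * cis (- (of_int (k - i) * t)))))"
      by (simp only:) (intro integral_sum finite_J integrable_on_mult_right int)
    also have "\<dots> = (\<Sum>i\<in>J. of_real (w i) * of_real (2 * pi * v n (k - i)))"
      by (simp only: Henstock_Kurzweil_Integration.integral_mult_right Suc)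
    also have "\<dots> = of_real (2 * pi * v (Suc n) k)"
      by (simp add: vS sum_distrib_left mult_ac)
    finally show ?case .
  qed
  obtain C where C: "\<And>n k. n \<ge> 1 \<Longrightarrow>
    norm (integral {-pi..pi} (\<lambda>t. chf t ^ n * cis (- (of_int k * t))) - of_real (sqrt (2 * pi / (real n * var))))
      \<le> C * (1 + (of_int k)\<^sup>2) / (real n * sqrt (real n))"
    by (rule chf_integral_asymp) (rule that)
  show ?thesis
  proof (rule that)
    fix n :: nat and k :: int assume n: "n \<ge> 1"
    have "\<bar>2 * pi * v n k - sqrt (2 * pi / (real n * var))\<bar> \<le> C * (1 + (of_int k)\<^sup>2) / (real n * sqrt (real n))"
      using C[OF n, of k] unfolding v_int of_real_diff[symmetric] norm_of_real .
    then have "\<bar>2 * pi * v n k - sqrt (2 * pi / (real n * var))\<bar> / (2 * pi) \<le> C * (1 + (of_int k)\<^sup>2) / (real n * sqrt (real n)) / (2 * pi)"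
      by (intro divide_right_mono) auto
    moreover have "\<bar>2 * pi * v n k - sqrt (2 * pi / (real n * var))\<bar> / (2 * pi) = \<bar>v n k - 1 / sqrt (2 * pi * var * real n)\<bar>"
    proof -
      have "sqrt (2 * pi / (real n * var)) / (2 * pi) = 1 / sqrt (2 * pi * var * real n)"
      proof -
        have "sqrt (2 * pi / (real n * var)) * sqrt (2 * pi * var * real n) = 2 * pi"
          unfolding real_sqrt_mult[symmetric] using n var_pos by (simp add: power2_eq_square[symmetric] real_sqrt_mult)
        then show ?thesis using n var_pos by (simp add: field_simps)
      qed
      then have "(2 * pi * v n k - sqrt (2 * pi / (real n * var))) / (2 * pi) = v n k - 1 / sqrt (2 * pi * var * real n)"
        by (simp add: diff_divide_distrib)
      then show ?thesis by (metis abs_divide abs_of_pos pi_gt_zero mult_pos_pos zero_less_numeral)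
    qed
    ultimately show "\<bar>v n k - 1 / sqrt (2 * pi * var * real n)\<bar> \<le> (C / (2 * pi)) * (1 + (of_int k)\<^sup>2) / (real n * sqrt (real n))"
      by (simp add: mult_ac)
  qed
qed

end

subsection \<open>The saddle point\<close>

text \<open>Convexity of u^i on the positive axis, strict for i < 0. As -c is a jump, it makes P'
  strictly increasing and the saddle point unique.\<close>

lemma jump_term_mono:
  assumes "0 < u" "u < v"
  shows "of_int i * u powi (i - 1) \<le> of_int i * (v::real) powi (i - 1)"
    "i < 0 \<Longrightarrow> of_int i * u powi (i - 1) < of_int i * (v::real) powi (i - 1)"
proof -
  show strict: "of_int i * u powi (i - 1) < of_int i * v powi (i - 1)" if "i < 0"
  proof -
    have "u ^ nat (1 - i) < v ^ nat (1 - i)" using assms that by (intro power_strict_mono) auto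
    then have "inverse (v ^ nat (1 - i)) < inverse (u ^ nat (1 - i))" using assms by simp
    then have "v powi (i - 1) < u powi (i - 1)" using that by (simp add: power_int_def power_inverse)
    then show ?thesis using that by (simp add: mult_less_cancel_left)
  qed
  show "of_int i * u powi (i - 1) \<le> of_int i * v powi (i - 1)"
  proof (cases "i \<ge> 1")
    case True
    then have "u powi (i - 1) \<le> v powi (i - 1)" using assms by (simp add: power_int_def power_mono)
    then show ?thesis using True by (simp add: mult_left_mono)
  next
    case False
    then show ?thesis using strict by (cases "i = 0") auto
  qed
qed

context jump_weights
begin

lemma jumpP'_strict_mono:
  assumes "0 < u" "u < v"
  shows "jumpP' p u < jumpP' p v"
  unfolding jumpP'_def
proof (rule sum_strict_mono_ex1[OF finite_jumps])
  show "\<forall>i\<in>jumps p. p i * of_int i * u powi (i - 1) \<le> p i * of_int i * v powi (i - 1)"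
    unfolding mult.assoc by (auto intro!: mult_left_mono jump_term_mono assms p_nonneg)
  show "\<exists>i\<in>jumps p. p i * of_int i * u powi (i - 1) < p i * of_int i * v powi (i - 1)"
    unfolding mult.assoc
    by (intro bexI[OF _ minus_c_jump] mult_strict_left_mono jump_term_mono(2) assms p_c_pos) (use c_pos in auto)
qed

text \<open>As u tends to 0 the jump -c drives P' to minus infinity, and for large u the jump d
  keeps it positive; the constant K absorbs all other jumps. \<open>u0\<close> and \<open>u1\<close>
  are points where these bounds fix the two signs.\<close>

lemma jumpP'_zero_exists: "\<exists>t>0. jumpP' p t = 0"
proof -
  define K where "K = (\<Sum>i\<in>jumps p. p i * \<bar>of_int i\<bar>)"
  have K0: "K \<ge> 0" unfolding K_def by (intro sum_nonneg mult_nonneg_nonneg p_nonneg) auto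
  have powi_ge: "1 / u \<le> u powi (i - 1)" if "0 < u" "u \<le> 1" "i < 0" for u :: real and i
  proof -
    have "u ^ nat (1 - i) \<le> u ^ 1" using that by (intro power_decreasing) auto
    then have "inverse u \<le> inverse (u ^ nat (1 - i))" using that by (intro le_imp_inverse_le) auto
    then show ?thesis using that by (simp add: power_int_def power_inverse inverse_eq_divide power_one_over)
  qed
  have powi_le: "u powi (i - 1) \<le> 1 / u" if "u \<ge> 1" "i < 0" for u :: real and i
  proof -
    have "u ^ 1 \<le> u ^ nat (1 - i)" using that by (intro power_increasing) auto
    then have "inverse (u ^ nat (1 - i)) \<le> inverse u" using that by (intro le_imp_inverse_le) auto
    then show ?thesis using that by (simp add: power_int_def power_inverse inverse_eq_divide power_one_over)
  qed
  have up: "jumpP' p u \<le> K - real c * p (- int c) / u" if u: "0 < u" "u \<le> 1" for u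
  proof -
    have "jumpP' p u \<le> (\<Sum>i\<in>jumps p. p i * \<bar>of_int i\<bar> + (if i = - int c then - (real c * p (- int c) / u) else 0))"
      unfolding jumpP'_def
    proof (rule sum_mono)
      fix i assume "i \<in> jumps p"
      show "p i * of_int i * u powi (i - 1) \<le> p i * \<bar>of_int i\<bar> + (if i = - int c then - (real c * p (- int c) / u) else 0)"
      proof (cases "i \<ge> 1")
        case True
        have "u powi (i - 1) \<le> 1" using True u by (simp add: power_int_def power_le_one)
        then have "p i * of_int i * u powi (i - 1) \<le> p i * of_int i * 1"
          using True p_nonneg by (intro mult_left_mono) auto
        then show ?thesis using True c_pos by simp
      next
        case False
        then have i: "i \<le> 0" by simp
        have le0: "p i * of_int i * u powi (i - 1) \<le> 0"
          using i u p_nonneg by (intro mult_nonpos_nonneg mult_nonneg_nonpos) auto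
        have ge0: "0 \<le> p i * \<bar>of_int i\<bar>" using p_nonneg by simp
        show ?thesis
        proof (cases "i = - int c")
          case True
          have "p i * of_int i * u powi (i - 1) \<le> p i * of_int i * (1 / u)"
            using True c_pos p_nonneg[of i] by (intro mult_left_mono_neg powi_ge u) (auto simp: mult_nonneg_nonpos)
          then show ?thesis using True ge0 by (simp add: mult.commute[of "p (- int c)"])
        next
          case False
          then show ?thesis using le0 ge0 by simp
        qed
      qed
    qed
    also have "\<dots> = K - real c * p (- int c) / u"
      using finite_jumps minus_c_jump by (simp add: sum.distrib K_def sum.delta)
    finally show ?thesis .
  qed
  have lo: "p (int d) * real d - K / u \<le> jumpP' p u" if u: "u \<ge> 1" for u
  proof -
    have "(\<Sum>i\<in>jumps p. - (p i * \<bar>of_int i\<bar> / u) + (if i = int d then p (int d) * real d else 0)) \<le> jumpP' p u"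
      unfolding jumpP'_def
    proof (rule sum_mono)
      fix i assume "i \<in> jumps p"
      show "- (p i * \<bar>of_int i\<bar> / u) + (if i = int d then p (int d) * real d else 0) \<le> p i * of_int i * u powi (i - 1)"
      proof (cases "i \<ge> 1")
        case True
        have "1 \<le> u powi (i - 1)" using True u by (simp add: power_int_def)
        then have "p i * of_int i * 1 \<le> p i * of_int i * u powi (i - 1)"
          using True p_nonneg by (intro mult_left_mono) auto
        moreover have "0 \<le> p i * \<bar>of_int i\<bar> / u" "0 \<le> p i * of_int i" using p_nonneg u True by auto
        ultimately show ?thesis by auto
      next
        case False
        show ?thesis
        proof (cases "i = 0")
          case True
          then show ?thesis using d_pos by simp
        next
          case i: False
          have "p i * of_int i * (1 / u) \<le> p i * of_int i * u powi (i - 1)"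
            using False i p_nonneg[of i] by (intro mult_left_mono_neg powi_le u) (auto simp: mult_nonneg_nonpos)
          then show ?thesis using False i d_pos by simp
        qed
      qed
    qed
    also have "(\<Sum>i\<in>jumps p. - (p i * \<bar>of_int i\<bar> / u) + (if i = int d then p (int d) * real d else 0)) = p (int d) * real d - K / u"
      using finite_jumps d_jump by (simp add: sum.distrib sum_subtractf K_def sum.delta sum_negf sum_divide_distrib)
    finally show ?thesis .
  qed
  define u0 where "u0 = min 1 (real c * p (- int c) / (K + 1))"
  define u1 where "u1 = max 1 (K / (p (int d) * real d))"
  have cp: "real c * p (- int c) > 0" and dp: "p (int d) * real d > 0" using c_pos d_pos p_c_pos p_d_pos by auto
  have u0: "0 < u0" "u0 \<le> 1" using cp K0 by (auto simp: u0_def)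
  have u1: "u1 \<ge> 1" by (simp add: u1_def)
  have "K + 1 \<le> real c * p (- int c) / u0"
  proof -
    have "u0 \<le> real c * p (- int c) / (K + 1)" by (simp add: u0_def)
    then show ?thesis using u0 K0 by (simp add: field_simps)
  qed
  then have n0: "jumpP' p u0 \<le> 0" using up[OF u0] by simp
  have "K / u1 \<le> p (int d) * real d"
  proof -
    have "K / (p (int d) * real d) \<le> u1" by (simp add: u1_def)
    then show ?thesis using u1 dp by (simp add: field_simps)
  qed
  then have n1: "0 \<le> jumpP' p u1" using lo[OF u1] by simp
  have "continuous_on {u0..u1} (jumpP' p)" unfolding jumpP'_def
    using u0 by (intro continuous_intros) auto
  then obtain t where "u0 \<le> t" "jumpP' p t = 0"
    using IVT'[of "jumpP' p" u0 0 u1] n0 n1 u0 u1 by auto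
  then show ?thesis using u0 by (intro exI[of _ t]) auto
qed

lemma jumpP'_zero_unique: "0 < t \<Longrightarrow> jumpP' p t = 0 \<Longrightarrow> 0 < u \<Longrightarrow> jumpP' p u = 0 \<Longrightarrow> t = u"
  using jumpP'_strict_mono[of t u] jumpP'_strict_mono[of u t] by (cases t u rule: linorder_cases) auto

lemma tau: "tau p > 0" "jumpP' p (tau p) = 0"
proof -
  obtain t where t: "t > 0" "jumpP' p t = 0" using jumpP'_zero_exists by blast
  have "tau p = t" unfolding tau_def
    using t jumpP'_zero_unique by (intro the_equality) force+
  then show "tau p > 0" "jumpP' p (tau p) = 0" using t by auto
qed

lemma jumpP_pos: "u > 0 \<Longrightarrow> jumpP p u > 0"
proof -
  assume u: "u > 0"
  have "0 < p (int d) * u powi (int d)" using p_d_pos u by simp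
  also have "\<dots> \<le> jumpP p u" unfolding jumpP_def
    by (rule member_le_sum[OF d_jump]) (use u finite_jumps p_nonneg in auto)
  finally show ?thesis .
qed

text \<open>In the coordinate y = ln (u / tau) the inequality exp x >= 1 + x bounds P from below by
  its tangent at tau, whose slope is a multiple of P'(tau) = 0.\<close>

lemma jumpP_tau_le:
  assumes u: "u > 0"
  shows "jumpP p (tau p) \<le> jumpP p u"
proof -
  define y where "y = ln (u / tau p)"
  have "jumpP p u = (\<Sum>i\<in>jumps p. p i * tau p powi i * exp (of_int i * y))"
    unfolding jumpP_def
  proof (rule sum.cong[OF refl])
    fix i
    have "exp (of_int i * y) = exp y powi i"
      by (simp add: exp_power_int mult.commute)
    also have "exp y = u / tau p" using u tau by (simp add: y_def)
    finally show "p i * u powi i = p i * tau p powi i * exp (of_int i * y)"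
      using tau by (simp add: power_int_divide_distrib)
  qed
  also have "\<dots> \<ge> (\<Sum>i\<in>jumps p. p i * tau p powi i * (1 + of_int i * y))"
    by (intro sum_mono mult_left_mono exp_ge_add_one_self) (use tau p_nonneg in auto)
  also have "(\<Sum>i\<in>jumps p. p i * tau p powi i * (1 + of_int i * y)) = jumpP p (tau p) + y * tau p * jumpP' p (tau p)"
    unfolding jumpP_def jumpP'_def sum_distrib_left sum.distrib[symmetric]
    by (rule sum.cong[OF refl]) (use tau in \<open>simp add: algebra_simps power_int_diff\<close>)
  finally show ?thesis using tau by simp
qed

lemma rho_pos: "rho p > 0"
  unfolding rho_def using jumpP_pos tau by simp

lemma tau_gt_1: "drift p < 0 \<Longrightarrow> tau p > 1"
  using jumpP'_strict_mono[of "tau p" 1] tau unfolding drift_def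
  by (cases "tau p" "1::real" rule: linorder_cases) auto

lemma rho_ge: "1 / jumpP p 1 \<le> rho p"
  unfolding rho_def using jumpP_tau_le[of 1] jumpP_pos tau by (intro divide_left_mono mult_pos_pos) auto

text \<open>The Esscher transform of the jump weights at the saddle point: rho normalises the total
  mass to 1, and P'(tau) = 0 makes the mean 0.\<close>

definition tilted :: "int \<Rightarrow> real" where "tilted i = rho p * p i * tau p powi i"

end

locale aperiodic_weights = jump_weights +
  assumes aper: "aperiodic p"
begin

text \<open>The integers s with cis (t s) = 1 form a subgroup that contains all differences of
  jumps. Its least positive element m divides all of them, and m >= 2 would be a period of
  P.\<close>

lemma span_jumps:
  assumes J: "\<And>i j. i \<in> jumps p \<Longrightarrow> j \<in> jumps p \<Longrightarrow> cis (t * of_int (i - j)) = 1"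
  shows "cis t = 1"
proof -
  define G where "G = {s::int. cis (t * of_int s) = 1}"
  have G_diff: "a - b * k \<in> G" if "a \<in> G" "b \<in> G" for a b k
  proof -
    have "cis (t * of_int (a - b * k)) = cis (t * of_int a) / (cis (t * of_int b)) powi k"
      by (simp add: cis_power_int cis_divide algebra_simps)
    then show ?thesis using that by (simp add: G_def)
  qed
  define M where "M = {m::nat. m > 0 \<and> int m \<in> G}"
  have "int (c + d) \<in> G" using J[OF d_jump minus_c_jump] by (simp add: G_def add.commute)
  then have M: "c + d \<in> M" using c_pos by (simp add: M_def)
  define m where "m = (LEAST m. m \<in> M)"
  have m: "m \<in> M" unfolding m_def using M by (rule LeastI)
  have mult: "int m dvd s" if "s \<in> G" for s
  proof -
    have "s mod int m \<in> G"
      using G_diff[OF that, of "int m" "s div int m"] m by (simp add: M_def minus_mult_div_eq_mod)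
    moreover have r: "0 \<le> s mod int m" "s mod int m < int m" using m by (auto simp: M_def)
    ultimately have "nat (s mod int m) = 0"
      using not_less_Least[of "nat (s mod int m)" "\<lambda>m. m \<in> M"] unfolding m_def[symmetric] by (auto simp: M_def)
    then show ?thesis using r by (simp add: dvd_eq_mod_eq_0)
  qed
  have "m = 1"
  proof (rule ccontr)
    assume "m \<noteq> 1"
    then have m2: "m \<ge> 2" using m by (auto simp: M_def)
    \<comment> \<open>All jumps lie in -c + m Z, so P(u) = u^(-c) H(u^m) with these coefficients of
      H.\<close>
    define h where "h j = p (int m * j - int c)" for j :: int
    have inj: "inj (\<lambda>j. int m * j - int c)" using m2 by (auto intro!: injI)
    have img: "(\<lambda>j. int m * j - int c) ` {j. h j \<noteq> 0} = jumps p"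
    proof (intro equalityI subsetI)
      fix i assume i: "i \<in> jumps p"
      then have "i + int c \<in> G" using J[OF i minus_c_jump] by (simp add: G_def)
      then obtain j where "i + int c = int m * j" using mult by blast
      then have "i = int m * j - int c" by simp
      then show "i \<in> (\<lambda>j. int m * j - int c) ` {j. h j \<noteq> 0}" using i by (auto simp: h_def jumps_def)
    qed (auto simp: h_def jumps_def)
    have fin: "finite {j. h j \<noteq> 0}"
      by (rule finite_imageD[of "\<lambda>j. int m * j - int c"]) (use img finite_jumps inj in \<open>auto intro: inj_on_subset\<close>)
    have "jumpP p u = u powi (- int c) * (\<Sum>j\<in>{j. h j \<noteq> 0}. h j * (u ^ m) powi j)" if "u \<noteq> 0" for u
    proof -
      have "jumpP p u = (\<Sum>j\<in>{j. h j \<noteq> 0}. p (int m * j - int c) * u powi (int m * j - int c))"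
        unfolding jumpP_def img[symmetric] by (subst sum.reindex) (auto intro: inj_on_subset[OF inj])
      also have "\<dots> = u powi (- int c) * (\<Sum>j\<in>{j. h j \<noteq> 0}. h j * (u ^ m) powi j)"
        unfolding sum_distrib_left
      proof (rule sum.cong[OF refl])
        fix j
        have "u powi (int m * j - int c) = u powi (int m * j) * u powi (- int c)"
          using that by (simp add: power_int_diff power_int_minus divide_inverse)
        also have "u powi (int m * j) = (u ^ m) powi j" by (simp add: power_int_mult)
        finally show "p (int m * j - int c) * u powi (int m * j - int c) = u powi (- int c) * (h j * (u ^ m) powi j)"
          by (simp add: h_def)
      qed
      finally show ?thesis .
    qed
    then have "\<exists>(b::int) (per::nat) (h::int \<Rightarrow> real). per \<ge> 2 \<and> finite {j. h j \<noteq> 0} \<and>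
      (\<forall>u::real. u \<noteq> 0 \<longrightarrow> jumpP p u = u powi b * (\<Sum>j\<in>{j. h j \<noteq> 0}. h j * (u ^ per) powi j))"
      using m2 fin by blast
    then show False using aper unfolding aperiodic_def by blast
  qed
  then show ?thesis using m by (simp add: M_def G_def)
qed

sublocale law: centered_law "jumps p" tilted
proof
  show "finite (jumps p)" by (rule finite_jumps)
  show "tilted i > 0" if "i \<in> jumps p" for i
    using that p_nonneg[of i] rho_pos tau by (auto simp: tilted_def jumps_def)
  have "(\<Sum>i\<in>jumps p. tilted i) = rho p * jumpP p (tau p)"
    by (simp add: tilted_def jumpP_def sum_distrib_left mult.assoc)
  then show "(\<Sum>i\<in>jumps p. tilted i) = 1"
    using jumpP_pos[of "tau p"] tau by (simp add: rho_def)
  have "(\<Sum>i\<in>jumps p. tilted i * of_int i) = rho p * tau p * jumpP' p (tau p)"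
    unfolding jumpP'_def sum_distrib_left tilted_def
    by (rule sum.cong[OF refl]) (use tau in \<open>simp add: power_int_diff\<close>)
  then show "(\<Sum>i\<in>jumps p. tilted i * of_int i) = 0" using tau by simp
  show "\<exists>i\<in>jumps p. i \<noteq> 0" using d_jump d_pos by (intro bexI[of _ "int d"]) auto
qed (rule span_jumps)

text \<open>Multiplication by rho^n tau^k turns \<open>walk_count\<close> into the n-step
  probabilities of the tilted law, which satisfy the recursion required by
  \<open>local_limit\<close>.\<close>

lemma walk_count_asymp:
  obtains C where "\<And>n k. n \<ge> 1 \<Longrightarrow>
    \<bar>walk_count n k * rho p ^ n * tau p powi k - 1 / sqrt (2 * pi * law.var * real n)\<bar> \<le> C * (1 + (of_int k)\<^sup>2) / (real n * sqrt (real n))"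
proof (rule law.local_limit[where v = "\<lambda>n k. walk_count n k * rho p ^ n * tau p powi k"])
  show "walk_count 0 k * rho p ^ 0 * tau p powi k = (if k = 0 then 1 else 0)" for k by simp
  show "walk_count (Suc n) k * rho p ^ Suc n * tau p powi k = (\<Sum>i\<in>jumps p. tilted i * (walk_count n (k - i) * rho p ^ n * tau p powi (k - i)))" for n k
    unfolding walk_count.simps sum_distrib_right
    by (rule sum.cong[OF refl]) (use tau in \<open>simp add: tilted_def power_int_diff\<close>)
qed (rule that)

end

subsection \<open>Generating functions at the dominant singularity\<close>

definition rescale :: "real \<Rightarrow> real fps \<Rightarrow> real fps" where
  "rescale r f = Abs_fps (\<lambda>n. fps_nth f n * r ^ n)"

lemma rescale_nth [simp]: "fps_nth (rescale r f) n = fps_nth f n * r ^ n"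
  by (simp add: rescale_def)

lemma rescale_mult: "rescale r (f * g) = rescale r f * rescale r g"
proof (rule fps_ext)
  fix n
  have "fps_nth f i * fps_nth g (n - i) * r ^ n = (fps_nth f i * r ^ i) * (fps_nth g (n - i) * r ^ (n - i))" if "i \<le> n" for i
    using power_add[of r i "n - i"] that by simp
  then show "fps_nth (rescale r (f * g)) n = fps_nth (rescale r f * rescale r g) n"
    unfolding rescale_nth fps_mult_nth sum_distrib_right by (intro sum.cong refl) auto
qed

lemma rescale_diff: "rescale r (f - g) = rescale r f - rescale r g"
  by (rule fps_ext) (simp add: left_diff_distrib)

lemma rescale_sum: "rescale r (\<Sum>i\<in>I. f i) = (\<Sum>i\<in>I. rescale r (f i))"
  by (rule fps_ext) (simp add: fps_sum_nth sum_distrib_right)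

lemma rescale_1 [simp]: "rescale r 1 = 1"
  by (rule fps_ext) simp

lemma rescale_inverse:
  assumes "fps_nth f 0 \<noteq> 0"
  shows "rescale r (inverse f) = inverse (rescale r f)"
proof -
  have "rescale r f * rescale r (inverse f) = 1"
    using assms by (simp add: rescale_mult[symmetric] inverse_mult_eq_1')
  then show ?thesis by (rule fps_inverse_unique[symmetric])
qed

lemma powr_minus_three_halves: "n \<ge> 1 \<Longrightarrow> real n powr - (3/2) = 1 / (real n * sqrt (real n))"
proof -
  assume n: "n \<ge> 1"
  have "real n powr - (3/2) = inverse (real n powr (1 + 1/2))" by (simp add: powr_minus)
  also have "real n powr (1 + 1/2) = real n * sqrt (real n)"
    using n by (subst powr_add) (simp add: powr_half_sqrt)
  finally show ?thesis by (simp add: inverse_eq_divide)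
qed

lemma decay_three_halvesI:
  fixes f :: "real fps"
  assumes "\<And>n. n \<ge> 1 \<Longrightarrow> \<bar>fps_nth f n\<bar> \<le> C / (real n * sqrt (real n))"
  shows "decay (3/2) f"
proof (rule decayI)
  fix n
  have C0: "C \<ge> 0" using order.trans[OF abs_ge_zero assms[of 1]] by simp
  show "norm (fps_nth f n) \<le> (C * 2 powr (3/2) + \<bar>fps_nth f 0\<bar>) * (real n + 1) powr - (3/2)"
  proof (cases "n = 0")
    case False
    then have n: "n \<ge> 1" by simp
    have "\<bar>fps_nth f n\<bar> \<le> C * real n powr - (3/2)"
      using assms[OF n] by (simp add: powr_minus_three_halves[OF n])
    also have "\<dots> \<le> C * ((real n + 1) / 2) powr - (3/2)"
      using n C0 by (intro mult_left_mono powr_mono2') auto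
    also have "\<dots> = C * 2 powr (3/2) * (real n + 1) powr - (3/2)" by (subst half_powr_minus) simp_all
    also have "\<dots> \<le> (C * 2 powr (3/2) + \<bar>fps_nth f 0\<bar>) * (real n + 1) powr - (3/2)"
      by (intro mult_right_mono) auto
    finally show ?thesis by simp
  qed (use C0 in simp)
qed

text \<open>With s for \<open>sqrt_fps\<close> and r for \<open>inv_sqrt_fps\<close>: X s' = - X r /
  2, and X r differs from r only by s, which has order 3/2. Hence a singular part e r integrates to
  - 2 e s.\<close>

lemma sqrt_class_primitive:
  assumes "decay (3/2) (A - fps_const e * inv_sqrt_fps)" "fps_nth A 0 = 0"
  obtains L where "fps_X * fps_deriv L = A" "sqrt_class (- 2 * e) L"
proof -
  define L where "L = Abs_fps (\<lambda>n. fps_nth A n / real n)"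
  have L: "fps_X * fps_deriv L = A"
  proof (rule fps_ext)
    fix n show "fps_nth (fps_X * fps_deriv L) n = fps_nth A n"
      unfolding fps_X_deriv_nth by (cases n) (simp_all add: L_def assms(2))
  qed
  have "fps_const (- 2 * e) * (fps_X * fps_deriv sqrt_fps) = fps_const e * (fps_X * inv_sqrt_fps)"
    unfolding X_deriv_sqrt_fps' mult.assoc[symmetric] by (simp add: mult.assoc)
  then have "fps_X * fps_deriv L - fps_const (- 2 * e) * (fps_X * fps_deriv sqrt_fps)
     = (A - fps_const e * inv_sqrt_fps) + fps_const e * ((1 - fps_X) * inv_sqrt_fps)"
    unfolding L by (simp add: algebra_simps)
  also have "decay (3/2) \<dots>" unfolding inv_sqrt_fps_mult
    by (intro decay_add assms(1) decay_cmult decay_sqrt_fps)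
  finally have "sqrt_class (- 2 * e) L" by (rule sqrt_class_of_X_deriv)
  then show ?thesis using L that by blast
qed

lemma sqrt_class_X_mult:
  assumes "sqrt_class b f"
  shows "sqrt_class b (fps_X * f)"
proof -
  have "fps_X * f - fps_const b * sqrt_fps = fps_X * (f - fps_const b * sqrt_fps) - fps_const b * ((1 - fps_X) * sqrt_fps)"
    by (simp add: algebra_simps)
  also have "decay (5/2) \<dots>"
    by (rule decay_diff[OF decay_X_mult decay_cmult[OF decay_one_minus_X_sqrt_fps]])
      (use assms in \<open>simp_all add: sqrt_class_def\<close>)
  finally show ?thesis by (simp add: sqrt_class_def)
qed

lemma summable_geometric_square:
  fixes y :: real assumes "0 < y" "y < 1"
  shows "summable (\<lambda>j. y ^ j * (1 + (real j)\<^sup>2))"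
proof -
  define z where "z = sqrt y"
  have z: "0 < z" "z < 1" "y = z * z" using assms by (auto simp: z_def)
  have "(\<lambda>j. z ^ j * (1 + (real j)\<^sup>2)) \<longlonglongrightarrow> 0" using z(1,2) by real_asymp
  then have "(\<lambda>j. z ^ j * (1 + (real j)\<^sup>2)) \<in> O(\<lambda>_. 1)"
    by (intro bigoI_tendsto[where c = 0]) auto
  then have "(\<lambda>j. z ^ j * (z ^ j * (1 + (real j)\<^sup>2))) \<in> O(\<lambda>j. z ^ j * 1)"
    by (rule landau_o.big.mult_left)
  moreover have "summable (\<lambda>j. norm (z ^ j * 1))" using z by (simp add: power_abs summable_geometric)
  ultimately have "summable (\<lambda>j. z ^ j * (z ^ j * (1 + (real j)\<^sup>2)))" by (rule summable_comparison_test_bigo[rotated])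
  then show ?thesis by (simp add: z(3) power_mult_distrib mult.assoc)
qed

lemma sum_convolution:
  fixes f g :: "int \<Rightarrow> real"
  assumes f: "\<And>i. i > A \<Longrightarrow> f i = 0" and g: "\<And>i. i > B \<Longrightarrow> g i = 0" and "A + B \<le> N"
  shows "(\<Sum>k\<in>{0..N}. \<Sum>i\<in>{0..k}. f i * g (k - i)) = (\<Sum>i\<in>{0..A}. f i) * (\<Sum>j\<in>{0..B}. g j)"
proof -
  have "(\<Sum>k\<in>{0..N}. \<Sum>i\<in>{0..k}. f i * g (k - i)) = (\<Sum>(k,i)\<in>(SIGMA k:{0..N}. {0..k}). f i * g (k - i))"
    by (rule sum.Sigma) auto
  also have "\<dots> = (\<Sum>(i,j)\<in>{(i,j). 0 \<le> i \<and> 0 \<le> j \<and> i + j \<le> N}. f i * g j)"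
    by (rule sum.reindex_bij_witness[of _ "\<lambda>(i,j). (i + j, i)" "\<lambda>(k,i). (i, k - i)"]) auto
  also have "\<dots> = (\<Sum>(i,j)\<in>{0..A} \<times> {0..B}. f i * g j)"
  proof (rule sum.mono_neutral_right)
    have "{(i,j). 0 \<le> i \<and> 0 \<le> j \<and> i + j \<le> N} \<subseteq> {0..N} \<times> {0..N}" by auto
    then show "finite {(i,j). 0 \<le> i \<and> 0 \<le> j \<and> i + j \<le> N}" by (rule finite_subset) auto
    show "{0..A} \<times> {0..B} \<subseteq> {(i,j). 0 \<le> i \<and> 0 \<le> j \<and> i + j \<le> N}" using assms(3) by auto
    show "\<forall>x\<in>{(i,j). 0 \<le> i \<and> 0 \<le> j \<and> i + j \<le> N} - {0..A} \<times> {0..B}. (case x of (i,j) \<Rightarrow> f i * g j) = 0"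
      using f g by (force simp: not_le)
  qed
  also have "\<dots> = (\<Sum>i\<in>{0..A}. f i) * (\<Sum>j\<in>{0..B}. g j)"
    by (simp add: sum_product sum.cartesian_product)
  finally show ?thesis .
qed

context aperiodic_weights
begin

text \<open>By Spitzer's identity, the coefficient of u^k in the logarithmic derivative X M' / M of
  the rescaled meander series. The entry at n = 0 is cut off because the identity starts at m =
  1.\<close>

definition kern :: "int \<Rightarrow> real fps" where
  "kern k = Abs_fps (\<lambda>n. if n = 0 then 0 else walk_count n k * rho p ^ n)"

definition kern_all :: "real fps" where
  "kern_all = Abs_fps (\<lambda>n. if n = 0 then 0 else (\<Sum>k\<in>{0..int (d * n)}. walk_count n k) * rho p ^ n)"

text \<open>The factor that turns the coefficient of \<open>inv_sqrt_fps\<close>, about 1 / sqrt (pi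
  n), into the local limit value 1 / sqrt (2 pi var n).\<close>

definition amp :: real where "amp = 1 / sqrt (2 * law.var)"

lemma amp_pos: "amp > 0" using law.var_pos by (simp add: amp_def)

lemma walk_count_inv_sqrt:
  obtains C where "C \<ge> 0" "\<And>n k. n \<ge> 1 \<Longrightarrow>
    \<bar>walk_count n k * rho p ^ n - tau p powi (- k) * (amp * fps_nth inv_sqrt_fps n)\<bar>
      \<le> tau p powi (- k) * (C * (1 + (of_int k)\<^sup>2)) / (real n * sqrt (real n))"
proof -
  obtain C where C: "\<And>n k. n \<ge> 1 \<Longrightarrow>
    \<bar>walk_count n k * rho p ^ n * tau p powi k - 1 / sqrt (2 * pi * law.var * real n)\<bar> \<le> C * (1 + (of_int k)\<^sup>2) / (real n * sqrt (real n))"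
    by (rule walk_count_asymp) (rule that)
  have C0: "C \<ge> 0" using order.trans[OF abs_ge_zero C[of 1 0]] by simp
  have "\<bar>walk_count n k * rho p ^ n - tau p powi (- k) * (amp * fps_nth inv_sqrt_fps n)\<bar>
      \<le> tau p powi (- k) * ((C + amp) * (1 + (of_int k)\<^sup>2)) / (real n * sqrt (real n))" if n: "n \<ge> 1" for n k
  proof -
    define W where "W = walk_count n k * rho p ^ n * tau p powi k"
    have tk: "tau p powi (- k) * tau p powi k = 1" using tau by (simp add: power_int_add[symmetric])
    have e: "1 / sqrt (2 * pi * law.var * real n) = amp * (1 / sqrt (pi * real n))"
      by (simp add: amp_def real_sqrt_mult mult_ac)
    have W1: "\<bar>W - amp * (1 / sqrt (pi * real n))\<bar> \<le> C * (1 + (of_int k)\<^sup>2) / (real n * sqrt (real n))"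
      using C[OF n, of k] unfolding W_def e .
    have W2: "\<bar>amp * (1 / sqrt (pi * real n)) - amp * fps_nth inv_sqrt_fps n\<bar> \<le> amp * (1 + (of_int k)\<^sup>2) / (real n * sqrt (real n))"
    proof -
      have "\<bar>amp * (1 / sqrt (pi * real n)) - amp * fps_nth inv_sqrt_fps n\<bar> = amp * \<bar>fps_nth inv_sqrt_fps n - 1 / sqrt (pi * real n)\<bar>"
        unfolding right_diff_distrib[symmetric] abs_mult using amp_pos by (simp add: abs_minus_commute)
      also have "\<dots> \<le> amp * real n powr - (3/2)"
        using n amp_pos by (intro mult_left_mono inv_sqrt_fps_approx) auto
      also have "\<dots> = amp * 1 / (real n * sqrt (real n))" by (simp add: powr_minus_three_halves[OF n])
      also have "\<dots> \<le> amp * (1 + (of_int k)\<^sup>2) / (real n * sqrt (real n))"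
        using amp_pos by (intro divide_right_mono mult_left_mono) auto
      finally show ?thesis .
    qed
    have "walk_count n k * rho p ^ n = tau p powi (- k) * W"
      using tk by (simp add: W_def mult_ac)
    then have "\<bar>walk_count n k * rho p ^ n - tau p powi (- k) * (amp * fps_nth inv_sqrt_fps n)\<bar> = tau p powi (- k) * \<bar>W - amp * fps_nth inv_sqrt_fps n\<bar>"
      using tau by (simp add: right_diff_distrib[symmetric] abs_mult)
    also have "\<dots> \<le> tau p powi (- k) * (C * (1 + (of_int k)\<^sup>2) / (real n * sqrt (real n)) + amp * (1 + (of_int k)\<^sup>2) / (real n * sqrt (real n)))"
      using W1 W2 tau by (intro mult_left_mono) auto
    also have "\<dots> = tau p powi (- k) * ((C + amp) * (1 + (of_int k)\<^sup>2)) / (real n * sqrt (real n))"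
      by (simp add: add_divide_distrib distrib_right distrib_left)
    finally show ?thesis .
  qed
  moreover have "C + amp \<ge> 0" using C0 amp_pos by simp
  ultimately show ?thesis using that by blast
qed

lemma kern_class: "decay (3/2) (kern k - fps_const (tau p powi (- k) * amp) * inv_sqrt_fps)"
proof -
  obtain C where C: "\<And>n k. n \<ge> 1 \<Longrightarrow>
    \<bar>walk_count n k * rho p ^ n - tau p powi (- k) * (amp * fps_nth inv_sqrt_fps n)\<bar>
      \<le> tau p powi (- k) * (C * (1 + (of_int k)\<^sup>2)) / (real n * sqrt (real n))"
    using walk_count_inv_sqrt by metis
  show ?thesis
    by (rule decay_three_halvesI[where C = "tau p powi (- k) * (C * (1 + (of_int k)\<^sup>2))"])
      (use C[of _ k] in \<open>simp add: kern_def mult.assoc\<close>)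
qed

text \<open>The local limit error is summed over all altitudes: tau^(-k) (1 + k^2) is summable
  because tau > 1. Here the negative drift is spent.\<close>

lemma kern_all_class:
  assumes "tau p > 1"
  shows "\<exists>e. decay (3/2) (kern_all - fps_const e * inv_sqrt_fps)"
proof -
  obtain C where C: "C \<ge> 0" "\<And>n k. n \<ge> 1 \<Longrightarrow>
    \<bar>walk_count n k * rho p ^ n - tau p powi (- k) * (amp * fps_nth inv_sqrt_fps n)\<bar>
      \<le> tau p powi (- k) * (C * (1 + (of_int k)\<^sup>2)) / (real n * sqrt (real n))"
    using walk_count_inv_sqrt by metis
  define y where "y = 1 / tau p"
  have y: "0 < y" "y < 1" using assms by (auto simp: y_def)
  have ty: "tau p powi (- int j) = y ^ j" for j by (simp add: y_def power_int_minus power_one_over inverse_eq_divide)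
  define S where "S = (\<Sum>j. y ^ j)"
  define D where "D = (\<Sum>j. y ^ j * (1 + (real j)\<^sup>2))"
  have sS: "summable (\<lambda>j. y ^ j)" using y by (intro summable_geometric) auto
  have sD: "summable (\<lambda>j. y ^ j * (1 + (real j)\<^sup>2))" by (rule summable_geometric_square[OF y])
  show ?thesis
  proof (intro exI, rule decay_three_halvesI)
    fix n :: nat assume n: "n \<ge> 1"
    define r where "r = amp * fps_nth inv_sqrt_fps n"
    define f where "f j = walk_count n (int j) * rho p ^ n" for j
    have f0: "f j = 0" if "j \<notin> {..d * n}" for j
      using that walk_count_support[of n "int j"] by (simp add: f_def of_nat_mult[symmetric] del: of_nat_mult)
    have sf: "summable f" by (rule summable_finite[of "{..d * n}"]) (use f0 in auto)
    have "fps_nth kern_all n = (\<Sum>k\<in>{0..int (d * n)}. walk_count n k * rho p ^ n)"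
      using n by (simp add: kern_all_def sum_distrib_right)
    also have "\<dots> = (\<Sum>j\<le>d * n. f j)" unfolding f_def
      by (rule sum.reindex_bij_witness[of _ int nat]) (auto simp del: of_nat_mult)
    also have "\<dots> = suminf f" by (rule suminf_finite[symmetric]) (use f0 in auto)
    finally have "fps_nth (kern_all - fps_const (amp * S) * inv_sqrt_fps) n = suminf f - S * r"
      by (simp add: r_def)
    also have "S * r = (\<Sum>j. y ^ j * r)" unfolding S_def by (rule suminf_mult2[OF sS])
    also have "suminf f - (\<Sum>j. y ^ j * r) = (\<Sum>j. f j - y ^ j * r)"
      by (rule suminf_diff[OF sf summable_mult2[OF sS]])
    also have "\<bar>\<dots>\<bar> \<le> (\<Sum>j. y ^ j * (1 + (real j)\<^sup>2) * (C / (real n * sqrt (real n))))"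
      unfolding real_norm_def[symmetric]
    proof (rule norm_suminf_le)
      fix j
      have "\<bar>f j - y ^ j * r\<bar> \<le> y ^ j * (C * (1 + (real j)\<^sup>2)) / (real n * sqrt (real n))"
        using C(2)[OF n, of "int j"] unfolding ty f_def r_def by simp
      then show "norm (f j - y ^ j * r) \<le> y ^ j * (1 + (real j)\<^sup>2) * (C / (real n * sqrt (real n)))"
        by (simp add: mult_ac)
    qed (rule summable_mult2[OF sD])
    also have "\<dots> = D * (C / (real n * sqrt (real n)))" unfolding D_def by (rule suminf_mult2[OF sD, symmetric])
    finally show "\<bar>fps_nth (kern_all - fps_const (amp * S) * inv_sqrt_fps) n\<bar> \<le> (D * C) / (real n * sqrt (real n))" by simp
  qed
qed

definition meander_gf :: "int \<Rightarrow> real fps" where "meander_gf k = rescale (rho p) (Mk p k)"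
definition all_gf :: "real fps" where "all_gf = rescale (rho p) (Mall p)"

lemma meander_gf_ode:
  assumes "k \<ge> 0"
  shows "fps_X * fps_deriv (meander_gf k) = (\<Sum>i\<in>{0..k}. kern i * meander_gf (k - i))"
proof (rule fps_ext)
  fix n
  have "fps_nth (\<Sum>i\<in>{0..k}. kern i * meander_gf (k - i)) n
     = (\<Sum>i\<in>{0..k}. \<Sum>m=0..n. fps_nth (kern i) m * fps_nth (meander_gf (k - i)) (n - m))"
    by (simp add: fps_sum_nth fps_mult_nth)
  also have "\<dots> = (\<Sum>m=0..n. \<Sum>i\<in>{0..k}. fps_nth (kern i) m * fps_nth (meander_gf (k - i)) (n - m))"
    by (rule sum.swap)
  also have "\<dots> = (\<Sum>m=1..n. \<Sum>i\<in>{0..k}. fps_nth (kern i) m * fps_nth (meander_gf (k - i)) (n - m))"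
    by (simp add: sum.atLeast_Suc_atMost kern_def)
  also have "\<dots> = (\<Sum>m=1..n. \<Sum>i\<in>{0..k}. walk_count m i * meander_count p (n - m) (k - i) * rho p ^ n)"
  proof (intro sum.cong refl)
    fix m i assume m: "m \<in> {1..n}"
    then have "rho p ^ m * rho p ^ (n - m) = rho p ^ n" by (simp add: power_add[symmetric])
    then show "fps_nth (kern i) m * fps_nth (meander_gf (k - i)) (n - m) = walk_count m i * meander_count p (n - m) (k - i) * rho p ^ n"
      using m by (simp add: kern_def meander_gf_def Mk_def)
  qed
  also have "\<dots> = real n * meander_count p n k * rho p ^ n"
    unfolding spitzer_identity[OF assms] by (simp add: sum_distrib_right)
  also have "\<dots> = fps_nth (fps_X * fps_deriv (meander_gf k)) n"
    unfolding fps_X_deriv_nth by (simp add: meander_gf_def Mk_def)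
  finally show "fps_nth (fps_X * fps_deriv (meander_gf k)) n = fps_nth (\<Sum>i\<in>{0..k}. kern i * meander_gf (k - i)) n" ..
qed

text \<open>Spitzer's identity at u = 1. The sum over final altitudes reaches d n, which covers the
  supports of both factors, so the convolution in the altitude factorises.\<close>

lemma all_gf_ode: "fps_X * fps_deriv all_gf = all_gf * kern_all"
proof (rule fps_ext)
  fix n
  have "real n * fps_nth (Mall p) n = (\<Sum>k\<in>{0..int (d * n)}. real n * meander_count p n k)"
    by (simp add: Mall_nth sum_distrib_left)
  also have "\<dots> = (\<Sum>k\<in>{0..int (d * n)}. \<Sum>m=1..n. \<Sum>i\<in>{0..k}. walk_count m i * meander_count p (n - m) (k - i))"
    by (intro sum.cong refl spitzer_identity) auto
  also have "\<dots> = (\<Sum>m=1..n. \<Sum>k\<in>{0..int (d * n)}. \<Sum>i\<in>{0..k}. walk_count m i * meander_count p (n - m) (k - i))"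
    by (rule sum.swap)
  also have "\<dots> = (\<Sum>m=1..n. (\<Sum>i\<in>{0..int (d * m)}. walk_count m i) * fps_nth (Mall p) (n - m))"
  proof (intro sum.cong refl)
    fix m assume m: "m \<in> {1..n}"
    have "int (d * m) + int (d * (n - m)) \<le> int (d * n)"
      using m by (simp add: of_nat_diff algebra_simps)
    then show "(\<Sum>k\<in>{0..int (d * n)}. \<Sum>i\<in>{0..k}. walk_count m i * meander_count p (n - m) (k - i)) = (\<Sum>i\<in>{0..int (d * m)}. walk_count m i) * fps_nth (Mall p) (n - m)"
      unfolding Mall_nth by (intro sum_convolution walk_count_support meander_count_support) auto
  qed
  finally have main: "real n * fps_nth (Mall p) n = (\<Sum>m=1..n. (\<Sum>i\<in>{0..int (d * m)}. walk_count m i) * fps_nth (Mall p) (n - m))" .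
  have "fps_nth (kern_all * all_gf) n = (\<Sum>m=0..n. fps_nth kern_all m * fps_nth all_gf (n - m))"
    by (simp add: fps_mult_nth)
  also have "\<dots> = (\<Sum>m=1..n. fps_nth kern_all m * fps_nth all_gf (n - m))"
    by (simp add: sum.atLeast_Suc_atMost kern_all_def)
  also have "\<dots> = (\<Sum>m=1..n. (\<Sum>i\<in>{0..int (d * m)}. walk_count m i) * fps_nth (Mall p) (n - m) * rho p ^ n)"
  proof (intro sum.cong refl)
    fix m assume m: "m \<in> {1..n}"
    then have "rho p ^ m * rho p ^ (n - m) = rho p ^ n" by (simp add: power_add[symmetric])
    then show "fps_nth kern_all m * fps_nth all_gf (n - m) = (\<Sum>i\<in>{0..int (d * m)}. walk_count m i) * fps_nth (Mall p) (n - m) * rho p ^ n"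
      using m by (simp add: kern_all_def all_gf_def)
  qed
  also have "\<dots> = real n * fps_nth (Mall p) n * rho p ^ n" unfolding main by (simp add: sum_distrib_right)
  also have "\<dots> = fps_nth (fps_X * fps_deriv all_gf) n" unfolding fps_X_deriv_nth by (simp add: all_gf_def)
  finally show "fps_nth (fps_X * fps_deriv all_gf) n = fps_nth (all_gf * kern_all) n" by (simp add: mult.commute)
qed

lemma kern_primitive: obtains L b where "fps_X * fps_deriv L = kern k" "sqrt_class b L"
  by (rule sqrt_class_primitive[OF kern_class[of k]]) (auto simp: kern_def)

lemma meander_gf_0_unit: "fps_nth (meander_gf 0) 0 = 1"
  by (simp add: meander_gf_def Mk_def meander_count_0)

lemma meander_gf_0_class: "\<exists>b. sqrt_class b (meander_gf 0)"
proof -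
  obtain L b where L: "fps_X * fps_deriv L = kern 0" "sqrt_class b L" by (rule kern_primitive)
  have "fps_X * fps_deriv (meander_gf 0) = meander_gf 0 * (fps_X * fps_deriv L)"
    using meander_gf_ode[of 0] by (simp add: L(1) mult.commute)
  then show ?thesis by (rule sqrt_class_exp[OF L(2) _ meander_gf_0_unit])
qed

text \<open>The equations for the M_j form a triangular system whose diagonal term is
  \<open>kern 0\<close>, the logarithmic derivative of E. Dividing by E as an integrating factor
  removes the diagonal: M_j / E is the integral of terms with smaller j, which allows
  induction.\<close>

lemma meander_gf_class: "\<exists>b. sqrt_class b (meander_gf (int j))"
proof -
  define E G where "E = meander_gf 0" and "G = inverse E"
  have E0: "fps_nth E 0 = 1" unfolding E_def by (rule meander_gf_0_unit)
  have EG: "E * G = 1" using E0 by (simp add: G_def inverse_mult_eq_1')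
  have odeE: "fps_X * fps_deriv E = kern 0 * E" using meander_gf_ode[of 0] by (simp add: E_def)
  have odeG: "fps_X * fps_deriv G = - (kern 0 * G)"
  proof -
    have "fps_deriv (E * G) = 0" by (simp add: EG)
    then have "G * (E * fps_deriv G) + G * (fps_deriv E * G) = 0" by (simp add: distrib_left[symmetric])
    then have "(E * G) * fps_deriv G = - (G * G * fps_deriv E)" by (simp add: eq_neg_iff_add_eq_0 mult_ac)
    then have "fps_X * fps_deriv G = - (G * G * (fps_X * fps_deriv E))" by (simp add: EG mult_ac)
    also have "\<dots> = - (G * (E * G) * kern 0)" unfolding odeE by (simp only: mult_ac)
    finally show ?thesis by (simp add: EG mult.commute)
  qed
  have N: "\<exists>b. sqrt_class b (meander_gf (int j) * G)" for j
  proof (induction j rule: less_induct)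
    case (less j)
    have "fps_X * fps_deriv (meander_gf (int j) * G) = fps_X * fps_deriv (meander_gf (int j)) * G + meander_gf (int j) * (fps_X * fps_deriv G)"
      by (simp add: algebra_simps)
    also have "\<dots> = (\<Sum>i\<in>{0..int j}. kern i * (meander_gf (int j - i) * G)) - kern 0 * (meander_gf (int j) * G)"
      unfolding odeG meander_gf_ode[of "int j", simplified] by (simp add: sum_distrib_right[symmetric] mult.assoc[symmetric])
    also have "{0..int j} = insert 0 {1..int j}" by auto
    finally have ode: "fps_X * fps_deriv (meander_gf (int j) * G) = (\<Sum>i\<in>{1..int j}. kern i * (meander_gf (int j - i) * G))"
      by simp
    \<comment> \<open>\<open>kern i\<close> has order 1/2 only, but it is X L' for some L in the
      class, so the product is covered by \<open>X_deriv_mult_class\<close>.\<close>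
    have ex: "\<exists>e. decay (3/2) (kern i * (meander_gf (int j - i) * G) - fps_const e * (fps_X * fps_deriv sqrt_fps))" if i: "i \<in> {1..int j}" for i
    proof -
      have "int j - i = int (nat (int j - i))" "nat (int j - i) < j" using i by auto
      then obtain b where b: "sqrt_class b (meander_gf (int j - i) * G)" using less by metis
      obtain L b' where L: "fps_X * fps_deriv L = kern i" "sqrt_class b' L" by (rule kern_primitive)
      show ?thesis using X_deriv_mult_class[OF L(2) b] unfolding L(1) .
    qed
    then obtain e where e: "\<And>i. i \<in> {1..int j} \<Longrightarrow> decay (3/2) (kern i * (meander_gf (int j - i) * G) - fps_const (e i) * (fps_X * fps_deriv sqrt_fps))"
      by metis
    have "decay (3/2) (\<Sum>i\<in>{1..int j}. kern i * (meander_gf (int j - i) * G) - fps_const (e i) * (fps_X * fps_deriv sqrt_fps))"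
      by (intro decay_sum e)
    also have "(\<Sum>i\<in>{1..int j}. kern i * (meander_gf (int j - i) * G) - fps_const (e i) * (fps_X * fps_deriv sqrt_fps))
       = fps_X * fps_deriv (meander_gf (int j) * G) - fps_const (\<Sum>i\<in>{1..int j}. e i) * (fps_X * fps_deriv sqrt_fps)"
    proof -
      have "fps_const (\<Sum>i\<in>A. e i) = (\<Sum>i\<in>A. fps_const (e i))" for A
        by (induction A rule: infinite_finite_induct) (simp_all flip: fps_const_add)
      then show ?thesis unfolding ode sum_subtractf sum_distrib_right[symmetric] by simp
    qed
    finally show ?case by (blast intro: sqrt_class_of_X_deriv)
  qed
  obtain b b' where "sqrt_class b (meander_gf (int j) * G)" "sqrt_class b' E"
    using N meander_gf_0_class unfolding E_def by blast
  then have "\<exists>e. sqrt_class e (meander_gf (int j) * G * E)" by (rule sqrt_class_mult)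
  moreover have "meander_gf (int j) * G * E = meander_gf (int j)" using EG by (simp add: mult.assoc mult.commute)
  ultimately show ?thesis by simp
qed

lemma all_gf_class:
  assumes "tau p > 1"
  shows "\<exists>b. sqrt_class b all_gf"
proof -
  obtain e where e: "decay (3/2) (kern_all - fps_const e * inv_sqrt_fps)" using kern_all_class[OF assms] by blast
  obtain L where L: "fps_X * fps_deriv L = kern_all" "sqrt_class (- 2 * e) L"
    by (rule sqrt_class_primitive[OF e]) (auto simp: kern_all_def)
  have "fps_nth all_gf 0 = 1" by (simp add: all_gf_def Mall_nth meander_count_0)
  then show ?thesis using sqrt_class_exp[OF L(2)] all_gf_ode unfolding L(1)[symmetric] by blast
qed

end

subsection \<open>Catastrophes\<close>

context jump_weights
begin

text \<open>One step of the walk, killed below 0, is moved onto the test function F. The lemma is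
  applied to u^k, to k + 1 and to the constant 1.\<close>

lemma meander_sum_Suc:
  fixes F :: "int \<Rightarrow> real"
  shows "(\<Sum>k\<in>{0..int (d * Suc n)}. meander_count p (Suc n) k * F k)
    = (\<Sum>j\<in>{0..int (d * n)}. meander_count p n j * (\<Sum>i\<in>jumps p. p i * (if j + i \<ge> 0 then F (j + i) else 0)))"
proof -
  have inner: "(\<Sum>k\<in>{0..int (d * Suc n)}. meander_count p n (k - i) * F k)
     = (\<Sum>j\<in>{0..int (d * n)}. meander_count p n j * (if j + i \<ge> 0 then F (j + i) else 0))" if i: "i \<in> jumps p" for i
  proof -
    have id: "i \<le> int d" using i jumps_subset by auto
    have "(\<Sum>k\<in>{0..int (d * Suc n)}. meander_count p n (k - i) * F k)
       = (\<Sum>k\<in>{k \<in> {0..int (d * Suc n)}. k - i \<in> {0..int (d * n)}}. meander_count p n (k - i) * F k)"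
    proof (rule sum.mono_neutral_right)
      show "\<forall>k\<in>{0..int (d * Suc n)} - {k \<in> {0..int (d * Suc n)}. k - i \<in> {0..int (d * n)}}. meander_count p n (k - i) * F k = 0"
      proof
        fix k assume "k \<in> {0..int (d * Suc n)} - {k \<in> {0..int (d * Suc n)}. k - i \<in> {0..int (d * n)}}"
        then have "k - i < 0 \<or> k - i > int (d * n)" by auto
        then show "meander_count p n (k - i) * F k = 0" using meander_count_neg meander_count_support by auto
      qed
    qed auto
    also have "\<dots> = (\<Sum>j\<in>{j \<in> {0..int (d * n)}. j + i \<ge> 0}. meander_count p n j * F (j + i))"
      by (rule sum.reindex_bij_witness[of _ "\<lambda>j. j + i" "\<lambda>k. k - i"]) (use id in \<open>auto simp: algebra_simps\<close>)
    also have "\<dots> = (\<Sum>j\<in>{0..int (d * n)}. meander_count p n j * (if j + i \<ge> 0 then F (j + i) else 0))"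
      by (rule sum.mono_neutral_cong_left) auto
    finally show ?thesis .
  qed
  have "(\<Sum>k\<in>{0..int (d * Suc n)}. meander_count p (Suc n) k * F k)
     = (\<Sum>k\<in>{0..int (d * Suc n)}. \<Sum>i\<in>jumps p. p i * (meander_count p n (k - i) * F k))"
    by (intro sum.cong refl) (simp add: meander_count_Suc sum_distrib_right mult.assoc)
  also have "\<dots> = (\<Sum>i\<in>jumps p. p i * (\<Sum>k\<in>{0..int (d * Suc n)}. meander_count p n (k - i) * F k))"
    by (subst sum.swap) (simp add: sum_distrib_left)
  also have "\<dots> = (\<Sum>i\<in>jumps p. \<Sum>j\<in>{0..int (d * n)}. p i * (meander_count p n j * (if j + i \<ge> 0 then F (j + i) else 0)))"
    by (intro sum.cong refl) (simp only: inner sum_distrib_left)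
  also have "\<dots> = (\<Sum>j\<in>{0..int (d * n)}. meander_count p n j * (\<Sum>i\<in>jumps p. p i * (if j + i \<ge> 0 then F (j + i) else 0)))"
    by (subst sum.swap) (simp add: sum_distrib_left mult.left_commute)
  finally show ?thesis .
qed

lemma Mall_nonneg: "fps_nth (Mall p) n \<ge> 0"
  unfolding Mall_nth by (intro sum_nonneg meander_count_nonneg)

text \<open>Without killing, u^k is multiplied by P(u) in each step; killing only lowers the sum,
  and u^k >= 1 on all altitudes as u >= 1. The choice u = tau gives convergence up to rho.\<close>

lemma Mall_le:
  assumes u: "u \<ge> 1"
  shows "fps_nth (Mall p) n \<le> jumpP p u ^ n"
proof -
  have main: "(\<Sum>k\<in>{0..int (d * n)}. meander_count p n k * u powi k) \<le> jumpP p u ^ n"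
  proof (induction n)
    case 0
    then show ?case by (simp add: meander_count_0)
  next
    case (Suc n)
    have "(\<Sum>k\<in>{0..int (d * Suc n)}. meander_count p (Suc n) k * u powi k)
      \<le> (\<Sum>j\<in>{0..int (d * n)}. meander_count p n j * (u powi j * jumpP p u))"
      unfolding meander_sum_Suc
    proof (intro sum_mono mult_left_mono meander_count_nonneg)
      fix j
      have "(\<Sum>i\<in>jumps p. p i * (if j + i \<ge> 0 then u powi (j + i) else 0)) \<le> (\<Sum>i\<in>jumps p. u powi j * (p i * u powi i))"
        by (intro sum_mono) (use u p_nonneg in \<open>auto simp: power_int_add\<close>)
      then show "(\<Sum>i\<in>jumps p. p i * (if j + i \<ge> 0 then u powi (j + i) else 0)) \<le> u powi j * jumpP p u"
        by (simp add: jumpP_def sum_distrib_left)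
    qed
    also have "\<dots> = (\<Sum>j\<in>{0..int (d * n)}. meander_count p n j * u powi j) * jumpP p u"
      by (simp add: sum_distrib_right mult.assoc)
    also have "\<dots> \<le> jumpP p u ^ n * jumpP p u"
      using jumpP_pos[of u] u by (intro mult_right_mono Suc) auto
    finally show ?case by (simp add: mult.commute)
  qed
  have "fps_nth (Mall p) n \<le> (\<Sum>k\<in>{0..int (d * n)}. meander_count p n k * u powi k)"
    unfolding Mall_nth
  proof (rule sum_mono)
    fix k assume "k \<in> {0..int (d * n)}"
    then have "1 \<le> u powi k" using u by (simp add: power_int_def)
    then show "meander_count p n k \<le> meander_count p n k * u powi k"
      using mult_left_mono[of 1 "u powi k" "meander_count p n k"] meander_count_nonneg by simp
  qed
  then show ?thesis using main by simp
qed

lemma jumpP_1: "jumpP p 1 = (\<Sum>i\<in>jumps p. p i)"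
  by (simp add: jumpP_def)

lemma Mall_ge:
  assumes "drift p \<ge> 0"
  shows "jumpP p 1 ^ n \<le> (real (d * n) + 1) * fps_nth (Mall p) n"
proof -
  define V where "V n = (\<Sum>k\<in>{0..int (d * n)}. meander_count p n k * (of_int k + 1))" for n
  have "jumpP p 1 ^ n \<le> V n"
  proof (induction n)
    case 0
    then show ?case by (simp add: V_def meander_count_0)
  next
    case (Suc n)
    have "jumpP p 1 ^ Suc n \<le> jumpP p 1 * V n"
      using Suc jumpP_pos[of 1] by (simp add: mult_left_mono)
    also have "\<dots> = (\<Sum>j\<in>{0..int (d * n)}. meander_count p n j * (jumpP p 1 * (of_int j + 1)))"
      by (simp add: V_def sum_distrib_left mult.left_commute)
    also have "\<dots> \<le> (\<Sum>j\<in>{0..int (d * n)}. meander_count p n j * (\<Sum>i\<in>jumps p. p i * (if j + i \<ge> 0 then of_int (j + i) + 1 else 0)))"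
    proof (intro sum_mono mult_left_mono meander_count_nonneg)
      fix j
      have "jumpP p 1 * (of_int j + 1) \<le> jumpP p 1 * (of_int j + 1) + jumpP' p 1"
        using assms by (simp add: drift_def)
      also have "\<dots> = (\<Sum>i\<in>jumps p. p i * (of_int (j + i) + 1))"
        unfolding jumpP_1 jumpP'_def sum_distrib_right sum.distrib[symmetric]
        by (rule sum.cong[OF refl]) (simp add: algebra_simps)
      also have "\<dots> \<le> (\<Sum>i\<in>jumps p. p i * (if j + i \<ge> 0 then of_int (j + i) + 1 else 0))"
      proof (intro sum_mono mult_left_mono p_nonneg)
        fix i
        \<comment> \<open>A killed position has altitude at most -1, so its value altitude + 1 is at
          most 0 and killing can only raise the sum; this is the reason for the + 1.\<close>
        have "real_of_int (j + i) + 1 \<le> 0" if "\<not> j + i \<ge> 0" using that by linarith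
        then show "real_of_int (j + i) + 1 \<le> (if j + i \<ge> 0 then of_int (j + i) + 1 else 0)" by auto
      qed
      finally show "jumpP p 1 * (of_int j + 1) \<le> (\<Sum>i\<in>jumps p. p i * (if j + i \<ge> 0 then of_int (j + i) + 1 else 0))" .
    qed
    also have "\<dots> = V (Suc n)" unfolding V_def meander_sum_Suc ..
    finally show ?case .
  qed
  also have "V n \<le> (\<Sum>k\<in>{0..int (d * n)}. meander_count p n k * (real (d * n) + 1))"
    unfolding V_def
  proof (intro sum_mono mult_left_mono meander_count_nonneg)
    fix k assume "k \<in> {0..int (d * n)}"
    then have "real_of_int k \<le> real_of_int (int (d * n))" by (simp only: of_int_le_iff atLeastAtMost_iff)
    then show "real_of_int k + 1 \<le> real (d * n) + 1" by simp
  qed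
  also have "\<dots> = (real (d * n) + 1) * fps_nth (Mall p) n"
    by (simp add: Mall_nth sum_distrib_left mult.commute)
  finally show ?thesis .
qed

text \<open>From each altitude below c the jump -c leaves the half-line, so at least that weight is
  lost. Telescoped, this controls the total weight of the low meanders.\<close>

lemma Mall_Suc_le:
  "fps_nth (Mall p) (Suc n) + p (- int c) * (\<Sum>j\<in>{0..int c - 1}. meander_count p n j) \<le> jumpP p 1 * fps_nth (Mall p) n"
proof -
  have "fps_nth (Mall p) (Suc n) = (\<Sum>j\<in>{0..int (d * n)}. meander_count p n j * (\<Sum>i\<in>jumps p. p i * (if j + i \<ge> 0 then 1 else 0)))"
    using meander_sum_Suc[of n "\<lambda>_. 1"] unfolding Mall_nth by (simp only: mult_1_right)
  also have "\<dots> \<le> (\<Sum>j\<in>{0..int (d * n)}. meander_count p n j * (jumpP p 1 - (if j < int c then p (- int c) else 0)))"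
  proof (intro sum_mono mult_left_mono meander_count_nonneg)
    fix j
    have "(\<Sum>i\<in>jumps p. p i * (if j + i \<ge> 0 then 1 else 0)) \<le> (\<Sum>i\<in>jumps p. p i - (if i = - int c then (if j < int c then p (- int c) else 0) else 0))"
      by (rule sum_mono) (use p_nonneg in auto)
    also have "\<dots> = jumpP p 1 - (if j < int c then p (- int c) else 0)"
      using finite_jumps minus_c_jump by (simp add: sum_subtractf jumpP_1 sum.delta)
    finally show "(\<Sum>i\<in>jumps p. p i * (if j + i \<ge> 0 then 1 else 0)) \<le> jumpP p 1 - (if j < int c then p (- int c) else 0)" .
  qed
  also have "\<dots> = jumpP p 1 * fps_nth (Mall p) n - p (- int c) * (\<Sum>j\<in>{0..int (d * n)}. if j < int c then meander_count p n j else 0)"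
  proof -
    have "meander_count p n j * (jumpP p 1 - (if j < int c then p (- int c) else 0))
      = jumpP p 1 * meander_count p n j - p (- int c) * (if j < int c then meander_count p n j else 0)" for j
      by (simp add: right_diff_distrib mult.commute)
    then show ?thesis by (simp only: Mall_nth sum_subtractf sum_distrib_left)
  qed
  also have "(\<Sum>j\<in>{0..int (d * n)}. if j < int c then meander_count p n j else 0) = (\<Sum>j\<in>{0..int c - 1}. meander_count p n j)"
    by (rule sum.mono_neutral_cong) (auto simp: meander_count_support)
  finally show ?thesis by simp
qed

lemma meander_count_step_d: "k \<ge> 0 \<Longrightarrow> p (int d) * meander_count p n k \<le> meander_count p (Suc n) (k + int d)"
proof -
  assume k: "k \<ge> 0"
  have "p (int d) * meander_count p n (k + int d - int d) \<le> (\<Sum>i\<in>jumps p. p i * meander_count p n (k + int d - i))"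
    by (rule member_le_sum[OF d_jump]) (use finite_jumps p_nonneg meander_count_nonneg in auto)
  then show ?thesis using k by (simp add: meander_count_Suc)
qed

lemma meander_count_steps_d: "k \<ge> 0 \<Longrightarrow> p (int d) ^ j * meander_count p n k \<le> meander_count p (n + j) (k + int (d * j))"
proof (induction j)
  case (Suc j)
  have "p (int d) ^ Suc j * meander_count p n k \<le> p (int d) * meander_count p (n + j) (k + int (d * j))"
    using Suc p_d_pos by (simp add: mult.assoc)
  also have "\<dots> \<le> meander_count p (Suc (n + j)) (k + int (d * j) + int d)"
    using Suc by (intro meander_count_step_d) auto
  finally show ?case by (simp add: algebra_simps)
qed simp

lemma Qfps_0: "fps_nth (Qfps p q) 0 = 0"
  by (simp add: Qfps_def)

text \<open>The altitudes from which a catastrophe may start.\<close>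

definition high :: "int set" where "high = {k. k > 0 \<and> - k \<notin> jumps p}"

text \<open>The subtracted series cancel exactly the altitudes outside \<open>high\<close>, which
  makes the coefficients of Q visibly non-negative. The index shift is the catastrophe step.\<close>

lemma Qfps_Suc: "fps_nth (Qfps p q) (Suc n) = q * (\<Sum>k\<in>{1..int (d * n)} \<inter> high. meander_count p n k)"
proof -
  define S where "S = {j::int. j > 0 \<and> - j \<in> jumps p}"
  have "S \<subseteq> uminus ` jumps p" by (force simp: S_def)
  then have fS: "finite S" using finite_jumps finite_surj by blast
  define B where "B = {1..int (d * n)}"
  have "fps_nth (Qfps p q) (Suc n) = q * (fps_nth (Mall p) n - meander_count p n 0 - (\<Sum>j\<in>S. meander_count p n j))"
    by (simp add: Qfps_def Efps_def Mk_def S_def fps_sum_nth mult.assoc)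
  also have "fps_nth (Mall p) n = meander_count p n 0 + (\<Sum>k\<in>B. meander_count p n k)"
  proof -
    have "{0..int (d * n)} = insert 0 B" by (auto simp: B_def)
    then show ?thesis unfolding Mall_nth by (simp add: B_def)
  qed
  also have "(\<Sum>k\<in>B. meander_count p n k) = (\<Sum>k\<in>B \<inter> high. meander_count p n k) + (\<Sum>k\<in>B \<inter> S. meander_count p n k)"
    by (subst sum.union_disjoint[symmetric]) (auto simp: B_def high_def S_def intro!: sum.cong)
  also have "(\<Sum>j\<in>S. meander_count p n j) = (\<Sum>k\<in>B \<inter> S. meander_count p n k)"
  proof (rule sum.mono_neutral_right[OF fS])
    show "\<forall>i\<in>S - B \<inter> S. meander_count p n i = 0"
    proof
      fix i assume "i \<in> S - B \<inter> S"
      then have "i > int (d * n)" by (auto simp: B_def S_def)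
      then show "meander_count p n i = 0" by (rule meander_count_support)
    qed
  qed auto
  finally show ?thesis by (simp add: B_def)
qed

end

section \<open>Lower bounds for Q, and its divergence for non-negative drift\<close>

locale catastrophe_walk = jump_weights +
  fixes q :: real
  assumes q_pos: "q > 0"
begin

abbreviation "qn \<equiv> fps_nth (Qfps p q)"

lemma qn_nonneg: "qn n \<ge> 0"
proof (cases n)
  case (Suc m)
  then show ?thesis unfolding Suc Qfps_Suc
    using q_pos by (intro mult_nonneg_nonneg sum_nonneg meander_count_nonneg) auto
qed (simp add: Qfps_0)

lemma qn_Suc_le: "qn (Suc n) \<le> q * fps_nth (Mall p) n"
proof -
  have "(\<Sum>k\<in>{1..int (d * n)} \<inter> high. meander_count p n k) \<le> fps_nth (Mall p) n"
    unfolding Mall_nth by (rule sum_mono2) (auto intro: meander_count_nonneg)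
  then show ?thesis unfolding Qfps_Suc using q_pos by (intro mult_left_mono) auto
qed

lemma above_c_high: "k > int c \<Longrightarrow> k \<in> high"
  using jumps_subset c_pos unfolding high_def by force

lemma qn_Suc_ge:
  assumes "k > int c"
  shows "q * meander_count p n k \<le> qn (Suc n)"
proof (cases "k \<le> int (d * n)")
  case True
  have "meander_count p n k \<le> (\<Sum>k\<in>{1..int (d * n)} \<inter> high. meander_count p n k)"
    by (rule member_le_sum) (use True assms above_c_high[OF assms] in \<open>auto intro: meander_count_nonneg\<close>)
  then show ?thesis unfolding Qfps_Suc using q_pos by (intro mult_left_mono) auto
next
  case False
  then show ?thesis using qn_nonneg[of "Suc n"] by (simp add: meander_count_support)
qed

text \<open>After an excursion, c + 1 jumps by d lead above altitude c, where a catastrophe is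
  always allowed. This passes the lower bound on excursions to Q.\<close>

lemma qn_lower:
  "q * p (int d) ^ (c + 1) * meander_count p n 0 \<le> qn (Suc (n + (c + 1)))"
proof -
  have "p (int d) ^ (c + 1) * meander_count p n 0 \<le> meander_count p (n + (c + 1)) (0 + int (d * (c + 1)))"
    by (rule meander_count_steps_d) simp
  then have "q * (p (int d) ^ (c + 1) * meander_count p n 0) \<le> q * meander_count p (n + (c + 1)) (0 + int (d * (c + 1)))"
    using q_pos by (intro mult_left_mono) auto
  also have "\<dots> \<le> qn (Suc (n + (c + 1)))"
  proof (rule qn_Suc_ge)
    have "1 * (c + 1) \<le> d * (c + 1)" using d_pos by (intro mult_right_mono) auto
    then have "c < d * (c + 1)" by (rule less_le_trans[rotated]) simp
    then show "0 + int (d * (c + 1)) > int c" by (simp only: of_nat_less_iff add_0)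
  qed
  finally show ?thesis by (simp add: mult.assoc)
qed

text \<open>A straight climb of n - 1 >= c + 1 jumps by d ends above altitude c, and the last step
  is a catastrophe. That no later n is missed is what \<open>nonneg_series_ne_1\<close>
  needs.\<close>

lemma qn_pos: "n \<ge> c + 2 \<Longrightarrow> qn n > 0"
proof -
  assume n: "n \<ge> c + 2"
  define m where "m = n - 1"
  have m: "n = Suc m" "m \<ge> c + 1" using n by (auto simp: m_def)
  have "0 < q * p (int d) ^ m" using q_pos p_d_pos by simp
  also have "\<dots> \<le> q * meander_count p (0 + m) (0 + int (d * m))"
    using meander_count_steps_d[of 0 m 0] q_pos by (intro mult_left_mono) (auto simp: meander_count_0)
  also have "\<dots> \<le> qn (Suc (0 + m))"
  proof (rule qn_Suc_ge)
    have "1 * m \<le> d * m" using d_pos by (intro mult_right_mono) auto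
    then have "c < d * m" using m by linarith
    then show "0 + int (d * m) > int c" by (simp only: of_nat_less_iff add_0)
  qed
  finally show ?thesis using m by simp
qed

text \<open>Altitudes above c belong to \<open>high\<close> and are counted by Q. Altitude c does
  not, but one jump by d lifts it into \<open>high\<close>. Only the altitudes below c
  remain.\<close>

lemma Mall_decompose:
  "fps_nth (Mall p) n \<le> (\<Sum>j\<in>{0..int c - 1}. meander_count p n j) + qn (Suc (Suc n)) / (q * p (int d)) + qn (Suc n) / q"
proof -
  have "fps_nth (Mall p) n \<le> (\<Sum>k\<in>{0..int c - 1} \<union> {int c} \<union> ({1..int (d * n)} \<inter> high). meander_count p n k)"
    unfolding Mall_nth
    by (rule sum_mono2) (use above_c_high in \<open>force intro: meander_count_nonneg\<close>)+
  also have "\<dots> \<le> (\<Sum>k\<in>{0..int c - 1} \<union> {int c}. meander_count p n k) + (\<Sum>k\<in>{1..int (d * n)} \<inter> high. meander_count p n k)"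
  proof -
    have *: "sum f (A \<union> B) \<le> sum f A + sum f B" if "finite A" "finite B" "\<And>x. f x \<ge> 0" for A B :: "int set" and f :: "int \<Rightarrow> real"
      using sum.union_inter[OF that(1,2), of f] sum_nonneg[of "A \<inter> B" f] that(3) by simp
    show ?thesis by (rule *) (auto simp: meander_count_nonneg)
  qed
  also have "(\<Sum>k\<in>{0..int c - 1} \<union> {int c}. meander_count p n k) = (\<Sum>j\<in>{0..int c - 1}. meander_count p n j) + meander_count p n (int c)"
    by (subst sum.union_disjoint) auto
  also have "(\<Sum>k\<in>{1..int (d * n)} \<inter> high. meander_count p n k) = qn (Suc n) / q"
    using q_pos by (simp add: Qfps_Suc)
  also have "meander_count p n (int c) \<le> qn (Suc (Suc n)) / (q * p (int d))"
  proof -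
    have "q * (p (int d) * meander_count p n (int c)) \<le> q * meander_count p (Suc n) (int c + int d)"
      using q_pos by (intro mult_left_mono meander_count_step_d) auto
    also have "\<dots> \<le> qn (Suc (Suc n))" using d_pos by (intro qn_Suc_ge) auto
    finally show ?thesis using q_pos p_d_pos by (simp add: pos_le_divide_eq mult_ac)
  qed
  finally show ?thesis by simp
qed

text \<open>If Q converged at 1 / P(1), so would M: altitudes from c on are controlled by Q, lower
  ones by the lost weight. But there the terms of M are at least 1 / (d (n + 1)), a divergent
  harmonic series.\<close>

lemma not_summable_drift_nonneg:
  assumes "drift p \<ge> 0"
  shows "\<not> summable (\<lambda>n. qn n * (1 / jumpP p 1) ^ n)"
proof
  define z where "z = 1 / jumpP p 1"
  have z: "z > 0" using jumpP_pos[of 1] by (simp add: z_def)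
  assume "summable (\<lambda>n. qn n * (1 / jumpP p 1) ^ n)"
  then have s0: "summable (\<lambda>n. qn n * z ^ n)" by (simp add: z_def)
  then have s1: "summable (\<lambda>n. qn (Suc n) * z ^ Suc n)" by (subst summable_Suc_iff)
  then have s2: "summable (\<lambda>n. qn (Suc (Suc n)) * z ^ Suc (Suc n))" by (subst summable_Suc_iff[of "\<lambda>n. qn (Suc n) * z ^ Suc n"])
  define B where "B n = (\<Sum>j\<in>{0..int c - 1}. meander_count p n j) * z ^ n" for n
  have B0: "B n \<ge> 0" for n unfolding B_def using z by (intro mult_nonneg_nonneg sum_nonneg meander_count_nonneg) auto
  define m where "m n = fps_nth (Mall p) n * z ^ n" for n
  have m0: "m n \<ge> 0" for n using Mall_nonneg z by (simp add: m_def)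
  have step: "m (Suc n) + (p (- int c) * z) * B n \<le> m n" for n
  proof -
    have "(fps_nth (Mall p) (Suc n) + p (- int c) * (\<Sum>j\<in>{0..int c - 1}. meander_count p n j)) * z ^ Suc n \<le> (jumpP p 1 * fps_nth (Mall p) n) * z ^ Suc n"
      using z by (intro mult_right_mono Mall_Suc_le) auto
    moreover have "jumpP p 1 * z = 1" using jumpP_pos[of 1] by (simp add: z_def)
    then have "(jumpP p 1 * fps_nth (Mall p) n) * z ^ Suc n = m n"
      by (simp add: m_def mult_ac)
    moreover have "(fps_nth (Mall p) (Suc n) + p (- int c) * (\<Sum>j\<in>{0..int c - 1}. meander_count p n j)) * z ^ Suc n = m (Suc n) + (p (- int c) * z) * B n"
      by (simp add: m_def B_def algebra_simps)
    ultimately show ?thesis by (simp only:)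
  qed
  \<comment> \<open>At z = 1 / P(1) the sequence \<open>m\<close> is non-increasing, and each drop
    pays for the low meanders of that length.\<close>
  have "(\<Sum>i<n. (p (- int c) * z) * B i) \<le> m 0 - m n" for n
  proof (induction n)
    case (Suc n)
    then show ?case using step[of n] by simp
  qed simp
  then have "(\<Sum>i<n. (p (- int c) * z) * B i) \<le> m 0" for n using m0[of n] by (smt (verit))
  then have "summable (\<lambda>i. (p (- int c) * z) * B i)"
    using B0 z p_c_pos by (intro summableI_nonneg_bounded[where x = "m 0"]) auto
  then have sB: "summable B" using z p_c_pos by (subst (asm) summable_cmult_iff) auto
  have sm: "summable m"
  proof (rule summable_comparison_test')
    show "summable (\<lambda>n. B n + (1 / (q * p (int d) * z\<^sup>2)) * (qn (Suc (Suc n)) * z ^ Suc (Suc n)) + (1 / (q * z)) * (qn (Suc n) * z ^ Suc n))"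
      by (intro summable_add summable_mult sB s1 s2)
    fix n
    have "m n \<le> ((\<Sum>j\<in>{0..int c - 1}. meander_count p n j) + qn (Suc (Suc n)) / (q * p (int d)) + qn (Suc n) / q) * z ^ n"
      unfolding m_def using z by (intro mult_right_mono Mall_decompose) auto
    also have "\<dots> = B n + (1 / (q * p (int d) * z\<^sup>2)) * (qn (Suc (Suc n)) * z ^ Suc (Suc n)) + (1 / (q * z)) * (qn (Suc n) * z ^ Suc n)"
      using z by (simp add: B_def distrib_right power2_eq_square)
    finally show "norm (m n) \<le> B n + (1 / (q * p (int d) * z\<^sup>2)) * (qn (Suc (Suc n)) * z ^ Suc (Suc n)) + (1 / (q * z)) * (qn (Suc n) * z ^ Suc n)"
      using m0[of n] by simp
  qed
  have lo: "1 / (real d * (real n + 1)) \<le> m n" for n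
  proof -
    have "1 = jumpP p 1 ^ n * z ^ n" using jumpP_pos[of 1] by (simp add: z_def power_one_over)
    also have "\<dots> \<le> (real (d * n) + 1) * fps_nth (Mall p) n * z ^ n"
      using z by (intro mult_right_mono Mall_ge assms) auto
    also have "\<dots> = (real (d * n) + 1) * m n" by (simp add: m_def)
    also have "\<dots> \<le> (real d * (real n + 1)) * m n"
      using m0 d_pos by (intro mult_right_mono) (auto simp: algebra_simps)
    finally show ?thesis using d_pos by (simp add: divide_le_eq mult.commute)
  qed
  have "summable (\<lambda>n. 1 / (real d * (real n + 1)))"
    by (rule summable_comparison_test'[OF sm]) (use lo in simp)
  then have "summable (\<lambda>n. real d * (1 / (real d * (real n + 1))))" by (rule summable_mult)
  then have "summable (\<lambda>n. 1 / (real (Suc n)))" using d_pos by (simp add: add.commute)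
  then have "summable (\<lambda>n. inverse (real n))"
    using summable_Suc_iff[of "\<lambda>n. inverse (real n)"] by (simp add: inverse_eq_divide)
  then show False using not_summable_harmonic[where 'a = real] by (simp add: inverse_eq_divide)
qed

lemma summable_qn:
  assumes "u \<ge> 1" "0 \<le> x" "x * jumpP p u < 1"
  shows "summable (\<lambda>n. qn n * x ^ n)"
proof -
  have "summable (\<lambda>n. qn (Suc n) * x ^ Suc n)"
  proof (rule summable_comparison_test')
    show "summable (\<lambda>n. q * x * (x * jumpP p u) ^ n)"
      using assms jumpP_pos[of u] by (intro summable_mult summable_geometric) auto
    fix n
    have "qn (Suc n) * x ^ Suc n \<le> (q * jumpP p u ^ n) * x ^ Suc n"
      using assms(2) q_pos Mall_le[OF assms(1), of n] qn_Suc_le[of n]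
      by (intro mult_right_mono) (auto intro: order.trans mult_left_mono)
    then show "norm (qn (Suc n) * x ^ Suc n) \<le> q * x * (x * jumpP p u) ^ n"
      using qn_nonneg assms(2) by (simp add: power_mult_distrib mult_ac)
  qed
  then show ?thesis by (subst (asm) summable_Suc_iff)
qed

end

subsection \<open>Coefficients of 1 / (1 - Q)\<close>

text \<open>The series may diverge at K, so the crossing is found in two steps: a partial sum, being
  a polynomial, takes the value 1 at some y < K; the full series is then at least 1 at y and
  continuous up to there.\<close>

lemma nonneg_series_crosses_1:
  fixes a :: "nat \<Rightarrow> real"
  assumes a: "\<And>n. a n \<ge> 0" "a 0 = 0" and K: "K > 0"
    and sm: "\<And>y. 0 < y \<Longrightarrow> y < K \<Longrightarrow> summable (\<lambda>n. a n * y ^ n)"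
    and big: "(\<Sum>n<N. a n * K ^ n) > 1"
  obtains z where "0 < z" "z < K" "(\<lambda>n. a n * z ^ n) sums 1"
proof -
  define f where "f x = (\<Sum>n<N. a n * x ^ n)" for x
  have f0: "f 0 = 0" using a by (auto simp: f_def power_0_left intro!: sum.neutral)
  have "\<exists>y. 0 \<le> y \<and> y \<le> K \<and> f y = 1"
    by (rule IVT') (use f0 big K in \<open>auto simp: f_def intro!: continuous_intros\<close>)
  then obtain y where y: "0 \<le> y" "y \<le> K" "f y = 1" by blast
  have "y \<noteq> K" using y(3) big by (auto simp: f_def)
  moreover have "y \<noteq> 0" using y(3) f0 by auto
  ultimately have y': "0 < y" "y < K" using y by auto
  define g where "g x = (\<Sum>n. a n * x ^ n)" for x
  obtain M where M: "y < M" "M < K" using dense[OF y'(2)] by blast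
  have sM: "summable (\<lambda>n. a n * M ^ n)" using sm M y' by auto
  have cont: "continuous_on {0..y} g" unfolding g_def
    by (intro continuous_at_imp_continuous_on ballI isCont_powser[OF sM]) (use M y' in auto)
  have "1 \<le> g y" unfolding y(3)[symmetric] f_def g_def
    by (rule sum_le_suminf[OF sm[OF y']]) (use a y' in auto)
  moreover have g0: "g 0 = 0" using a by (simp add: g_def powser_zero)
  ultimately have "\<exists>z. 0 \<le> z \<and> z \<le> y \<and> g z = 1"
    by (intro IVT') (use cont y' in auto)
  then obtain z where z: "0 \<le> z" "z \<le> y" "g z = 1" by blast
  have "z \<noteq> 0" using z(3) g0 by auto
  then have z': "0 < z" "z < K" using z y' by auto
  have "(\<lambda>n. a n * z ^ n) sums g z" unfolding g_def by (rule summable_sums[OF sm[OF z']])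
  then show ?thesis using that z' z(3) by simp
qed

text \<open>Comparing real parts forces Re (z^n) = 1, hence z^n = 1, wherever b n > 0; two
  consecutive exponents give z = 1.\<close>

lemma nonneg_series_ne_1:
  fixes b :: "nat \<Rightarrow> real" and z :: complex
  assumes b: "\<And>n. b n \<ge> 0" "b sums 1" and pos: "\<And>n. n \<ge> N \<Longrightarrow> b n > 0" and z: "norm z \<le> 1" "z \<noteq> 1"
  shows "(\<Sum>n. of_real (b n) * z ^ n) \<noteq> 1"
proof
  assume eq: "(\<Sum>n. of_real (b n) * z ^ n) = 1"
  have zn: "norm (z ^ n) \<le> 1" for n using z by (simp add: norm_power power_le_one)
  have sm: "summable (\<lambda>n. complex_of_real (b n) * z ^ n)"
  proof (rule summable_comparison_test'[OF sums_summable[OF b(2)]])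
    fix n show "norm (complex_of_real (b n) * z ^ n) \<le> b n"
      using zn[of n] b(1)[of n] by (simp add: norm_mult mult_left_le)
  qed
  then have "(\<lambda>n. complex_of_real (b n) * z ^ n) sums 1" using eq summable_sums by metis
  then have "(\<lambda>n. Re (complex_of_real (b n) * z ^ n)) sums Re 1" by (rule sums_Re)
  then have "(\<lambda>n. b n - Re (complex_of_real (b n) * z ^ n)) sums (1 - Re 1)" by (rule sums_diff[OF b(2)])
  then have s: "(\<lambda>n. b n * (1 - Re (z ^ n))) sums 0" by (simp add: right_diff_distrib)
  have nn: "b n * (1 - Re (z ^ n)) \<ge> 0" for n
    using b(1)[of n] zn[of n] complex_Re_le_cmod[of "z ^ n"] by (intro mult_nonneg_nonneg) auto
  have zero: "b n * (1 - Re (z ^ n)) = 0" for n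
    using s nn suminf_eq_zero_iff[OF sums_summable[OF s]] sums_unique[OF s] by auto
  have one: "z ^ n = 1" if "n \<ge> N" for n
  proof -
    have re: "Re (z ^ n) = 1" using zero[of n] pos[OF that] by simp
    have "(Re (z ^ n))\<^sup>2 + (Im (z ^ n))\<^sup>2 \<le> 1"
      using zn[of n] by (metis cmod_power2 norm_ge_zero power_le_one)
    then have "Im (z ^ n) = 0" unfolding re by simp
    then show ?thesis using re by (simp add: complex_eq_iff)
  qed
  have "z = z ^ Suc N" using one[of N] by simp
  also have "\<dots> = 1" using one[of "Suc N"] by simp
  finally show False using z by simp
qed

lemma eval_fps_complex_of_real:
  assumes "summable (\<lambda>n. norm (fps_nth f n))"
  shows "eval_fps (fps_complex f) 1 = of_real (eval_fps f 1)"
  unfolding eval_fps_def using assms by (simp add: suminf_of_real summable_rabs_cancel)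

text \<open>The quotient V = (1 - Q) / (1 - z / r) is analytic beyond the disc of radius r and
  has no zero on its closure.\<close>

lemma simple_pole_coefficients:
  fixes A :: "real fps"
  assumes A: "\<And>n. fps_nth A n \<ge> 0" "fps_nth A 0 = 0" and pos: "\<And>n. n \<ge> N \<Longrightarrow> fps_nth A n > 0"
    and r: "r > 0" "(\<lambda>n. fps_nth A n * r ^ n) sums 1" and R: "R > r" "summable (\<lambda>n. fps_nth A n * R ^ n)"
  shows "\<exists>K. 0 < K \<and> K < 1 / r \<and>
    (\<lambda>n. fps_nth (inverse (1 - A)) n - (1 / r) ^ n / (r * (\<Sum>n. fps_nth (fps_deriv A) n * r ^ n))) \<in> o(\<lambda>n. K ^ n)"
proof -
  define B where "B = rescale r A"
  have B0: "fps_nth B n \<ge> 0" for n using A r by (simp add: B_def)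
  have Bpos: "fps_nth B n > 0" if "n \<ge> N" for n using pos[OF that] r by (simp add: B_def)
  have "fps_nth B = (\<lambda>n. fps_nth A n * r ^ n)" by (simp add: B_def fun_eq_iff)
  then have Bs: "fps_nth B sums 1" using r by simp
  define x where "x = R / r"
  have x: "x > 1" using R r by (simp add: x_def)
  have Bx: "summable (\<lambda>n. fps_nth B n * x ^ n)" using R r by (simp add: B_def x_def power_divide)
  \<comment> \<open>Division by 1 - X means partial sums; as B sums to 1, those of 1 - B are the
    tails of B, which are non-negative and decay like x^(-n).\<close>
  define V where "V = Abs_fps (\<lambda>n. \<Sum>k. fps_nth B (k + Suc n))"
  have sB: "summable (\<lambda>k. fps_nth B (k + m))" for m
    using sums_summable[OF Bs] by (rule summable_ignore_initial_segment)
  have V0: "fps_nth V n \<ge> 0" for n unfolding V_def by (simp add: suminf_nonneg[OF sB[of "Suc n", simplified]] B0)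
  have VB: "(1 - fps_X) * V = 1 - B"
  proof (rule fps_ext)
    fix n
    have split: "(\<Sum>k. fps_nth B (k + m)) = (\<Sum>k. fps_nth B (k + Suc m)) + fps_nth B m" for m
      using suminf_split_head[OF sB[of m]] by simp
    show "fps_nth ((1 - fps_X) * V) n = fps_nth (1 - B) n"
    proof (cases n)
      case 0
      then show ?thesis using split[of 0] sums_unique[OF Bs] by (simp add: V_def left_diff_distrib)
    next
      case (Suc m)
      then show ?thesis using split[of "Suc m"] by (simp add: V_def left_diff_distrib)
    qed
  qed
  define C where "C = (\<Sum>k. fps_nth B k * x ^ k)"
  have Vle: "fps_nth V n \<le> C * (1 / x) ^ n" for n
  proof -
    have sx: "summable (\<lambda>k. fps_nth B (k + Suc n) * x ^ (k + Suc n))"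
      using Bx by (rule summable_ignore_initial_segment)
    have "fps_nth V n * x ^ n = (\<Sum>k. fps_nth B (k + Suc n) * x ^ n)"
      unfolding V_def by (simp add: suminf_mult2[OF sB[of "Suc n", simplified]])
    also have "\<dots> \<le> (\<Sum>k. fps_nth B (k + Suc n) * x ^ (k + Suc n))"
    proof (rule suminf_le[OF _ summable_mult2[OF sB] sx])
      fix k
      have "x ^ n \<le> x ^ (k + Suc n)" using x by (intro power_increasing) auto
      then show "fps_nth B (k + Suc n) * x ^ n \<le> fps_nth B (k + Suc n) * x ^ (k + Suc n)"
        by (intro mult_left_mono B0)
    qed
    also have "\<dots> \<le> C" unfolding C_def
      using suminf_split_initial_segment[OF Bx, of "Suc n"] B0 x by (simp add: sum_nonneg del: sum.lessThan_Suc)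
    finally show ?thesis using x by (simp add: power_one_over field_simps)
  qed
  have radV: "fps_conv_radius (fps_complex V) \<ge> x" "fps_conv_radius V \<ge> x"
  proof -
    have *: "summable (\<lambda>n. fps_nth V n * y ^ n)" if y: "0 < y" "y < x" for y
    proof (rule summable_comparison_test')
      show "summable (\<lambda>n. C * (y / x) ^ n)" using y x by (intro summable_mult summable_geometric) auto
      fix n
      have "fps_nth V n * y ^ n \<le> (C * (1 / x) ^ n) * y ^ n" using y by (intro mult_right_mono Vle) auto
      then show "norm (fps_nth V n * y ^ n) \<le> C * (y / x) ^ n" using V0[of n] y by (simp add: power_divide)
    qed
    show "fps_conv_radius V \<ge> x" unfolding fps_conv_radius_def
      by (rule conv_radius_geI_ex') (use * x in auto)
    show "fps_conv_radius (fps_complex V) \<ge> x" unfolding fps_conv_radius_def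
    proof (rule conv_radius_geI_ex')
      fix y :: real assume "0 < y" "ereal y < ereal x"
      then have "summable (\<lambda>n. complex_of_real (fps_nth V n * y ^ n))"
        by (intro summable_of_real *) auto
      then show "summable (\<lambda>n. fps_nth (fps_complex V) n * of_real y ^ n)" by simp
    qed
  qed
  have radV1: "fps_conv_radius (fps_complex V) > 1" "fps_conv_radius V > 1"
    using radV x by (metis ereal_less(3) one_ereal_def less_ereal.simps(1) less_le_trans)+
  have sV: "summable (\<lambda>n. norm (fps_nth V n))"
    using norm_summable_fps[of 1 V] radV1 by (simp add: one_ereal_def)
  have sBn: "summable (\<lambda>n. norm (fps_nth B n))" using sums_summable[OF Bs] B0 by simp
  have V1: "eval_fps V 1 \<ge> 1"
  proof -
    have "fps_nth V 0 = 1"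
    proof -
      have "fps_nth ((1 - fps_X) * V) 0 = fps_nth (1 - B) 0" by (simp only: VB)
      then show ?thesis using A(2) by (simp add: B_def)
    qed
    then have "1 = (\<Sum>n<1. fps_nth V n)" by simp
    also have "\<dots> \<le> (\<Sum>n. fps_nth V n)" by (rule sum_le_suminf) (use sV V0 in auto)
    finally show ?thesis by (simp add: eval_fps_def)
  qed
  have nz: "eval_fps (fps_complex V) z \<noteq> 0" if z: "norm z \<le> 1" for z :: complex
  proof (cases "z = 1")
    case True
    then show ?thesis using V1 eval_fps_complex_of_real[OF sV] by simp
  next
    case False
    have cB: "fps_complex ((1 - fps_X) * V) = 1 - fps_complex B"
      unfolding VB by (rule fps_ext) auto
    have "eval_fps (fps_complex (1 - fps_X)) z * eval_fps (fps_complex V) z = eval_fps (1 - fps_complex B) z"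
      unfolding cB[symmetric] fps_complex_mult
    proof (rule eval_fps_mult_l1[symmetric])
      show "summable (\<lambda>n. norm (fps_nth (fps_complex (1 - fps_X)) n))"
        by (rule summable_finite[of "{..1}"]) (auto simp: fps_X_def)
    qed (use sV z in auto)
    also have "\<dots> = eval_fps 1 z - eval_fps (fps_complex B) z"
    proof (rule eval_fps_diff_l1)
      show "summable (\<lambda>n. norm (fps_nth (1 :: complex fps) n))"
        by (rule summable_finite[of "{0}"]) auto
    qed (use sBn z in auto)
    also have "\<dots> = 1 - (\<Sum>n. of_real (fps_nth B n) * z ^ n)"
      by (simp add: eval_fps_def[of "fps_complex B"])
    also have "\<dots> \<noteq> 0" using nonneg_series_ne_1[OF B0 Bs Bpos z False] by simp
    finally show ?thesis by auto
  qed
  obtain m where m: "m > 0" "\<And>z. norm z \<le> 1 \<Longrightarrow> m < norm (eval_fps (fps_complex V) z)"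
  proof -
    have "continuous_on (cball 0 1) (\<lambda>z. norm (eval_fps (fps_complex V) z))"
      using continuous_on_l1_power_series[of "fps_complex V"] sV unfolding eval_fps_def by (intro continuous_on_norm) simp
    then obtain z0 where z0: "z0 \<in> cball 0 1" "\<And>z. z \<in> cball 0 1 \<Longrightarrow> norm (eval_fps (fps_complex V) z0) \<le> norm (eval_fps (fps_complex V) z)"
      using continuous_attains_inf[of "cball (0::complex) 1" "\<lambda>z. norm (eval_fps (fps_complex V) z)"] by auto
    have p: "norm (eval_fps (fps_complex V) z0) > 0" using nz z0 by simp
    show ?thesis
    proof (rule that[of "norm (eval_fps (fps_complex V) z0) / 2"])
      show "norm (eval_fps (fps_complex V) z0) / 2 > 0" using p by simp
      fix z :: complex assume "norm z \<le> 1"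
      then have "norm (eval_fps (fps_complex V) z0) \<le> norm (eval_fps (fps_complex V) z)" using z0(2) by simp
      then show "norm (eval_fps (fps_complex V) z0) / 2 < norm (eval_fps (fps_complex V) z)" using p by linarith
    qed
  qed
  obtain Y where Y: "Y > 1" "ereal Y < fps_conv_radius (fps_complex V)" "\<And>z. norm z \<le> Y \<Longrightarrow> m \<le> norm (eval_fps (fps_complex V) z)"
    by (rule eval_fps_lower_bound_larger_disc[OF radV1(1) m(2)]) (auto intro: that)
  define W where "W = inverse V"
  have Vnz: "fps_nth V 0 \<noteq> 0" using nz[of 0] by (simp add: eval_fps_at_0)
  have Wle: "\<bar>fps_nth W n\<bar> \<le> (1 / m) * (1 / Y) ^ n" for n
  proof -
    have "norm (fps_nth (inverse (fps_complex V) ^ 1) n) \<le> (1 / m) ^ 1 / Y ^ n"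
      by (rule fps_inverse_power_bound[OF _ Y(2) m(1) Y(3)]) (use Y in auto)
    moreover have "inverse (fps_complex V) = fps_complex W" unfolding W_def by (rule fps_complex_inverse[OF Vnz, symmetric])
    ultimately show ?thesis by (simp add: power_one_over)
  qed
  have sW: "summable (\<lambda>n. norm (fps_nth W n))"
    by (rule summable_comparison_test'[OF summable_mult[OF summable_geometric[of "1 / Y"], of "1 / m"]])
      (use Wle Y in auto)
  define w where "w = eval_fps W 1"
  have wV: "w * eval_fps V 1 = 1"
  proof -
    have "eval_fps (W * V) 1 = w * eval_fps V 1" unfolding w_def by (rule eval_fps_mult_l1[OF sW sV]) simp
    moreover have "W * V = 1" unfolding W_def using Vnz by (simp add: inverse_mult_eq_1)
    ultimately show ?thesis by simp
  qed
  have V1eq: "eval_fps V 1 = r * (\<Sum>n. fps_nth (fps_deriv A) n * r ^ n)"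
  proof -
    \<comment> \<open>Differentiating (1 - X) V = 1 - B and evaluating at 1, inside the disc of
      convergence of V, gives V(1) = B'(1) = r A'(r).\<close>
    have "fps_deriv ((1 - fps_X) * V) = - fps_deriv B" by (simp add: VB)
    then have "V = fps_deriv B + (1 - fps_X) * fps_deriv V" by (simp add: algebra_simps)
    moreover have rd: "fps_conv_radius (fps_deriv V) > 1"
      using fps_conv_radius_deriv[of V] radV1(2) by (metis less_le_trans)
    moreover have "fps_conv_radius (1 - fps_X :: real fps) = \<infinity>"
      using fps_conv_radius_diff[of 1 "fps_X :: real fps"] by simp
    ultimately have "eval_fps (V - (1 - fps_X) * fps_deriv V) 1 = eval_fps (fps_deriv B) 1" by (metis add_diff_cancel_right')
    moreover have "eval_fps ((1 - fps_X) * fps_deriv V) (1::real) = 0"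
      by (subst eval_fps_mult) (use rd \<open>fps_conv_radius (1 - fps_X) = \<infinity>\<close> in \<open>auto simp: one_ereal_def eval_fps_diff\<close>)
    moreover have "eval_fps (V - (1 - fps_X) * fps_deriv V) 1 = eval_fps V 1 - eval_fps ((1 - fps_X) * fps_deriv V) 1"
      by (rule eval_fps_diff) (use radV1 fps_conv_radius_mult[of "1 - fps_X" "fps_deriv V"] rd \<open>fps_conv_radius (1 - fps_X) = \<infinity>\<close> in \<open>auto simp: one_ereal_def\<close>)
    ultimately have e: "eval_fps V 1 = eval_fps (fps_deriv B) 1" by simp
    have t: "fps_nth (fps_deriv B) n = r * (fps_nth (fps_deriv A) n * r ^ n)" for n
      by (simp add: B_def mult_ac)
    have "summable (\<lambda>n. fps_nth (fps_deriv B) n)"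
    proof -
      have "fps_deriv B = V - (1 - fps_X) * fps_deriv V" using \<open>V = fps_deriv B + (1 - fps_X) * fps_deriv V\<close> by (metis add_diff_cancel_right')
      moreover have "fps_conv_radius (V - (1 - fps_X) * fps_deriv V) > 1"
        using fps_conv_radius_diff[of V "(1 - fps_X) * fps_deriv V"] fps_conv_radius_mult[of "1 - fps_X" "fps_deriv V"] radV1(2) rd \<open>fps_conv_radius (1 - fps_X) = \<infinity>\<close>
        by (auto simp: less_le_trans min_def split: if_splits)
      ultimately show ?thesis using summable_fps[of 1 "fps_deriv B"] by (simp add: one_ereal_def)
    qed
    then have "summable (\<lambda>n. fps_nth (fps_deriv A) n * r ^ n)" unfolding t using r by (subst (asm) summable_cmult_iff) auto
    then show ?thesis unfolding e unfolding eval_fps_def t power_one mult_1_right by (rule suminf_mult)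
  qed
  \<comment> \<open>The rescaled coefficients are the partial sums of W = 1 / V, which tend to W(1)
    = 1 / V(1) at a geometric rate.\<close>
  have Dn: "fps_nth (inverse (1 - A)) n * r ^ n = (\<Sum>k\<le>n. fps_nth W k)" for n
  proof -
    have "fps_nth (inverse (1 - A)) n * r ^ n = fps_nth (rescale r (inverse (1 - A))) n" by simp
    also have "rescale r (inverse (1 - A)) = inverse (1 - B)"
      by (subst rescale_inverse) (simp_all add: A rescale_diff B_def)
    also have "\<dots> = inverse (1 - fps_X) * W" by (simp add: VB[symmetric] fps_inverse_mult W_def)
    also have "inverse (1 - fps_X) = Abs_fps (\<lambda>_. 1 :: real)"
      unfolding fps_inverse_gp'[symmetric] by (rule fps_inverse_idempotent) simp
    also have "fps_nth (Abs_fps (\<lambda>_. 1) * W) n = (\<Sum>k\<le>n. fps_nth W k)"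
      by (subst mult.commute) (simp add: fps_mult_nth atLeast0AtMost)
    finally show ?thesis .
  qed
  define D where "D = (1 / m) / (Y - 1)"
  have tail: "\<bar>(\<Sum>k\<le>n. fps_nth W k) - w\<bar> \<le> D * (1 / Y) ^ n" for n
  proof -
    have "w = (\<Sum>k. fps_nth W (k + Suc n)) + (\<Sum>k\<le>n. fps_nth W k)"
      unfolding w_def eval_fps_def using suminf_split_initial_segment[OF summable_norm_cancel[OF sW], of "Suc n"]
      by (simp add: lessThan_Suc_atMost)
    then have "\<bar>(\<Sum>k\<le>n. fps_nth W k) - w\<bar> = norm (\<Sum>k. fps_nth W (k + Suc n))" by simp
    also have "\<dots> \<le> (\<Sum>k. ((1 / m) * (1 / Y) ^ Suc n) * (1 / Y) ^ k)"
    proof (rule norm_suminf_le)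
      show "summable (\<lambda>k. ((1 / m) * (1 / Y) ^ Suc n) * (1 / Y) ^ k)"
        using Y by (intro summable_mult summable_geometric) auto
      fix k show "norm (fps_nth W (k + Suc n)) \<le> ((1 / m) * (1 / Y) ^ Suc n) * (1 / Y) ^ k"
        using Wle[of "k + Suc n"] by (simp add: power_add mult_ac)
    qed
    also have "\<dots> = ((1 / m) * (1 / Y) ^ Suc n) * (1 / (1 - 1 / Y))"
      using Y by (subst suminf_mult) (auto intro!: summable_geometric simp: suminf_geometric)
    also have "\<dots> = D * (1 / Y) ^ n" using Y m by (simp add: D_def field_simps)
    finally show ?thesis .
  qed
  \<comment> \<open>The geometric mean of 1 / (r Y), the rate of the error, and 1 / r: any rate
    strictly between them turns the O bound into an o bound.\<close>
  define K where "K = 1 / (r * sqrt Y)"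
  have K: "0 < K" "K < 1 / r" using r Y by (auto simp: K_def divide_simps)
  have "(\<lambda>n. fps_nth (inverse (1 - A)) n - (1 / r) ^ n * w) \<in> O(\<lambda>n. (1 / (r * Y)) ^ n)"
  proof (rule bigoI[where c = D], rule always_eventually, rule allI)
    fix n
    have "fps_nth (inverse (1 - A)) n = (1 / r) ^ n * (\<Sum>k\<le>n. fps_nth W k)"
      unfolding Dn[symmetric] using r by (simp add: power_one_over)
    then have "fps_nth (inverse (1 - A)) n - (1 / r) ^ n * w = (1 / r) ^ n * ((\<Sum>k\<le>n. fps_nth W k) - w)"
      by (simp add: right_diff_distrib)
    then have "norm (fps_nth (inverse (1 - A)) n - (1 / r) ^ n * w) = (1 / r) ^ n * \<bar>(\<Sum>k\<le>n. fps_nth W k) - w\<bar>"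
      using r by (simp add: abs_mult)
    also have "\<dots> \<le> (1 / r) ^ n * (D * (1 / Y) ^ n)" using r by (intro mult_left_mono tail) auto
    also have "\<dots> = D * norm ((1 / (r * Y)) ^ n)" using r Y by (simp add: power_mult_distrib power_divide)
    finally show "norm (fps_nth (inverse (1 - A)) n - (1 / r) ^ n * w) \<le> D * norm ((1 / (r * Y)) ^ n)" .
  qed
  also have "(\<lambda>n. (1 / (r * Y)) ^ n) \<in> o(\<lambda>n. K ^ n)"
  proof (rule smalloI_tendsto)
    have "(\<lambda>n. (1 / sqrt Y) ^ n) \<longlonglongrightarrow> 0" using Y by (intro LIMSEQ_realpow_zero) auto
    moreover have "(1 / (r * Y)) ^ n / K ^ n = (1 / sqrt Y) ^ n" for n
    proof -
      have "(1 / (r * Y)) / K = 1 / sqrt Y" using r Y by (simp add: K_def field_simps)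
      then show ?thesis by (simp add: power_divide[symmetric])
    qed
    ultimately show "(\<lambda>n. (1 / (r * Y)) ^ n / K ^ n) \<longlonglongrightarrow> 0" by simp
    show "eventually (\<lambda>n. K ^ n \<noteq> 0) sequentially" using K by auto
  qed
  finally have "(\<lambda>n. fps_nth (inverse (1 - A)) n - (1 / r) ^ n * w) \<in> o(\<lambda>n. K ^ n)" .
  moreover have "w = 1 / (r * (\<Sum>n. fps_nth (fps_deriv A) n * r ^ n))"
  proof -
    have "eval_fps V 1 \<noteq> 0" using V1 by linarith
    then have "w = 1 / eval_fps V 1" using wV by (simp add: eq_divide_eq)
    then show ?thesis unfolding V1eq .
  qed
  ultimately show ?thesis using K by auto
qed

text \<open>As g sums to 0, its partial sums are the negatives of its tails, and a tail of terms of
  order 5/2 has order 3/2.\<close>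

lemma decay_partial_sums_zero_sum:
  fixes g :: "real fps"
  assumes g: "decay (5/2) g" and g1: "eval_fps g 1 = 0"
  shows "decay (3/2) (inverse (1 - fps_X) * g)"
proof -
  obtain G where G: "G > 0" "\<And>n. norm (fps_nth g n) \<le> G * (real n + 1) powr - (5/2)"
    using decayE[OF g] by blast
  have geo: "inverse (1 - fps_X) = Abs_fps (\<lambda>_. 1 :: real)"
    unfolding fps_inverse_gp'[symmetric] by (rule fps_inverse_idempotent) simp
  \<comment> \<open>The mean value theorem for x^(-3/2) replaces an integral comparison: it bounds
    the tail by a telescoping series.\<close>
  have step: "(y + 1) powr - (5/2) \<le> y powr - (3/2) - (y + 1) powr - (3/2)" if y: "y > 0" for y :: real
  proof -
    obtain z where z: "y < z" "z < y + 1"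
      "(y + 1) powr - (3/2) - y powr - (3/2) = (y + 1 - y) * (- (3/2) * z powr (- (3/2) - 1))"
      by (rule MVT2[of y "y + 1" "\<lambda>x. x powr - (3/2)" "\<lambda>x. - (3/2) * x powr (- (3/2) - 1)", THEN exE])
        (use y in \<open>auto intro!: derivative_eq_intros simp: divide_simps powr_diff\<close>)
    have "(y + 1) powr - (5/2) \<le> z powr - (5/2)" using y z by (intro powr_mono2') auto
    moreover have "z powr - (5/2) \<ge> 0" by simp
    moreover have "(y + 1) powr - (3/2) - y powr - (3/2) = - (3/2) * z powr - (5/2)" using z(3) by simp
    ultimately show ?thesis by linarith
  qed
  show ?thesis
  proof (rule decayI)
    fix n
    define f where "f j = (real n + 1 + real j) powr - (3/2)" for j
    have "f \<longlonglongrightarrow> 0" unfolding f_def by real_asymp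
    then have tel: "(\<lambda>j. f j - f (Suc j)) sums (f 0 - 0)" by (rule telescope_sums')
    have sg: "summable (\<lambda>n. fps_nth g n)" using decay_summable[OF g] by (simp add: summable_rabs_cancel)
    have "fps_nth (inverse (1 - fps_X) * g) n = (\<Sum>k\<le>n. fps_nth g k)"
      unfolding geo by (subst mult.commute) (simp add: fps_mult_nth atLeast0AtMost)
    also have "\<dots> = - (\<Sum>k. fps_nth g (k + Suc n))"
      using suminf_split_initial_segment[OF sg, of "Suc n"] g1 by (simp add: eval_fps_def lessThan_Suc_atMost)
    finally have "norm (fps_nth (inverse (1 - fps_X) * g) n) = norm (\<Sum>k. fps_nth g (k + Suc n))" by simp
    also have "\<dots> \<le> (\<Sum>j. G * (f j - f (Suc j)))"
    proof (rule norm_suminf_le)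
      show "summable (\<lambda>j. G * (f j - f (Suc j)))" by (intro summable_mult sums_summable[OF tel])
      fix j
      have "norm (fps_nth g (j + Suc n)) \<le> G * (real (j + Suc n) + 1) powr - (5/2)" by (rule G)
      also have "real (j + Suc n) + 1 = (real n + 1 + real j) + 1" by simp
      also have "((real n + 1 + real j) + 1) powr - (5/2) \<le> (real n + 1 + real j) powr - (3/2) - ((real n + 1 + real j) + 1) powr - (3/2)"
        by (rule step) simp
      also have "\<dots> = f j - f (Suc j)" by (simp add: f_def add_ac)
      finally show "norm (fps_nth g (j + Suc n)) \<le> G * (f j - f (Suc j))" using G(1) by simp
    qed
    also have "\<dots> = G * (f 0 - 0)" using sums_unique[OF sums_mult[OF tel, of G]] by simp
    finally show "norm (fps_nth (inverse (1 - fps_X) * g) n) \<le> G * (real n + 1) powr - (3/2)" by (simp add: f_def)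
  qed
qed

text \<open>Here V = (1 - Q) / s is invertible in the class of series with coefficients O(n^(-3/2)), and
  1 / (1 - Q) = r / eta + h / (eta V) with h = g / (1 - X), r = 1 / s and 1 - Q = eta s - g.\<close>

lemma square_root_pole:
  fixes Q :: "real fps"
  assumes cl: "sqrt_class (- \<eta>) Q" and \<eta>: "\<eta> > 0"
    and Q: "\<And>n. fps_nth Q n \<ge> 0" "fps_nth Q sums 1" and pos: "\<And>n. n \<ge> N \<Longrightarrow> fps_nth Q n > 0"
    and Q0: "fps_nth Q 0 = 0"
  shows "decay (3/2) (inverse (1 - Q) - fps_const (1 / \<eta>) * inv_sqrt_fps)"
proof -
  define g where "g = Q - 1 + fps_const \<eta> * sqrt_fps"
  have dQ: "decay (3/2) Q" by (rule sqrt_class_decay[OF cl])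
  have "g = (Q - fps_const (- \<eta>) * sqrt_fps) - 1"
    by (rule fps_ext) (simp add: g_def)
  then have dg: "decay (5/2) g"
    using cl unfolding sqrt_class_def by (simp only:) (rule decay_diff[OF _ decay_1])
  have Qeq: "1 - Q = fps_const \<eta> * sqrt_fps - g" by (simp add: g_def)
  have eQ: "eval_fps Q 1 = 1" using sums_unique[OF Q(2)] by (simp add: eval_fps_def)
  have eg: "eval_fps g 1 = 0"
  proof -
    have "eval_fps g 1 = eval_fps (Q - 1) 1 + eval_fps (fps_const \<eta> * sqrt_fps) 1"
      unfolding g_def by (rule eval_fps_add_decay[OF decay_diff[OF dQ decay_1] _ decay_cmult[OF decay_sqrt_fps]]) auto
    also have "eval_fps (Q - 1) 1 = eval_fps Q 1 - eval_fps 1 1"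
      by (rule eval_fps_diff_decay[OF dQ _ decay_1[of 2]]) auto
    also have "eval_fps (fps_const \<eta> * sqrt_fps) 1 = eval_fps (fps_const \<eta>) 1 * eval_fps sqrt_fps 1"
      by (rule eval_fps_mult_decay[OF decay_const[of 2] _ decay_sqrt_fps]) auto
    finally show ?thesis by (simp add: eQ eval_sqrt_fps_1)
  qed
  define h where "h = inverse (1 - fps_X) * g"
  have dh: "decay (3/2) h" unfolding h_def by (rule decay_partial_sums_zero_sum[OF dg eg])
  have "(1 - fps_X) * inverse (1 - fps_X) = (1 :: real fps)" by (rule inverse_mult_eq_1') simp
  then have hg: "(1 - fps_X) * h = g" unfolding h_def by (simp add: mult.assoc[symmetric])
  define V where "V = fps_const \<eta> - sqrt_fps * h"
  have sV: "sqrt_fps * V = 1 - Q"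
    unfolding V_def Qeq right_diff_distrib mult.assoc[symmetric] sqrt_fps_square hg by (simp add: mult.commute)
  have dV: "decay (3/2) V" unfolding V_def by (intro decay_diff decay_const decay_mult decay_sqrt_fps dh) simp
  have eV: "eval_fps V 1 = \<eta>"
  proof -
    have "eval_fps V 1 = eval_fps (fps_const \<eta>) 1 - eval_fps (sqrt_fps * h) 1"
      unfolding V_def by (rule eval_fps_diff_decay[OF decay_const[of 2] _ decay_mult[OF decay_sqrt_fps dh]]) auto
    also have "eval_fps (sqrt_fps * h) 1 = eval_fps sqrt_fps 1 * eval_fps h 1"
      by (rule eval_fps_mult_decay[OF decay_sqrt_fps _ dh]) auto
    finally show ?thesis by (simp add: eval_sqrt_fps_1)
  qed
  have dc: "decay (3/2) (fps_complex f)" if "decay (3/2) f" for f using that by (simp add: decay_def)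
  \<comment> \<open>Away from 1 the product s V = 1 - Q does not vanish. At 1 it does, through s, so
    the value V(1) = \<eta> has to be known separately.\<close>
  have nz: "eval_fps (fps_complex V) z \<noteq> 0" if z: "norm z \<le> 1" for z :: complex
  proof (cases "z = 1")
    case True
    then show ?thesis using eval_fps_complex_of_real[of V] decay_summable[OF dV] eV \<eta> by simp
  next
    case False
    have cQ: "fps_complex (1 - Q) = 1 - fps_complex Q" by (rule fps_ext) auto
    have "eval_fps (fps_complex sqrt_fps) z * eval_fps (fps_complex V) z = eval_fps (fps_complex sqrt_fps * fps_complex V) z"
      by (rule eval_fps_mult_decay[OF dc[OF decay_sqrt_fps] _ dc[OF dV], symmetric]) (use z in auto)
    also have "fps_complex sqrt_fps * fps_complex V = 1 - fps_complex Q"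
      unfolding fps_complex_mult[symmetric] sV by (rule cQ)
    also have "eval_fps (1 - fps_complex Q) z = eval_fps 1 z - eval_fps (fps_complex Q) z"
      by (rule eval_fps_diff_decay[OF decay_1[of 2] _ dc[OF dQ]]) (use z in auto)
    also have "\<dots> = 1 - (\<Sum>n. of_real (fps_nth Q n) * z ^ n)" by (simp add: eval_fps_def[of "fps_complex Q"])
    also have "\<dots> \<noteq> 0" using nonneg_series_ne_1[OF Q pos z False] by simp
    finally show ?thesis by auto
  qed
  have dW: "decay (3/2) (inverse V)"
    by (rule decay_inverse[OF dV]) (use nz in \<open>auto simp: eval_fps_def\<close>)
  have V0: "fps_nth V 0 \<noteq> 0" using nz[of 0] by (simp add: eval_fps_at_0)
  have VV: "V * inverse V = 1" using V0 by (simp add: inverse_mult_eq_1')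
  have inv: "inverse (1 - Q) = inv_sqrt_fps * inverse V"
  proof (rule fps_inverse_unique)
    have "(1 - Q) * (inv_sqrt_fps * inverse V) = (sqrt_fps * inv_sqrt_fps) * (V * inverse V)"
      unfolding sV[symmetric] by (simp only: mult_ac)
    then show "(1 - Q) * (inv_sqrt_fps * inverse V) = 1" by (simp add: sqrt_fps_mult_inv VV)
  qed
  have "inv_sqrt_fps * inverse V - fps_const (1 / \<eta>) * inv_sqrt_fps = fps_const (1 / \<eta>) * (h * inverse V)"
  proof -
    have "fps_const (1 / \<eta>) * (h * inverse V) = fps_const (1 / \<eta>) * ((sqrt_fps * inv_sqrt_fps) * h * inverse V)"
      by (simp add: sqrt_fps_mult_inv)
    also have "\<dots> = fps_const (1 / \<eta>) * (inv_sqrt_fps * ((sqrt_fps * h) * inverse V))" by (simp only: mult_ac)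
    also have "sqrt_fps * h = fps_const \<eta> - V" by (simp add: V_def)
    also have "(fps_const \<eta> - V) * inverse V = fps_const \<eta> * inverse V - 1" by (simp add: left_diff_distrib VV)
    also have "fps_const (1 / \<eta>) * (inv_sqrt_fps * (fps_const \<eta> * inverse V - 1))
       = (fps_const (1 / \<eta>) * fps_const \<eta>) * (inv_sqrt_fps * inverse V) - fps_const (1 / \<eta>) * inv_sqrt_fps"
      by (simp add: right_diff_distrib mult_ac del: fps_const_mult)
    also have "fps_const (1 / \<eta>) * fps_const \<eta> = 1" using \<eta> by simp
    finally show ?thesis by simp
  qed
  also have "decay (3/2) \<dots>" by (intro decay_cmult decay_mult dh dW) simp
  finally show ?thesis unfolding inv .
qed

text \<open>The regular part g has a finite first moment, so 1 - x^n <= n (1 - x) makes it Lipschitz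
  at 1.\<close>

lemma sqrt_class_puiseux:
  assumes cl: "sqrt_class (- \<eta>) Q"
  obtains K where "\<And>x. 0 \<le> x \<Longrightarrow> x \<le> 1 \<Longrightarrow> \<bar>eval_fps Q x - (eval_fps Q 1 - \<eta> * sqrt (1 - x))\<bar> \<le> K * (1 - x)"
proof -
  define g where "g = Q - fps_const (- \<eta>) * sqrt_fps"
  have dg: "decay (5/2) g" using cl by (simp add: sqrt_class_def g_def)
  have Q: "Q = g + fps_const (- \<eta>) * sqrt_fps" by (simp add: g_def)
  have ev: "eval_fps Q x = eval_fps g x - \<eta> * sqrt (1 - x)" if "0 \<le> x" "x \<le> 1" for x
  proof -
    have "eval_fps Q x = eval_fps g x + eval_fps (fps_const (- \<eta>) * sqrt_fps) x"
      by (subst Q, rule eval_fps_add_decay[OF dg _ decay_cmult[OF decay_sqrt_fps]]) (use that in auto)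
    also have "eval_fps (fps_const (- \<eta>) * sqrt_fps) x = eval_fps (fps_const (- \<eta>)) x * eval_fps sqrt_fps x"
      by (rule eval_fps_mult_decay[OF decay_const[of 2] _ decay_sqrt_fps]) (use that in auto)
    finally show ?thesis using that by (simp add: eval_sqrt_fps)
  qed
  have sg: "summable (\<lambda>n. real n * \<bar>fps_nth g n\<bar>)" using decay_summable_of_nat[OF dg] by simp
  have sg0: "summable (\<lambda>n. norm (fps_nth g n))" using decay_summable[OF dg] by simp
  show ?thesis
  proof (rule that)
    fix x :: real assume x: "0 \<le> x" "x \<le> 1"
    have s1: "summable (\<lambda>n. fps_nth g n * y ^ n)" if "0 \<le> y" "y \<le> 1" for y :: real
      by (rule summable_norm_cancel[OF summable_l1_power_series[OF sg0]]) (use that in auto)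
    have "eval_fps Q x - (eval_fps Q 1 - \<eta> * sqrt (1 - x)) = eval_fps g x - eval_fps g 1"
      using ev[OF x] ev[of 1] by simp
    also have "\<dots> = (\<Sum>n. fps_nth g n * x ^ n - fps_nth g n * 1 ^ n)"
      unfolding eval_fps_def by (rule suminf_diff[OF s1[OF x] s1]) auto
    also have "norm \<dots> \<le> (\<Sum>n. real n * \<bar>fps_nth g n\<bar> * (1 - x))"
    proof (rule norm_suminf_le[OF _ summable_mult2[OF sg]], unfold real_norm_def)
      fix n
      have "1 + real n * (x - 1) \<le> (1 + (x - 1)) ^ n" using x by (intro Bernoulli_inequality) auto
      then have "1 - x ^ n \<le> real n * (1 - x)" by (simp add: algebra_simps)
      moreover have "x ^ n \<le> 1" using x by (intro power_le_one)
      ultimately have "\<bar>x ^ n - 1\<bar> \<le> real n * (1 - x)" by simp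
      then have "\<bar>fps_nth g n\<bar> * \<bar>x ^ n - 1\<bar> \<le> \<bar>fps_nth g n\<bar> * (real n * (1 - x))" by (intro mult_left_mono) auto
      then show "\<bar>fps_nth g n * x ^ n - fps_nth g n * 1 ^ n\<bar> \<le> real n * \<bar>fps_nth g n\<bar> * (1 - x)"
        by (simp add: abs_mult[symmetric] algebra_simps)
    qed
    also have "\<dots> = (\<Sum>n. real n * \<bar>fps_nth g n\<bar>) * (1 - x)" by (rule suminf_mult2[OF sg, symmetric])
    finally have "norm (eval_fps Q x - (eval_fps Q 1 - \<eta> * sqrt (1 - x))) \<le> (\<Sum>n. real n * \<bar>fps_nth g n\<bar>) * (1 - x)" .
    then show "\<bar>eval_fps Q x - (eval_fps Q 1 - \<eta> * sqrt (1 - x))\<bar> \<le> (\<Sum>n. real n * \<bar>fps_nth g n\<bar>) * (1 - x)" by simp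
  qed
qed

lemma powr_minus_five_halves:
  assumes "n \<ge> 1" shows "real n powr - (5/2) = 1 / ((real n)\<^sup>2 * sqrt (real n))"
proof -
  have "real n powr (- (3/2) + - 1) = real n powr - (3/2) * real n powr - 1" by (rule powr_add)
  also have "real n powr - 1 = 1 / real n" using assms by (simp add: powr_minus_divide)
  finally show ?thesis using assms by (simp add: powr_minus_three_halves power2_eq_square mult_ac)
qed

text \<open>With r_n the coefficient of (1 - X)^(-1/2), the coefficient of \<open>sqrt_fps\<close>
  is - r_n / (2 n - 1). Replacing 2 n - 1 by 2 n and r_n by 1 / sqrt (pi n) costs a relative error
  O(1/n) each.\<close>

lemma sqrt_fps_approx:
  assumes n: "n \<ge> 1"
  shows "\<bar>- fps_nth sqrt_fps n - 1 / (2 * sqrt (pi * real n ^ 3))\<bar> \<le> 1 / ((real n)\<^sup>2 * sqrt (real n))"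
proof -
  obtain m where m: "n = Suc m" using n by (cases n) auto
  define r where "r = fps_nth inv_sqrt_fps n"
  define a where "a = 1 / sqrt (pi * real n)"
  have s: "- fps_nth sqrt_fps n = r / (2 * real n - 1)"
    unfolding r_def m sqrt_fps_Suc inv_sqrt_fps_Suc by (simp add: divide_simps)
  have t: "1 / (2 * sqrt (pi * real n ^ 3)) = a / (2 * real n)"
  proof -
    have "sqrt (pi * real n ^ 3) = real n * sqrt (pi * real n)"
      by (simp add: real_sqrt_mult power3_eq_cube)
    then show ?thesis by (simp add: a_def)
  qed
  have r0: "r > 0" unfolding r_def by (rule inv_sqrt_fps_pos)
  have r1: "r \<le> 1 / sqrt (real n)"
  proof -
    have "r\<^sup>2 \<le> 1 / (pi * real n)" unfolding r_def using n by (intro inv_sqrt_fps_bounds) auto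
    also have "\<dots> \<le> 1 / real n" using n pi_ge_two by (intro divide_left_mono) auto
    finally show ?thesis using real_le_rsqrt by (metis real_sqrt_divide real_sqrt_one)
  qed
  have ra: "\<bar>r - a\<bar> \<le> 1 / (real n * sqrt (real n))"
    unfolding r_def a_def powr_minus_three_halves[OF n, symmetric] by (rule inv_sqrt_fps_approx) (use n in auto)
  have q: "0 \<le> 1 / (2 * real n - 1) - 1 / (2 * real n)" "1 / (2 * real n - 1) - 1 / (2 * real n) \<le> 1 / (2 * (real n)\<^sup>2)"
    using n by (auto simp: divide_simps power2_eq_square algebra_simps)
  have "r / (2 * real n - 1) - a / (2 * real n) = r * (1 / (2 * real n - 1) - 1 / (2 * real n)) + (r - a) / (2 * real n)"
    by (simp add: right_diff_distrib diff_divide_distrib)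
  also have "\<bar>\<dots>\<bar> \<le> 1 / sqrt (real n) * (1 / (2 * (real n)\<^sup>2)) + 1 / (real n * sqrt (real n)) / (2 * real n)"
  proof (intro order.trans[OF abs_triangle_ineq] add_mono)
    show "\<bar>r * (1 / (2 * real n - 1) - 1 / (2 * real n))\<bar> \<le> 1 / sqrt (real n) * (1 / (2 * (real n)\<^sup>2))"
      unfolding abs_mult using r0 r1 q by (intro mult_mono) auto
    show "\<bar>(r - a) / (2 * real n)\<bar> \<le> 1 / (real n * sqrt (real n)) / (2 * real n)"
    proof -
      have "\<bar>(r - a) / (2 * real n)\<bar> = \<bar>r - a\<bar> / (2 * real n)" by simp
      also have "\<dots> \<le> 1 / (real n * sqrt (real n)) / (2 * real n)" by (intro divide_right_mono ra) auto
      finally show ?thesis .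
    qed
  qed
  also have "\<dots> = 1 / ((real n)\<^sup>2 * sqrt (real n))"
    using n by (simp add: power2_eq_square field_simps)
  finally show ?thesis unfolding s t .
qed

section \<open>The location of rho_0 and the simple pole\<close>

context catastrophe_walk
begin

lemma sums_1_unique:
  assumes "0 < x" "(\<lambda>n. qn n * x ^ n) sums 1" "0 < y" "(\<lambda>n. qn n * y ^ n) sums 1"
  shows "x = y"
proof -
  have *: False if "0 < x" "(\<lambda>n. qn n * x ^ n) sums 1" "x < y" "(\<lambda>n. qn n * y ^ n) sums 1" for x y
  proof -
    have s: "(\<lambda>n. qn n * y ^ n - qn n * x ^ n) sums (1 - 1)" by (intro sums_diff that)
    have "0 < (\<Sum>n. qn n * y ^ n - qn n * x ^ n)"
    proof (rule suminf_pos2[OF sums_summable[OF s]])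
      show "0 \<le> qn n * y ^ n - qn n * x ^ n" for n
        unfolding right_diff_distrib[symmetric] using that by (intro mult_nonneg_nonneg qn_nonneg) (auto intro: power_mono)
      show "0 < qn (c + 2) * y ^ (c + 2) - qn (c + 2) * x ^ (c + 2)"
      proof -
        have "x ^ (c + 2) < y ^ (c + 2)" using that by (intro power_strict_mono) auto
        then show ?thesis unfolding right_diff_distrib[symmetric] by (intro mult_pos_pos qn_pos) auto
      qed
    qed
    then show False using sums_unique[OF s] by simp
  qed
  show ?thesis using *[of x y] *[of y x] assms by (cases x y rule: linorder_cases) auto
qed

text \<open>Q is strictly increasing, so \<open>rho0_set\<close> has at most one point and the
  infimum in \<open>rho0\<close> is that point.\<close>

lemma rho0_eqI:
  assumes "z \<in> rho0_set p q"
  shows "rho0 p q = z"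
proof -
  have "rho0_set p q = {z}" using assms sums_1_unique[of _ z] by (auto simp: rho0_set_def)
  then show ?thesis by (simp add: rho0_def)
qed

lemma rho0_in_set: "rho0_exists p q \<Longrightarrow> rho0 p q \<in> rho0_set p q"
  using rho0_eqI unfolding rho0_exists_def by (metis ex_in_conv)

text \<open>Divergence at 1 / P(1) makes some partial sum exceed 1 there, so Q takes the value 1
  strictly before.\<close>

lemma rho0_drift_nonneg:
  assumes "drift p \<ge> 0"
  obtains z where "z \<in> rho0_set p q" "z < 1 / jumpP p 1"
proof -
  define K where "K = 1 / jumpP p 1"
  have K: "K > 0" "K \<le> rho p" using jumpP_pos[of 1] rho_ge by (simp_all add: K_def)
  have "\<exists>N. (\<Sum>n<N. qn n * K ^ n) > 1"
  proof (rule ccontr)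
    assume "\<not> ?thesis"
    then have "(\<Sum>n<N. qn n * K ^ n) \<le> 1" for N by (simp add: not_less)
    then have "summable (\<lambda>n. qn n * K ^ n)"
      using K qn_nonneg by (intro summableI_nonneg_bounded[where x = 1]) auto
    then show False using not_summable_drift_nonneg[OF assms] by (simp add: K_def)
  qed
  then obtain N where N: "(\<Sum>n<N. qn n * K ^ n) > 1" by blast
  obtain z where "0 < z" "z < K" "(\<lambda>n. qn n * z ^ n) sums 1"
  proof (rule nonneg_series_crosses_1[OF qn_nonneg Qfps_0 K(1) _ N])
    fix y assume y: "0 < y" "y < K"
    then have "y * jumpP p 1 < 1" using jumpP_pos[of 1] by (simp add: K_def field_simps)
    then show "summable (\<lambda>n. qn n * y ^ n)" using y by (intro summable_qn[of 1]) auto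
  qed
  then show ?thesis using that[of z] K by (simp add: rho0_set_def K_def)
qed

lemma drift_neg:
  assumes "(rho0_exists p q \<and> rho0 p q = rho p) \<or> \<not> rho0_exists p q"
  shows "drift p < 0"
proof (rule ccontr)
  assume "\<not> ?thesis"
  then obtain z where z: "z \<in> rho0_set p q" "z < 1 / jumpP p 1" using rho0_drift_nonneg by (auto simp: not_less)
  then have "rho0 p q < rho p" using rho_ge rho0_eqI by simp
  moreover have "rho0_exists p q" using z by (auto simp: rho0_exists_def)
  ultimately show False using assms by simp
qed

text \<open>Convergence beyond rho_0 is needed, and \<open>Mall_le\<close> offers only u >= 1. For
  negative drift u = tau reaches up to rho; otherwise u = 1 reaches up to 1 / P(1), and rho_0 lies
  strictly before that.\<close>

lemma subcritical_pole:
  assumes ex: "rho0_exists p q" and lt: "rho0 p q < rho p"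
  shows "\<exists>K. 0 < K \<and> K < 1 / rho0 p q \<and>
    (\<lambda>n. fps_nth (Dfps p q) n - (1 / rho0 p q) ^ n / (rho0 p q * Qder p q (rho0 p q))) \<in> o(\<lambda>n. K ^ n)"
proof -
  define r where "r = rho0 p q"
  have r: "r > 0" "(\<lambda>n. qn n * r ^ n) sums 1" using rho0_in_set[OF ex] by (auto simp: rho0_set_def r_def)
  have "\<exists>R>r. summable (\<lambda>n. qn n * R ^ n)"
  proof (cases "drift p < 0")
    case True
    define R where "R = (r + rho p) / 2"
    have R: "r < R" "R < rho p" using lt by (auto simp: R_def r_def)
    have "R * jumpP p (tau p) < 1"
      using R(2) jumpP_pos[OF tau(1)] by (simp add: rho_def field_simps)
    then have "summable (\<lambda>n. qn n * R ^ n)"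
      using tau_gt_1[OF True] R r by (intro summable_qn[of "tau p"]) auto
    then show ?thesis using R by blast
  next
    case False
    then have dr: "drift p \<ge> 0" by simp
    obtain z where z: "z \<in> rho0_set p q" "z < 1 / jumpP p 1" using rho0_drift_nonneg[OF dr] by blast
    then have rz: "r < 1 / jumpP p 1" using rho0_eqI by (simp add: r_def)
    define R where "R = (r + 1 / jumpP p 1) / 2"
    have R: "r < R" "R < 1 / jumpP p 1" using rz by (auto simp: R_def)
    have "R * jumpP p 1 < 1" using R(2) jumpP_pos[of 1] by (simp add: field_simps)
    then have "summable (\<lambda>n. qn n * R ^ n)" using R r by (intro summable_qn[of 1]) auto
    then show ?thesis using R by blast
  qed
  then obtain R where R: "R > r" "summable (\<lambda>n. qn n * R ^ n)" by blast
  show ?thesis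
    using simple_pole_coefficients[OF qn_nonneg Qfps_0 qn_pos r R] by (simp only: r_def Dfps_def Qder_def)
qed

end

section \<open>The two square-root cases\<close>

locale catastrophe_gf = aperiodic_weights + catastrophe_walk
begin

definition Qr :: "real fps" where "Qr = rescale (rho p) (Qfps p q)"

lemma Qr_nth: "fps_nth Qr n = qn n * rho p ^ n" by (simp add: Qr_def)

lemma Qr_class:
  assumes "drift p < 0"
  shows "\<exists>b. sqrt_class b Qr"
proof -
  define S where "S = {j::int. j > 0 \<and> - j \<in> jumps p}"
  have X: "rescale (rho p) (fps_X * fps_const q) = fps_const (rho p * q) * fps_X"
    by (rule fps_ext) (simp add: fps_X_def)
  have Qr: "Qr = fps_const (rho p * q) * (fps_X * (all_gf - meander_gf 0 - (\<Sum>j\<in>S. meander_gf j)))"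
    unfolding Qr_def Qfps_def rescale_mult[of _ "fps_X * fps_const q"] X
    by (simp add: rescale_diff rescale_sum all_gf_def meander_gf_def Efps_def S_def mult.assoc)
  obtain b1 where b1: "sqrt_class b1 all_gf" using all_gf_class[OF tau_gt_1[OF assms]] by blast
  obtain b2 where b2: "sqrt_class b2 (meander_gf 0)" using meander_gf_0_class by blast
  have "\<exists>b. sqrt_class b (\<Sum>j\<in>S. meander_gf j)"
  proof (rule sqrt_class_sum)
    fix j assume "j \<in> S"
    then have "j = int (nat j)" by (simp add: S_def)
    then show "\<exists>b. sqrt_class b (meander_gf j)" using meander_gf_class by metis
  qed
  then obtain b3 where b3: "sqrt_class b3 (\<Sum>j\<in>S. meander_gf j)" by blast
  show ?thesis unfolding Qr
    using sqrt_class_cmult[OF sqrt_class_X_mult[OF sqrt_class_diff[OF sqrt_class_diff[OF b1 b2] b3]]] by blast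
qed

lemma walk_count_0_lower:
  obtains a n0 where "a > 0" "n0 \<ge> 1" "\<And>n. n \<ge> n0 \<Longrightarrow> a / sqrt (real n) \<le> walk_count n 0 * rho p ^ n"
proof -
  obtain C where C: "C \<ge> 0" "\<And>n k. n \<ge> 1 \<Longrightarrow>
    \<bar>walk_count n k * rho p ^ n - tau p powi (- k) * (amp * fps_nth inv_sqrt_fps n)\<bar>
      \<le> tau p powi (- k) * (C * (1 + (of_int k)\<^sup>2)) / (real n * sqrt (real n))"
    by (rule walk_count_inv_sqrt) (rule that)
  define e where "e = amp / sqrt (2 * pi)"
  have e: "e > 0" using amp_pos by (simp add: e_def)
  \<comment> \<open>From \<open>n0\<close> on the error C / (n sqrt n) is at most half of the lower
    bound e / sqrt n for the main term.\<close>
  define n0 where "n0 = max 1 (nat \<lceil>2 * C / e\<rceil>)"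
  show ?thesis
  proof (rule that[of "e / 2" n0])
    fix n assume n: "n \<ge> n0"
    then have n1: "n \<ge> 1" by (simp add: n0_def)
    have "2 * C / e \<le> real n" using n by (simp add: n0_def nat_le_iff ceiling_le_iff)
    then have Cn: "C / real n \<le> e / 2" using e n1 by (simp add: field_simps)
    have "1 / sqrt (2 * pi * real n) \<le> fps_nth inv_sqrt_fps n"
    proof (rule power2_le_imp_le)
      have "(1 / sqrt (2 * pi * real n))\<^sup>2 = 1 / (2 * pi * real n)" by (simp add: power_divide)
      also have "\<dots> \<le> 1 / (pi * (real n + 1/2))"
        using n1 by (intro divide_left_mono) (auto simp: mult_ac intro!: mult_left_mono)
      also have "\<dots> \<le> (fps_nth inv_sqrt_fps n)\<^sup>2" using n1 by (intro inv_sqrt_fps_bounds) auto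
      finally show "(1 / sqrt (2 * pi * real n))\<^sup>2 \<le> (fps_nth inv_sqrt_fps n)\<^sup>2" .
    qed (use inv_sqrt_fps_pos[of n] in simp)
    then have "amp * (1 / sqrt (2 * pi * real n)) \<le> amp * fps_nth inv_sqrt_fps n" using amp_pos by (intro mult_left_mono) auto
    moreover have "amp * (1 / sqrt (2 * pi * real n)) = e / sqrt (real n)" by (simp add: e_def real_sqrt_mult)
    ultimately have 1: "e / sqrt (real n) \<le> amp * fps_nth inv_sqrt_fps n" by simp
    have 2: "\<bar>walk_count n 0 * rho p ^ n - amp * fps_nth inv_sqrt_fps n\<bar> \<le> C / (real n * sqrt (real n))"
      using C(2)[OF n1, of 0] by simp
    have "C / (real n * sqrt (real n)) = (C / real n) / sqrt (real n)" by simp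
    also have "\<dots> \<le> (e / 2) / sqrt (real n)" by (intro divide_right_mono Cn) simp
    finally have "e / sqrt (real n) - (e / 2) / sqrt (real n) \<le> walk_count n 0 * rho p ^ n" using 1 2 by linarith
    then show "(e / 2) / sqrt (real n) \<le> walk_count n 0 * rho p ^ n" by (simp add: field_simps)
  qed (use e in \<open>auto simp: n0_def\<close>)
qed

text \<open>The coefficients of s from index 1 on are negative, so b >= 0 would leave the
  coefficients of Q at most O(n^(-5/2)), while the excursions contribute at least a multiple of
  n^(-3/2). The strict sign is needed because eta is a denominator in one case and a factor of the
  leading term in the other.\<close>

lemma Qr_class_neg:
  assumes "sqrt_class b Qr"
  shows "b < 0"
proof (rule ccontr)
  assume "\<not> b < 0"
  then have b: "b \<ge> 0" by simp
  obtain C where C: "C > 0" "\<And>n. norm (fps_nth (Qr - fps_const b * sqrt_fps) n) \<le> C * (real n + 1) powr - (5/2)"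
    using decayE[OF assms[unfolded sqrt_class_def]] by blast
  obtain a n0 where a: "a > 0" "n0 \<ge> 1" "\<And>n. n \<ge> n0 \<Longrightarrow> a / sqrt (real n) \<le> walk_count n 0 * rho p ^ n"
    by (rule walk_count_0_lower) (rule that)
  \<comment> \<open>The extra length: c + 1 jumps by d and the final catastrophe.\<close>
  define s where "s = Suc (c + 1)"
  define \<kappa> where "\<kappa> = q * p (int d) ^ (c + 1) * rho p ^ s"
  have \<kappa>: "\<kappa> > 0" using q_pos p_d_pos rho_pos by (simp add: \<kappa>_def)
  have main: "\<kappa> * a * real n \<le> C" if n: "n \<ge> n0" for n
  proof -
    have n1: "n \<ge> 1" using n a(2) by simp
    \<comment> \<open>The single term m = n of Spitzer's identity: free walks returning to 0 weigh
      at most n times the excursions of the same length.\<close>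
    have "walk_count n 0 \<le> real n * meander_count p n 0"
    proof -
      have "walk_count n 0 = (\<Sum>i\<in>{0..0}. walk_count n i * meander_count p (n - n) (0 - i))"
        by (simp add: meander_count_0)
      also have "\<dots> \<le> (\<Sum>m=1..n. \<Sum>i\<in>{0..0}. walk_count m i * meander_count p (n - m) (0 - i))"
        by (rule member_le_sum) (use n1 in \<open>auto intro!: mult_nonneg_nonneg walk_count_nonneg meander_count_nonneg\<close>)
      also have "\<dots> = real n * meander_count p n 0" using spitzer_identity[of 0 n] by simp
      finally show ?thesis .
    qed
    then have "a / sqrt (real n) \<le> (real n * meander_count p n 0) * rho p ^ n"
      using a(3)[OF n] rho_pos by (auto intro: order.trans mult_right_mono)
    then have "a / sqrt (real n) / real n \<le> meander_count p n 0 * rho p ^ n"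
      using n1 by (simp add: field_simps)
    then have "\<kappa> * (a / sqrt (real n) / real n) \<le> \<kappa> * (meander_count p n 0 * rho p ^ n)"
      using \<kappa> by (intro mult_left_mono) auto
    also have "\<dots> = (q * p (int d) ^ (c + 1) * meander_count p n 0) * rho p ^ (n + s)"
      by (simp add: \<kappa>_def power_add)
    also have "\<dots> \<le> qn (n + s) * rho p ^ (n + s)"
      using qn_lower[of n] rho_pos by (intro mult_right_mono) (auto simp: s_def)
    also have "\<dots> = fps_nth Qr (n + s)" by (simp add: Qr_nth)
    also have "\<dots> \<le> b * fps_nth sqrt_fps (n + s) + C * (real (n + s) + 1) powr - (5/2)"
      using C(2)[of "n + s"] by (simp add: abs_le_iff)
    also have "\<dots> \<le> C * (real (n + s) + 1) powr - (5/2)"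
      using b inv_sqrt_fps_pos[of "n + (c + 1)"] by (simp add: s_def sqrt_fps_Suc mult_nonneg_nonpos divide_nonpos_pos)
    also have "\<dots> \<le> C * real n powr - (5/2)" using C(1) n1 by (intro mult_left_mono powr_mono2') auto
    also have "real n powr - (5/2) = 1 / (real n * (real n * sqrt (real n)))"
      by (simp add: powr_minus_five_halves[OF n1] power2_eq_square mult.assoc)
    finally have "\<kappa> * (a / sqrt (real n) / real n) * (real n * (real n * sqrt (real n))) \<le> C * (1 / (real n * (real n * sqrt (real n)))) * (real n * (real n * sqrt (real n)))"
      by (intro mult_right_mono) auto
    then show ?thesis using n1 by simp
  qed
  define n where "n = max n0 (nat \<lceil>C / (\<kappa> * a)\<rceil> + 1)"
  have "C / (\<kappa> * a) < real n" unfolding n_def by linarith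
  then have "C < \<kappa> * a * real n" using \<kappa> a by (simp add: divide_less_eq mult_ac)
  then show False using main[of n] by (simp add: n_def)
qed

lemma puiseux_Qr:
  assumes "sqrt_class (- \<eta>) Qr"
  shows "puiseux_eta p q \<eta>" "summable (fps_nth Qr)" "Qfun p q (rho p) = eval_fps Qr 1"
proof -
  have s: "summable (\<lambda>n. norm (fps_nth Qr n))" by (rule decay_summable[OF sqrt_class_decay[OF assms]]) simp
  then show sm: "summable (fps_nth Qr)" by (rule summable_norm_cancel)
  have Qf: "Qfun p q z = eval_fps Qr (z / rho p)" for z
    using rho_pos by (simp add: Qfun_def eval_fps_def Qr_nth power_divide)
  show "Qfun p q (rho p) = eval_fps Qr 1" using rho_pos by (simp add: Qf)
  obtain K where K: "\<And>x. 0 \<le> x \<Longrightarrow> x \<le> 1 \<Longrightarrow> \<bar>eval_fps Qr x - (eval_fps Qr 1 - \<eta> * sqrt (1 - x))\<bar> \<le> K * (1 - x)"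
    by (rule sqrt_class_puiseux[OF assms]) (rule that)
  have "(\<lambda>z. Qfun p q z - (Qfun p q (rho p) - \<eta> * sqrt (1 - z / rho p))) \<in> O[at_left (rho p)](\<lambda>z. 1 - z / rho p)"
  proof (rule bigoI[where c = K])
    have "eventually (\<lambda>z. z \<in> {0<..<rho p}) (at_left (rho p))"
      by (rule eventually_at_left_real[OF rho_pos])
    then show "eventually (\<lambda>z. norm (Qfun p q z - (Qfun p q (rho p) - \<eta> * sqrt (1 - z / rho p))) \<le> K * norm (1 - z / rho p)) (at_left (rho p))"
    proof eventually_elim
      case (elim z)
      then have z: "0 \<le> z / rho p" "z / rho p \<le> 1" by auto
      show ?case using K[OF z] z rho_pos by (simp add: Qf)
    qed
  qed
  moreover have "(\<lambda>n. qn n * rho p ^ n) = fps_nth Qr" by (rule ext) (simp add: Qr_nth)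
  then have "summable (\<lambda>n. qn n * rho p ^ n)" using sm by simp
  ultimately show "puiseux_eta p q \<eta>" by (simp add: puiseux_eta_def)
qed

lemma Dfps_rescaled: "fps_nth (Dfps p q) n = (1 / rho p) ^ n * fps_nth (inverse (1 - Qr)) n"
proof -
  have "rescale (rho p) (Dfps p q) = inverse (1 - Qr)"
    unfolding Dfps_def by (subst rescale_inverse) (simp_all add: Qfps_0 rescale_diff Qr_def)
  then have "fps_nth (inverse (1 - Qr)) n = fps_nth (Dfps p q) n * rho p ^ n" by (metis rescale_nth)
  then show ?thesis using rho_pos by (simp add: power_one_over)
qed

text \<open>Passing from 1 / (1 - Q) to r / eta, and from the coefficient r_n to 1 / sqrt (pi n),
  costs O(n^(-3/2)) each, that is a relative error O(1/n).\<close>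

lemma critical_case:
  assumes ex: "rho0_exists p q" and eq: "rho0 p q = rho p"
  shows "\<exists>eta. puiseux_eta p q eta \<and>
    (\<lambda>n. fps_nth (Dfps p q) n - (1 / rho p) ^ n / (eta * sqrt (pi * real n)))
      \<in> O(\<lambda>n. (1 / rho p) ^ n / (eta * sqrt (pi * real n)) / real n)"
proof -
  have dr: "drift p < 0" using drift_neg ex eq by blast
  obtain b where b: "sqrt_class b Qr" using Qr_class[OF dr] by blast
  define \<eta> where "\<eta> = - b"
  have \<eta>: "\<eta> > 0" using Qr_class_neg[OF b] by (simp add: \<eta>_def)
  have cl: "sqrt_class (- \<eta>) Qr" using b by (simp add: \<eta>_def)
  have "(\<lambda>n. qn n * rho p ^ n) sums 1" using rho0_in_set[OF ex] eq by (simp add: rho0_set_def)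
  moreover have "(\<lambda>n. qn n * rho p ^ n) = fps_nth Qr" by (rule ext) (simp add: Qr_nth)
  ultimately have s1: "fps_nth Qr sums 1" by simp
  have "decay (3/2) (inverse (1 - Qr) - fps_const (1 / \<eta>) * inv_sqrt_fps)"
  proof (rule square_root_pole[OF cl \<eta> _ s1, of "c + 2"])
    show "fps_nth Qr n \<ge> 0" for n using qn_nonneg rho_pos by (simp add: Qr_nth)
    show "fps_nth Qr n > 0" if "n \<ge> c + 2" for n using qn_pos[OF that] rho_pos by (simp add: Qr_nth)
    show "fps_nth Qr 0 = 0" by (simp add: Qr_nth Qfps_0)
  qed
  then obtain C where C: "C > 0" "\<And>n. norm (fps_nth (inverse (1 - Qr) - fps_const (1 / \<eta>) * inv_sqrt_fps) n) \<le> C * (real n + 1) powr - (3/2)"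
    by (elim decayE) blast
  have "(\<lambda>n. fps_nth (Dfps p q) n - (1 / rho p) ^ n / (\<eta> * sqrt (pi * real n)))
      \<in> O(\<lambda>n. (1 / rho p) ^ n / (\<eta> * sqrt (pi * real n)) / real n)"
  proof (rule bigoI[where c = "(C + 1 / \<eta>) * (\<eta> * sqrt pi)"], rule eventually_sequentiallyI[of 1])
    fix n :: nat assume n: "n \<ge> 1"
    define r where "r = fps_nth inv_sqrt_fps n"
    define D where "D = fps_nth (inverse (1 - Qr)) n"
    have 1: "\<bar>D - r / \<eta>\<bar> \<le> C / (real n * sqrt (real n))"
    proof -
      have "\<bar>D - r / \<eta>\<bar> \<le> C * (real n + 1) powr - (3/2)" using C(2)[of n] by (simp add: D_def r_def)
      also have "\<dots> \<le> C * real n powr - (3/2)" using C(1) n by (intro mult_left_mono powr_mono2') auto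
      finally show ?thesis by (simp add: powr_minus_three_halves[OF n])
    qed
    have "\<bar>r / \<eta> - 1 / (\<eta> * sqrt (pi * real n))\<bar> = (1 / \<eta>) * \<bar>r - 1 / sqrt (pi * real n)\<bar>"
    proof -
      have "r / \<eta> - 1 / (\<eta> * sqrt (pi * real n)) = (1 / \<eta>) * (r - 1 / sqrt (pi * real n))"
        by (simp add: right_diff_distrib)
      then show ?thesis using \<eta> by (simp only: abs_mult) simp
    qed
    also have "\<dots> \<le> (1 / \<eta>) * (1 / (real n * sqrt (real n)))"
      unfolding r_def powr_minus_three_halves[OF n, symmetric] using \<eta> n by (intro mult_left_mono inv_sqrt_fps_approx) auto
    finally have 2: "\<bar>D - 1 / (\<eta> * sqrt (pi * real n))\<bar> \<le> (C + 1 / \<eta>) / (real n * sqrt (real n))"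
      using 1 by (simp add: add_divide_distrib)
    have "fps_nth (Dfps p q) n - (1 / rho p) ^ n / (\<eta> * sqrt (pi * real n)) = (1 / rho p) ^ n * (D - 1 / (\<eta> * sqrt (pi * real n)))"
      unfolding Dfps_rescaled D_def by (simp add: right_diff_distrib)
    then have "norm (fps_nth (Dfps p q) n - (1 / rho p) ^ n / (\<eta> * sqrt (pi * real n))) = (1 / rho p) ^ n * \<bar>D - 1 / (\<eta> * sqrt (pi * real n))\<bar>"
      using rho_pos by (simp add: abs_mult)
    also have "\<dots> \<le> (1 / rho p) ^ n * ((C + 1 / \<eta>) / (real n * sqrt (real n)))"
      using rho_pos by (intro mult_left_mono 2) auto
    also have "\<dots> = (C + 1 / \<eta>) * (\<eta> * sqrt pi) * ((1 / rho p) ^ n / (\<eta> * sqrt (pi * real n)) / real n)"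
    proof -
      have "x * (y / (N * s)) = y * (\<eta> * P) * (x / (\<eta> * (P * s)) / N)" if "P \<noteq> 0" for x y N s P :: real
        using that \<eta> by (simp add: mult.commute)
      then show ?thesis unfolding real_sqrt_mult by simp
    qed
    also have "\<dots> = (C + 1 / \<eta>) * (\<eta> * sqrt pi) * norm ((1 / rho p) ^ n / (\<eta> * sqrt (pi * real n)) / real n)"
      using rho_pos \<eta> by simp
    finally show "norm (fps_nth (Dfps p q) n - (1 / rho p) ^ n / (\<eta> * sqrt (pi * real n)))
      \<le> (C + 1 / \<eta>) * (\<eta> * sqrt pi) * norm ((1 / rho p) ^ n / (\<eta> * sqrt (pi * real n)) / real n)" .
  qed
  then show ?thesis using puiseux_Qr(1)[OF cl] by blast
qed

text \<open>If Q(rho) = 1 then rho is a root, and if Q(rho) > 1 the crossing lemma gives a root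
  before rho; either would put a point into \<open>rho0_set\<close>.\<close>

lemma Qr_sum_less_1:
  assumes nex: "\<not> rho0_exists p q" and sm: "summable (fps_nth Qr)"
  shows "eval_fps Qr 1 < 1"
proof (rule ccontr)
  assume "\<not> ?thesis"
  then have ge: "(\<Sum>n. fps_nth Qr n) \<ge> 1" by (simp add: eval_fps_def)
  have eq: "(\<lambda>n. qn n * rho p ^ n) = fps_nth Qr" by (rule ext) (simp add: Qr_nth)
  have "\<exists>z. z \<in> rho0_set p q"
  proof (cases "(\<Sum>n. fps_nth Qr n) = 1")
    case True
    then have "fps_nth Qr sums 1" using summable_sums[OF sm] by simp
    then show ?thesis using rho_pos by (intro exI[of _ "rho p"]) (simp add: rho0_set_def eq)
  next
    case False
    then have "1 < (\<Sum>n. fps_nth Qr n)" using ge by simp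
    then have "eventually (\<lambda>N. 1 < (\<Sum>n<N. fps_nth Qr n)) sequentially"
      by (rule order_tendstoD(1)[OF summable_LIMSEQ[OF sm]])
    then obtain N where "1 < (\<Sum>n<N. fps_nth Qr n)" by (auto simp: eventually_sequentially)
    then have N: "1 < (\<Sum>n<N. qn n * rho p ^ n)" by (simp add: Qr_nth)
    obtain z where "0 < z" "z < rho p" "(\<lambda>n. qn n * z ^ n) sums 1"
    proof (rule nonneg_series_crosses_1[OF qn_nonneg Qfps_0 rho_pos _ N])
      fix y assume y: "0 < y" "y < rho p"
      show "summable (\<lambda>n. qn n * y ^ n)"
      proof (rule summable_comparison_test'[OF sm])
        fix n
        have "qn n * y ^ n \<le> qn n * rho p ^ n" using y by (intro mult_left_mono power_mono qn_nonneg) auto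
        then show "norm (qn n * y ^ n) \<le> fps_nth Qr n" using y qn_nonneg[of n] by (simp add: Qr_nth)
      qed
    qed
    then show ?thesis by (intro exI[of _ z]) (simp add: rho0_set_def)
  qed
  then show False using nex by (auto simp: rho0_exists_def)
qed

text \<open>Non-negative coefficients give |Q| <= Q(rho) < 1 on the closed disc, so
  \<open>sqrt_class_inverse\<close> applies to 1 - Q. It multiplies the singular coefficient by - 1
  / (1 - Q(rho))^2, which is the origin of the factor D(rho)^2.\<close>

lemma supercritical_case:
  assumes nex: "\<not> rho0_exists p q"
  shows "\<exists>eta. puiseux_eta p q eta \<and>
    (\<lambda>n. fps_nth (Dfps p q) n - (1 / (1 - Qfun p q (rho p)))\<^sup>2 * eta * (1 / rho p) ^ n / (2 * sqrt (pi * real n ^ 3)))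
      \<in> O(\<lambda>n. (1 / (1 - Qfun p q (rho p)))\<^sup>2 * eta * (1 / rho p) ^ n / (2 * sqrt (pi * real n ^ 3)) / real n)"
proof -
  have dr: "drift p < 0" using drift_neg nex by blast
  obtain b where b: "sqrt_class b Qr" using Qr_class[OF dr] by blast
  define \<eta> where "\<eta> = - b"
  have \<eta>: "\<eta> > 0" using Qr_class_neg[OF b] by (simp add: \<eta>_def)
  have cl: "sqrt_class (- \<eta>) Qr" using b by (simp add: \<eta>_def)
  note P = puiseux_Qr[OF cl]
  define Q0 where "Q0 = eval_fps Qr 1"
  have Q0: "Q0 < 1" unfolding Q0_def by (rule Qr_sum_less_1[OF nex P(2)])
  have QrN: "fps_nth Qr n \<ge> 0" for n using qn_nonneg rho_pos by (simp add: Qr_nth)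
  have dQ: "decay (3/2) Qr" by (rule sqrt_class_decay[OF cl])
  have cl1: "sqrt_class \<eta> (1 - Qr)"
    using sqrt_class_diff[OF sqrt_class_of_decay[OF decay_1] cl] by simp
  have e1: "eval_fps (1 - Qr) 1 = 1 - Q0"
    unfolding Q0_def by (subst eval_fps_diff_decay[OF decay_1[of 2] _ dQ]) auto
  have "sqrt_class (- \<eta> / (eval_fps (1 - Qr) 1)\<^sup>2) (inverse (1 - Qr))"
  proof (rule sqrt_class_inverse[OF cl1])
    fix z :: complex assume z: "norm z \<le> 1"
    have cQ: "fps_complex (1 - Qr) = 1 - fps_complex Qr" by (rule fps_ext) auto
    have dc: "decay (3/2) (fps_complex Qr)" using dQ by (simp add: decay_def)
    have "eval_fps (fps_complex (1 - Qr)) z = 1 - eval_fps (fps_complex Qr) z"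
      unfolding cQ by (subst eval_fps_diff_decay[OF decay_1[of 2] _ dc]) (use z in auto)
    moreover have "norm (eval_fps (fps_complex Qr) z) \<le> Q0"
      unfolding Q0_def eval_fps_def power_one mult_1_right
    proof (rule norm_suminf_le[OF _ P(2)])
      fix n show "norm (fps_nth (fps_complex Qr) n * z ^ n) \<le> fps_nth Qr n"
        using z QrN[of n] by (simp add: norm_mult norm_power mult_left_le power_le_one)
    qed
    ultimately show "eval_fps (fps_complex (1 - Qr)) z \<noteq> 0" using Q0 by auto
  qed
  then have "sqrt_class (- ((1 / (1 - Q0))\<^sup>2 * \<eta>)) (inverse (1 - Qr))"
    by (simp add: e1 power_divide)
  moreover define \<beta> where "\<beta> = (1 / (1 - Q0))\<^sup>2 * \<eta>"
  ultimately have "decay (5/2) (inverse (1 - Qr) - fps_const (- \<beta>) * sqrt_fps)" by (simp add: sqrt_class_def)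
  then obtain C where C: "C > 0" "\<And>n. norm (fps_nth (inverse (1 - Qr) - fps_const (- \<beta>) * sqrt_fps) n) \<le> C * (real n + 1) powr - (5/2)"
    by (elim decayE) blast
  have \<beta>: "\<beta> > 0" using Q0 \<eta> by (simp add: \<beta>_def)
  have "(\<lambda>n. fps_nth (Dfps p q) n - \<beta> * (1 / rho p) ^ n / (2 * sqrt (pi * real n ^ 3)))
      \<in> O(\<lambda>n. \<beta> * (1 / rho p) ^ n / (2 * sqrt (pi * real n ^ 3)) / real n)"
  proof (rule bigoI[where c = "(C + \<beta>) * (2 * sqrt pi / \<beta>)"], rule eventually_sequentiallyI[of 1])
    fix n :: nat assume n: "n \<ge> 1"
    define t where "t = 1 / (2 * sqrt (pi * real n ^ 3))"
    define D where "D = fps_nth (inverse (1 - Qr)) n"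
    have 1: "\<bar>D - \<beta> * (- fps_nth sqrt_fps n)\<bar> \<le> C / ((real n)\<^sup>2 * sqrt (real n))"
    proof -
      have "\<bar>D - \<beta> * (- fps_nth sqrt_fps n)\<bar> \<le> C * (real n + 1) powr - (5/2)" using C(2)[of n] by (simp add: D_def)
      also have "\<dots> \<le> C * real n powr - (5/2)" using C(1) n by (intro mult_left_mono powr_mono2') auto
      finally show ?thesis by (simp add: powr_minus_five_halves[OF n])
    qed
    have "\<bar>\<beta> * (- fps_nth sqrt_fps n) - \<beta> * t\<bar> = \<beta> * \<bar>- fps_nth sqrt_fps n - t\<bar>"
      unfolding right_diff_distrib[symmetric] abs_mult using \<beta> by simp
    also have "\<dots> \<le> \<beta> * (1 / ((real n)\<^sup>2 * sqrt (real n)))"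
      unfolding t_def using \<beta> by (intro mult_left_mono sqrt_fps_approx n) auto
    finally have 2: "\<bar>D - \<beta> * t\<bar> \<le> (C + \<beta>) / ((real n)\<^sup>2 * sqrt (real n))"
      using 1 by (simp add: add_divide_distrib)
    have tn: "1 / ((real n)\<^sup>2 * sqrt (real n)) = (2 * sqrt pi) * (t / real n)"
    proof -
      have "sqrt (pi * real n ^ 3) = sqrt pi * (real n * sqrt (real n))"
        by (simp add: real_sqrt_mult power3_eq_cube)
      then show ?thesis by (simp add: t_def power2_eq_square)
    qed
    have "fps_nth (Dfps p q) n - \<beta> * (1 / rho p) ^ n / (2 * sqrt (pi * real n ^ 3)) = (1 / rho p) ^ n * (D - \<beta> * t)"
      unfolding Dfps_rescaled D_def t_def by (simp add: right_diff_distrib)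
    then have "norm (fps_nth (Dfps p q) n - \<beta> * (1 / rho p) ^ n / (2 * sqrt (pi * real n ^ 3))) = (1 / rho p) ^ n * \<bar>D - \<beta> * t\<bar>"
      using rho_pos by (simp add: abs_mult)
    also have "\<dots> \<le> (1 / rho p) ^ n * ((C + \<beta>) * (1 / ((real n)\<^sup>2 * sqrt (real n))))"
      using rho_pos 2 by (intro mult_left_mono) auto
    also have "\<dots> = (C + \<beta>) * (2 * sqrt pi / \<beta>) * (\<beta> * (1 / rho p) ^ n * t / real n)"
      unfolding tn using \<beta> by simp
    also have "\<beta> * (1 / rho p) ^ n * t / real n = norm (\<beta> * (1 / rho p) ^ n / (2 * sqrt (pi * real n ^ 3)) / real n)"
      using rho_pos \<beta> by (simp add: t_def)
    finally show "norm (fps_nth (Dfps p q) n - \<beta> * (1 / rho p) ^ n / (2 * sqrt (pi * real n ^ 3)))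
      \<le> (C + \<beta>) * (2 * sqrt pi / \<beta>) * norm (\<beta> * (1 / rho p) ^ n / (2 * sqrt (pi * real n ^ 3)) / real n)" .
  qed
  then show ?thesis using P(1) unfolding P(3) \<beta>_def Q0_def by blast
qed

end

theorem theorem4p3:
  fixes c d :: nat and p :: "int \<Rightarrow> real" and q :: real
  assumes "c \<ge> 1" and "d \<ge> 1"
    and "\<forall>i. p i \<ge> 0"
    and "\<forall>i. i < - int c \<or> i > int d \<longrightarrow> p i = 0"
    and "p (- int c) \<noteq> 0" and "p (int d) \<noteq> 0"
    and "aperiodic p"
    and "q > 0"
  defines "dn \<equiv> \<lambda>n. fps_nth (Dfps p q) n"
  shows
    "(rho0_exists p q \<and> rho0 p q < rho p \<longrightarrow>
        (\<exists>K. 0 < K \<and> K < 1 / rho0 p q \<and>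
           (\<lambda>n. dn n - (1 / rho0 p q) ^ n / (rho0 p q * Qder p q (rho0 p q)))
             \<in> o(\<lambda>n. K ^ n)))
     \<and> (rho0_exists p q \<and> rho0 p q = rho p \<longrightarrow>
        (\<exists>eta. puiseux_eta p q eta \<and>
           (\<lambda>n. dn n - (1 / rho p) ^ n / (eta * sqrt (pi * real n)))
             \<in> O(\<lambda>n. (1 / rho p) ^ n / (eta * sqrt (pi * real n)) / real n)))
     \<and> (\<not> rho0_exists p q \<longrightarrow>
        (\<exists>eta. puiseux_eta p q eta \<and>
           (\<lambda>n. dn n - (1 / (1 - Qfun p q (rho p)))\<^sup>2 * eta * (1 / rho p) ^ n
                        / (2 * sqrt (pi * real n ^ 3)))
             \<in> O(\<lambda>n. (1 / (1 - Qfun p q (rho p)))\<^sup>2 * eta * (1 / rho p) ^ n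
                        / (2 * sqrt (pi * real n ^ 3)) / real n)))
     \<and> ((rho0_exists p q \<and> rho0 p q = rho p) \<or> \<not> rho0_exists p q \<longrightarrow> drift p < 0)"
proof -
  interpret catastrophe_gf c d p q
    by unfold_locales (use assms in auto)
  show ?thesis
    unfolding dn_def
    using subcritical_pole critical_case supercritical_case drift_neg by blast
qed

end
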